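(* Let $0<\varrho<1$ and let $\{\omega_{ij}\}_{i,j\in\mathbb Z_+}$ be independent with $\omega_{00}=0$, $\omega_{i0}\sim\mathrm{Exp}(1-\varrho)$ for $i\ge1$, $\omega_{0j}\sim\mathrm{Exp}(\varrho)$ for $j\ge1$, and $\omega_{ij}\sim\mathrm{Exp}(1)$ for $i,j\ge1$. Let $Z^{*\varrho}(t)$ be the signed distance, defined in terms of the competition interface, associated with the point $(\lfloor(1-\varrho)^2t\rfloor,\lfloor\varrho^2t\rfloor)$. (a) For every $t_0>0$ there exists a finite constant $C=C(t_0,\varrho)$ such that, for all $a>0$ and $t\ge t_0$, \[ \mathbf P\{Z^{*\varrho}(t)\ge at^{2/3}\}\le Ca^{-3}. \] (b) For every $\varepsilon>0$ there is a $\delta>0$ such that for all large enough $t$, \[ \mathbf P\{1\le Z^{*\varrho}(t)\le\delta t^{2/3}\}\le\varepsilon. \]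
   Context: $\mathbb Z_+=\{0,1,2,\dots\}$; $\mathrm{Exp}(r)$ is the exponential distribution with rate $r$; $x^+=\max(x,0)$. The last-passage time $G_{ij}=G(i,j)$ is the maximum of $\sum_{(p,q)\in\pi}\omega_{pq}$ over all lattice paths $\pi$ from $(0,0)$ to $(i,j)$ with steps $(1,0)$ and $(0,1)$ (endpoints included). The competition interface is the (a.s. well-defined) path $k\mapsto\varphi_k\in\mathbb Z_+^2$, $k\in\mathbb Z_+$, given by $\varphi_0=(0,0)$ and $\varphi_{k+1}=\varphi_k+(1,0)$ if $G(\varphi_k+(1,0))<G(\varphi_k+(0,1))$, and $\varphi_{k+1}=\varphi_k+(0,1)$ if $G(\varphi_k+(1,0))>G(\varphi_k+(0,1))$. Define $v(n)=\inf\{i:(i,n)=\varphi_k\text{ for some }k\ge0\}$ and $w(m)=\inf\{j:(m,j)=\varphi_k\text{ for some }k\ge0\}$, with $\inf\emptyset=\infty$. For given $(m,n)$ put \[ Z^{*\varrho}=[m-v(n)]^+-[n-w(m)]^+, \] and let $Z^{*\varrho}(t)$ be this variable for $(m,n)=(\lfloor(1-\varrho)^2t\rfloor,\lfloor\varrho^2t\rfloor)$. *)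

theory Defs
  imports "HOL-Probability.Probability"
begin

definition lattice_step :: "nat \<times> nat \<Rightarrow> nat \<times> nat \<Rightarrow> bool" where
  "lattice_step p q \<longleftrightarrow> q = p + (1, 0) \<or> q = p + (0, 1)"

definition lattice_paths :: "nat \<times> nat \<Rightarrow> (nat \<times> nat) list set" where
  "lattice_paths p =
     {\<pi>. \<pi> \<noteq> [] \<and> hd \<pi> = (0, 0) \<and> last \<pi> = p \<and> successively lattice_step \<pi>}"

definition last_passage :: "(nat \<times> nat \<Rightarrow> real) \<Rightarrow> nat \<times> nat \<Rightarrow> real" where
  "last_passage \<omega> p = Max ((\<lambda>\<pi>. \<Sum>q\<leftarrow>\<pi>. \<omega> q) ` lattice_paths p)"

text \<open>
  The competition interface is determined by the weights only when
  \<open>G(\<phi>\<^sub>k + (1,0)) \<noteq> G(\<phi>\<^sub>k + (0,1))\<close> for all \<open>k\<close>, which holds almost surely for the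
  weights considered below. On the exceptional null set ties are resolved upwards,
  merely to obtain a total function.
\<close>

primrec competition_interface :: "(nat \<times> nat \<Rightarrow> real) \<Rightarrow> nat \<Rightarrow> nat \<times> nat" where
  "competition_interface \<omega> 0 = (0, 0)"
| "competition_interface \<omega> (Suc k) =
     (let p = competition_interface \<omega> k in
      if last_passage \<omega> (p + (1, 0)) < last_passage \<omega> (p + (0, 1))
      then p + (1, 0) else p + (0, 1))"

text \<open>In \<^typ>\<open>enat\<close>, the infimum of the empty set is \<open>\<infinity>\<close>.\<close>

definition interface_v :: "(nat \<times> nat \<Rightarrow> real) \<Rightarrow> nat \<Rightarrow> enat" where
  "interface_v \<omega> n = (INF i \<in> {i. \<exists>k. (i, n) = competition_interface \<omega> k}. enat i)"

definition interface_w :: "(nat \<times> nat \<Rightarrow> real) \<Rightarrow> nat \<Rightarrow> enat" where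
  "interface_w \<omega> m = (INF j \<in> {j. \<exists>k. (m, j) = competition_interface \<omega> k}. enat j)"

text \<open>
  Differences are formed in the extended reals, where \<open>m - \<infinity> = -\<infinity>\<close>. Both positive parts
  are finite, so the conversion back to the reals loses no information.
\<close>

definition Zstar :: "(nat \<times> nat \<Rightarrow> real) \<Rightarrow> nat \<Rightarrow> nat \<Rightarrow> real" where
  "Zstar \<omega> m n =
     real_of_ereal (max 0 (ereal (real m) - ereal_of_enat (interface_v \<omega> n)))
     - real_of_ereal (max 0 (ereal (real n) - ereal_of_enat (interface_w \<omega> m)))"

definition Zstar_at :: "real \<Rightarrow> (nat \<times> nat \<Rightarrow> real) \<Rightarrow> real \<Rightarrow> real" where
  "Zstar_at \<rho> \<omega> t = Zstar \<omega> (nat \<lfloor>(1 - \<rho>)\<^sup>2 * t\<rfloor>) (nat \<lfloor>\<rho>\<^sup>2 * t\<rfloor>)"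

locale stationary_lpp = prob_space M for M :: "'a measure" +
  fixes \<omega> :: "nat \<times> nat \<Rightarrow> 'a \<Rightarrow> real" and \<rho> :: real
  assumes weights_indep: "indep_vars (\<lambda>_. borel) \<omega> UNIV"
    and weight_origin: "AE x in M. \<omega> (0, 0) x = 0"
    and weight_horizontal:
      "\<And>i. i \<ge> 1 \<Longrightarrow> distributed M lborel (\<omega> (i, 0)) (exponential_density (1 - \<rho>))"
    and weight_vertical:
      "\<And>j. j \<ge> 1 \<Longrightarrow> distributed M lborel (\<omega> (0, j)) (exponential_density \<rho>)"
    and weight_bulk:
      "\<And>i j. i \<ge> 1 \<Longrightarrow> j \<ge> 1 \<Longrightarrow> distributed M lborel (\<omega> (i, j)) (exponential_density 1)"

text \<open>
  The maximum defining \<^const>\<open>last_passage\<close> is over a finite nonempty set, and the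
  events formed from \<^const>\<open>Zstar_at\<close> are measurable.
\<close>

lemma lattice_path_bounds:
  assumes "successively lattice_step \<pi>" "\<pi> \<noteq> []"
  shows "fst (last \<pi>) + snd (last \<pi>) + 1 = fst (hd \<pi>) + snd (hd \<pi>) + length \<pi>
    \<and> set \<pi> \<subseteq> {..fst (last \<pi>)} \<times> {..snd (last \<pi>)}"
  using assms
proof (induction \<pi> rule: induct_list012)
  case (3 x y zs)
  then have IH: "fst (last (y # zs)) + snd (last (y # zs)) + 1 = fst y + snd y + length (y # zs)"
    "set (y # zs) \<subseteq> {..fst (last (y # zs))} \<times> {..snd (last (y # zs))}"
    and st: "lattice_step x y" by auto
  have s: "fst y + snd y = fst x + snd x + 1" "fst x \<le> fst y" "snd x \<le> snd y"
    using st by (auto simp: lattice_step_def)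
  from IH(2) have "fst y \<le> fst (last (y # zs))" "snd y \<le> snd (last (y # zs))"
    by (auto simp: mem_Times_iff)
  with s have "x \<in> {..fst (last (y # zs))} \<times> {..snd (last (y # zs))}"
    by (auto simp: mem_Times_iff simp del: last.simps)
  with IH s show ?case by (simp del: last.simps add: last_ConsR)
qed (auto simp: mem_Times_iff)

lemma finite_lattice_paths: "finite (lattice_paths p)"
proof (rule finite_subset)
  show "lattice_paths p \<subseteq>
      {\<pi>. set \<pi> \<subseteq> {..fst p} \<times> {..snd p} \<and> length \<pi> = fst p + snd p + 1}"
    using lattice_path_bounds by (fastforce simp: lattice_paths_def)
qed (auto intro: finite_lists_length_eq)

lemma lattice_paths_nonempty: "lattice_paths (i, j) \<noteq> {}"
proof -
  have snoc: "\<pi> @ [q] \<in> lattice_paths q" if "\<pi> \<in> lattice_paths p" "lattice_step p q" for \<pi> p q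
    using that by (auto simp: lattice_paths_def successively_append_iff)
  have "\<exists>\<pi>. \<pi> \<in> lattice_paths (i, 0)"
  proof (induction i)
    case 0
    have "[(0, 0)] \<in> lattice_paths (0, 0)" by (simp add: lattice_paths_def)
    then show ?case by blast
  next
    case (Suc i)
    then show ?case using snoc[of _ "(i, 0)" "(Suc i, 0)"] by (auto simp: lattice_step_def)
  qed
  then have "\<exists>\<pi>. \<pi> \<in> lattice_paths (i, j)"
  proof (induction j)
    case (Suc j)
    then show ?case using snoc[of _ "(i, j)" "(i, Suc j)"] by (auto simp: lattice_step_def)
  qed
  then show ?thesis by blast
qed

context stationary_lpp
begin

lemma weights_measurable: "\<omega> p \<in> borel_measurable M"
  using weights_indep unfolding indep_vars_def by blast

lemma last_passage_measurable: "(\<lambda>x. last_passage (\<lambda>p. \<omega> p x) q) \<in> borel_measurable M"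
proof -
  have "(\<lambda>x. \<Sum>p\<leftarrow>\<pi>. \<omega> p x) \<in> borel_measurable M" for \<pi>
    by (induction \<pi>) (simp_all add: weights_measurable borel_measurable_add)
  then show ?thesis
    unfolding last_passage_def image_def
    using finite_lattice_paths[of q]
    by (intro borel_measurable_Max[of _ "\<lambda>\<pi> x. \<Sum>p\<leftarrow>\<pi>. \<omega> p x", unfolded image_def]) auto
qed

lemma competition_interface_measurable:
  "(\<lambda>x. competition_interface (\<lambda>p. \<omega> p x) k) \<in> measurable M (count_space UNIV)"
proof (induction k)
  case (Suc k)
  let ?G = "\<lambda>p x. last_passage (\<lambda>p. \<omega> p x) p"
  define f where "f p x = (if ?G (p + (1, 0)) x < ?G (p + (0, 1)) x then p + (1, 0) else p + (0, 1))"
    for p x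
  have "f p \<in> measurable M (count_space UNIV)" for p
    unfolding f_def using last_passage_measurable
    by (intro measurable_If borel_measurable_less measurable_const) auto
  then have "(\<lambda>x. f (competition_interface (\<lambda>p. \<omega> p x) k) x) \<in> measurable M (count_space UNIV)"
    using Suc by (rule measurable_compose_countable)
  then show ?case by (simp only: competition_interface.simps Let_def f_def)
qed simp

lemma Zstar_at_measurable: "(\<lambda>x. Zstar_at \<rho> (\<lambda>p. \<omega> p x) t) \<in> borel_measurable M"
proof -
  note [measurable] = competition_interface_measurable
  have [measurable]: "(\<lambda>x. INF i \<in> {i. \<exists>k. P i x k}. enat i) \<in> measurable M (count_space UNIV)"
    if [measurable]: "\<And>i k. Measurable.pred M (\<lambda>x. P i x k)" for P :: "nat \<Rightarrow> 'a \<Rightarrow> nat \<Rightarrow> bool"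
  proof -
    have "(INF i \<in> {i. \<exists>k. P i x k}. enat i) = (INF i. if \<exists>k. P i x k then enat i else \<infinity>)" for x
    proof (rule antisym)
      show "(INF i \<in> {i. \<exists>k. P i x k}. enat i) \<le> (INF i. if \<exists>k. P i x k then enat i else \<infinity>)"
        by (rule INF_greatest) (simp add: INF_lower)
      show "(INF i. if \<exists>k. P i x k then enat i else \<infinity>) \<le> (INF i \<in> {i. \<exists>k. P i x k}. enat i)"
      proof (rule INF_greatest)
        fix i assume "i \<in> {i. \<exists>k. P i x k}"
        then show "(INF i. if \<exists>k. P i x k then enat i else \<infinity>) \<le> enat i"
          by (intro INF_lower2[of i]) simp_all
      qed
    qed
    moreover have "(\<lambda>x. INF i. if \<exists>k. P i x k then enat i else \<infinity>) \<in> measurable M (count_space UNIV)"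
      by measurable
    ultimately show ?thesis by (simp only:)
  qed
  have [measurable]: "(\<lambda>x. interface_v (\<lambda>p. \<omega> p x) n) \<in> measurable M (count_space UNIV)" for n
    unfolding interface_v_def by measurable
  have [measurable]: "(\<lambda>x. interface_w (\<lambda>p. \<omega> p x) n) \<in> measurable M (count_space UNIV)" for n
    unfolding interface_w_def by measurable
  show ?thesis unfolding Zstar_at_def Zstar_def by measurable
qed

end

end

theory Submission
  imports Defs
begin

text \<open>
Write $G_h(i,j)$ for the largest weight of a path to $(i,j)$ that starts with a horizontal step and
$G_v(i,j)$ for the largest weight of one that starts with a vertical step, so that
$G = \max(G_h, G_v)$. The difference $D = G_h - G_v$ (\<open>exit_gap\<close>) increases in $i$ and decreases in
$j$, and the competition interface separates the region $D \ge 0$ on its right from the region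
$D \le 0$ above it (\<open>interface_invariant\<close>). Both claims therefore concern the sign of $D$ on the row
$n$: the event $Z^* \ge x$ forces $D(M,n) \ge 0$ for some $M \le m - x + 1$, and $1 \le Z^* \le u$ forces
$D(m-u,n) \le 0 \le D(m,n)$.

The tail. If the horizontal axis has rate $1-a$ and the vertical axis has rate $b$, then
$\mathbf E\, e^{(b-a)G(m,n)} = (b/a)^n ((1-a)/(1-b))^m$ (\<open>lpp_mgf\<close>): for $a = b$ the increments of $G$
along a column are independent exponentials (\<open>distr_col_shift\<close>), and changing the rate of the
horizontal axis is a change of density. Where $D \ge 0$ one has $G = G_h$, and $G_h$ does not see the
weights on the vertical axis. So $\mathbf P(D \ge 0)$ is at most
$(\mathbf E\, e^{-sG}\, \mathbf E\, e^{sG_h})^{1/2}$, and both factors are controlled by the formula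
after the rates of the axes have been adapted to each of them (\<open>exit_gap_bound\<close>). At distance $x$ from
the characteristic direction the choice of $s$ proportional to $x/t$ gives a bound of the form
$C e^{-c x^3/t^2}$ (\<open>exit_gap_tail\<close>), which for $x = a t^{2/3}$ is much smaller than $a^{-3}$.

The window. By stationarity $D(m-u,n) > 0$ has the same probability as the event that the maximal
path from the origin to $(m,n)$ leaves the horizontal axis beyond $u$. Hence
$D(m-u,n) \le 0 \le D(m,n)$ is at most as likely as the event that, among the paths starting
horizontally, one that leaves the axis at some $y \le u$ is optimal (\<open>gap_window_le_early_exit\<close>). The
weight of the best path that leaves at $z$ is $U_z + A_z$ with a random walk $U$ and an independent
bulk last-passage value $A_z$. The decrements of $A$ are dominated by the increments of a stationary
field of slightly larger parameter $\mu = \rho + K t^{-1/3}$, which are independent exponentials; the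
domination holds unless the endpoint lies on the wrong side of the characteristic of $\mu$, which is
unlikely by the first part. So an early exit makes a random walk with exponential steps and a drift
of order $-t^{-1/3}$ stay below a small multiple of $t^{1/3}$ for a time of order $t^{2/3}$, or makes
another one rise that high within the first $u$ steps (\<open>early_exit_bound\<close>). Because exponential laws
have no memory, the first probability can be computed almost exactly (\<open>walk_below_bound\<close>) and is
small; the second one is small because $u$ is (\<open>walk_above_bound\<close>).
\<close>

section \<open>Fields of independent exponential weights\<close>

abbreviation field_space :: "('i \<Rightarrow> real) measure" where
  "field_space \<equiv> PiM UNIV (\<lambda>_. borel)"

text \<open>
A rate that is not positive encodes the weight zero. In this way the origin is a coordinate like any
other.
\<close>

definition exp_law :: "real \<Rightarrow> real measure" where
  "exp_law r = (if r > 0 then density lborel (exponential_density r) else return borel 0)"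

definition exp_field :: "('i \<Rightarrow> real) \<Rightarrow> ('i \<Rightarrow> real) measure" where
  "exp_field r = PiM UNIV (\<lambda>p. exp_law (r p))"

lemma prob_space_exp_law [simp]: "prob_space (exp_law r)"
  by (auto simp: exp_law_def prob_space_exponential_density prob_space_return)

lemma sets_exp_law [simp, measurable_cong]: "sets (exp_law r) = sets borel"
  by (simp add: exp_law_def)

lemma space_exp_law [simp]: "space (exp_law r) = UNIV"
  by (simp add: exp_law_def)

lemma sets_exp_field [simp, measurable_cong]: "sets (exp_field r) = sets field_space"
  unfolding exp_field_def by (rule sets_PiM_cong) simp_all

lemma space_exp_field [simp]: "space (exp_field r) = UNIV"
  by (simp add: exp_field_def space_PiM)

lemma space_field_space [simp]: "space field_space = UNIV"
  by (simp add: space_PiM)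

lemma prob_space_exp_field [simp]: "prob_space (exp_field r)"
  unfolding exp_field_def by (rule prob_space_PiM) simp

lemma nn_integral_exp_law:
  assumes "r > 0" and [measurable]: "f \<in> borel_measurable borel"
  shows "(\<integral>\<^sup>+x. f x \<partial>exp_law r) = (\<integral>\<^sup>+x. ennreal (exponential_density r x) * f x \<partial>lborel)"
  using assms(1) unfolding exp_law_def by (simp add: nn_integral_density)

lemma box_in_field_space:
  fixes A :: "'i \<Rightarrow> real set"
  assumes "finite J" "\<And>j. j \<in> J \<Longrightarrow> A j \<in> sets borel"
  shows "{w. \<forall>j\<in>J. w j \<in> A j} \<in> sets field_space"
proof -
  have "{w. \<forall>j\<in>J. w j \<in> A j} = prod_emb UNIV (\<lambda>_. borel) J (Pi\<^sub>E J A)"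
    by (auto simp: prod_emb_def PiE_iff)
  then show ?thesis
    using assms by (simp add: sets_PiM_I)
qed

lemma emeasure_exp_field_box:
  assumes "finite J" "\<And>j. j \<in> J \<Longrightarrow> A j \<in> sets borel"
  shows "emeasure (exp_field r) {w. \<forall>j\<in>J. w j \<in> A j} = (\<Prod>j\<in>J. emeasure (exp_law (r j)) (A j))"
proof -
  have "{w. \<forall>j\<in>J. w j \<in> A j} = prod_emb UNIV (\<lambda>p. exp_law (r p)) J (Pi\<^sub>E J A)"
    by (auto simp: prod_emb_def PiE_iff)
  then show ?thesis
    unfolding exp_field_def using assms by (simp add: emeasure_PiM_emb)
qed

text \<open>
Boxes over finitely many coordinates generate the product sigma-algebra, so every identity in law
below reduces to a product formula for them.
\<close>

lemma exp_field_eqI: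
  assumes "sets P = sets field_space"
    and "\<And>J A. finite J \<Longrightarrow> (\<And>j. j \<in> J \<Longrightarrow> A j \<in> sets borel) \<Longrightarrow>
      emeasure P {w. \<forall>j\<in>J. w j \<in> A j} = (\<Prod>j\<in>J. emeasure (exp_law (r j)) (A j))"
  shows "P = exp_field r"
proof (rule sym, rule measure_eqI_PiM_infinite[where I = UNIV and M = "\<lambda>p. exp_law (r p)"])
  show "sets (exp_field r) = sets (PiM UNIV (\<lambda>p. exp_law (r p)))" by (simp add: exp_field_def)
  show "sets P = sets (PiM UNIV (\<lambda>p. exp_law (r p)))"
    using assms(1) by (simp flip: exp_field_def)
  interpret prob_space "exp_field r" by simp
  show "finite_measure (exp_field r)" by unfold_locales
  fix A and J :: "'a set" assume J: "finite J" and A: "\<And>i. i \<in> J \<Longrightarrow> A i \<in> sets (exp_law (r i))"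
  have "prod_emb UNIV (\<lambda>p. exp_law (r p)) J (Pi\<^sub>E J A) = {w. \<forall>j\<in>J. w j \<in> A j}"
    by (auto simp: prod_emb_def PiE_iff)
  then show "emeasure (exp_field r) (prod_emb UNIV (\<lambda>p. exp_law (r p)) J (Pi\<^sub>E J A))
      = emeasure P (prod_emb UNIV (\<lambda>p. exp_law (r p)) J (Pi\<^sub>E J A))"
    using J A assms(2) by (simp add: emeasure_exp_field_box)
qed

lemma sets_field_Collect: "Measurable.pred field_space P \<Longrightarrow> {w. P w} \<in> sets field_space"
  by (simp add: pred_def)

lemma measurable_field_map:
  assumes "\<And>p. (\<lambda>x. f x p) \<in> borel_measurable M"
  shows "f \<in> measurable M field_space"
  using assms by (intro measurable_PiM_single') (auto simp: space_PiM)

text \<open>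
Relabelling along an injection and rescaling the coordinates are the two ways in which fields with
different rates are coupled.
\<close>

lemma distr_exp_field_coordinatewise:
  fixes \<sigma> :: "'j \<Rightarrow> 'i"
  assumes [measurable]: "\<And>p. f p \<in> borel_measurable borel"
    and inj: "inj \<sigma>"
    and law: "\<And>p. distr (exp_law (r (\<sigma> p))) borel (f p) = exp_law (r' p)"
  shows "distr (exp_field r) field_space (\<lambda>w p. f p (w (\<sigma> p))) = exp_field r'"
proof (rule exp_field_eqI)
  have [measurable]: "(\<lambda>w p. f p (w (\<sigma> p))) \<in> measurable field_space field_space"
    by (rule measurable_field_map) measurable
  fix J :: "'j set" and A assume J: "finite J" and A: "\<And>j. j \<in> J \<Longrightarrow> A j \<in> sets (borel::real measure)"
  define B where "B q = f (the_inv \<sigma> q) -` A (the_inv \<sigma> q)" for q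
  have B: "B (\<sigma> j) \<in> sets borel" if "j \<in> J" for j
    using measurable_sets[OF assms(1) A[OF that]] inj by (simp add: B_def the_inv_f_f)
  have "emeasure (distr (exp_field r) field_space (\<lambda>w p. f p (w (\<sigma> p)))) {w. \<forall>j\<in>J. w j \<in> A j}
      = emeasure (exp_field r) {w. \<forall>q\<in>\<sigma> ` J. w q \<in> B q}"
    using inj box_in_field_space[OF J A]
    by (subst emeasure_distr) (auto simp: B_def the_inv_f_f intro!: arg_cong[where f = "emeasure _"])
  also have "\<dots> = (\<Prod>q\<in>\<sigma>`J. emeasure (exp_law (r q)) (B q))"
    using J B by (intro emeasure_exp_field_box) auto
  also have "\<dots> = (\<Prod>j\<in>J. emeasure (exp_law (r (\<sigma> j))) (B (\<sigma> j)))"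
    using inj by (subst prod.reindex) (auto simp: inj_on_def)
  also have "\<dots> = (\<Prod>j\<in>J. emeasure (exp_law (r' j)) (A j))"
  proof (rule prod.cong)
    fix j assume "j \<in> J"
    then show "emeasure (exp_law (r (\<sigma> j))) (B (\<sigma> j)) = emeasure (exp_law (r' j)) (A j)"
      using A inj by (simp add: law[symmetric] emeasure_distr B_def the_inv_f_f)
  qed simp
  finally show "emeasure (distr (exp_field r) field_space (\<lambda>w p. f p (w (\<sigma> p)))) {w. \<forall>j\<in>J. w j \<in> A j}
      = (\<Prod>j\<in>J. emeasure (exp_law (r' j)) (A j))" .
qed simp

lemma distr_exp_field_relabel:
  assumes "inj \<sigma>"
  shows "distr (exp_field r) field_space (\<lambda>w p. w (\<sigma> p)) = exp_field (\<lambda>p. r (\<sigma> p))"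
  using assms by (intro distr_exp_field_coordinatewise[where f = "\<lambda>_ x. x"])
    (auto intro!: distr_id2 simp: distr_id2)

lemma distr_exp_law_scale:
  assumes "c > 0"
  shows "distr (exp_law r) borel (\<lambda>x. c * x) = exp_law (r / c)"
proof (cases "r > 0")
  case True
  have rc: "r / c > 0" using True assms by simp
  show ?thesis
  proof (rule measure_eqI)
    fix X assume "X \<in> sets (distr (exp_law r) borel (\<lambda>x. c * x))"
    then have X[measurable]: "X \<in> sets borel" by simp
    have "emeasure (distr (exp_law r) borel (\<lambda>x. c * x)) X
        = (\<integral>\<^sup>+x. indicator X (c * x) \<partial>exp_law r)"
      by (subst nn_integral_indicator[symmetric], simp, subst nn_integral_distr) auto
    also have "\<dots> = (\<integral>\<^sup>+x. ennreal (exponential_density r x) * indicator X (c * x) \<partial>lborel)"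
      using True by (intro nn_integral_exp_law) auto
    also have "\<dots> = (\<integral>\<^sup>+x. ennreal c * (ennreal (exponential_density (r / c) (c * x)) * indicator X (c * x)) \<partial>lborel)"
    proof (intro nn_integral_cong)
      fix x :: real
      have "exponential_density r x = c * exponential_density (r / c) (c * x)"
        using assms by (auto simp: exponential_density_def mult_less_0_iff)
      then show "ennreal (exponential_density r x) * indicator X (c * x)
        = ennreal c * (ennreal (exponential_density (r / c) (c * x)) * indicator X (c * x))"
        using assms by (simp add: ennreal_mult' mult.assoc)
    qed
    also have "\<dots> = ennreal c * (\<integral>\<^sup>+x. ennreal (exponential_density (r / c) (c * x)) * indicator X (c * x) \<partial>lborel)"
      by (rule nn_integral_cmult) simp
    also have "\<dots> = (\<integral>\<^sup>+x. ennreal (exponential_density (r / c) x) * indicator X x \<partial>lborel)"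
      using nn_integral_real_affine[of "\<lambda>x. ennreal (exponential_density (r / c) x) * indicator X x" c 0] assms
      by simp
    also have "\<dots> = emeasure (exp_law (r / c)) X"
      using nn_integral_exp_law[OF rc, of "indicator X"] by simp
    finally show "emeasure (distr (exp_law r) borel (\<lambda>x. c * x)) X = emeasure (exp_law (r / c)) X" .
  qed simp
next
  case False
  then have "\<not> r / c > 0" using assms by (simp add: zero_less_divide_iff)
  with False show ?thesis by (simp add: exp_law_def distr_return)
qed

lemma fun_upd_measurable [measurable]:
  "(\<lambda>(x, w). w(p := x)) \<in> measurable (borel \<Otimes>\<^sub>M field_space) field_space"
  by (rule measurable_field_map) (auto simp: case_prod_beta fun_upd_def)

text \<open>
Independence in operational form: replacing one coordinate by an independent sample changes only its
rate. Integrals over a field can thus be computed one coordinate at a time.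
\<close>

lemma exp_field_resample:
  fixes r :: "'i \<Rightarrow> real"
  shows
  "distr (exp_law a \<Otimes>\<^sub>M exp_field r) field_space (\<lambda>(x, w). w(p := x)) = exp_field (r(p := a))"
proof (rule exp_field_eqI)
  interpret I: prob_space "exp_field r" by simp
  interpret L: prob_space "exp_law a" by simp
  fix J :: "'i set" and A assume J: "finite J" and A: "\<And>j. j \<in> J \<Longrightarrow> A j \<in> sets (borel::real measure)"
  define B where "B = (if p \<in> J then A p else UNIV)"
  have B[measurable]: "B \<in> sets borel" using A by (simp add: B_def)
  have [measurable]: "(\<lambda>(x, w). w(p := x)) \<in> measurable (exp_law a \<Otimes>\<^sub>M exp_field r) field_space"
    by measurable
  have "emeasure (distr (exp_law a \<Otimes>\<^sub>M exp_field r) field_space (\<lambda>(x, w). w(p := x))) {w. \<forall>j\<in>J. w j \<in> A j}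
      = emeasure (exp_law a \<Otimes>\<^sub>M exp_field r) (B \<times> {w. \<forall>j\<in>J - {p}. w j \<in> A j})"
    using box_in_field_space[OF J A]
    by (subst emeasure_distr) (auto simp: B_def space_pair_measure intro!: arg_cong[where f = "emeasure _"] split: if_splits)
  also have "\<dots> = emeasure (exp_law a) B * (\<Prod>j\<in>J-{p}. emeasure (exp_law (r j)) (A j))"
    using J A box_in_field_space[of "J - {p}" A] emeasure_exp_field_box[of "J - {p}" A r]
    by (subst I.emeasure_pair_measure_Times) auto
  also have "(\<Prod>j\<in>J-{p}. emeasure (exp_law (r j)) (A j)) = (\<Prod>j\<in>J-{p}. emeasure (exp_law ((r(p := a)) j)) (A j))"
    by (rule prod.cong) auto
  also have "emeasure (exp_law a) B * \<dots> = (\<Prod>j\<in>J. emeasure (exp_law ((r(p := a)) j)) (A j))"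
    using J L.emeasure_space_1 by (cases "p \<in> J") (auto simp: B_def prod.remove)
  finally show "emeasure (distr (exp_law a \<Otimes>\<^sub>M exp_field r) field_space (\<lambda>(x, w). w(p := x))) {w. \<forall>j\<in>J. w j \<in> A j}
    = (\<Prod>j\<in>J. emeasure (exp_law ((r(p := a)) j)) (A j))" .
qed simp

lemma nn_integral_exp_field_resample:
  assumes [measurable]: "g \<in> borel_measurable field_space"
  shows "(\<integral>\<^sup>+w. g w \<partial>exp_field (r(p := a))) = (\<integral>\<^sup>+x. \<integral>\<^sup>+w. g (w(p := x)) \<partial>exp_field r \<partial>exp_law a)"
proof -
  interpret I: prob_space "exp_field r" by simp
  have [measurable]: "(\<lambda>(x, w). w(p := x)) \<in> measurable (exp_law a \<Otimes>\<^sub>M exp_field r) field_space"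
    by measurable
  have "(\<integral>\<^sup>+w. g w \<partial>exp_field (r(p := a)))
     = (\<integral>\<^sup>+w. g w \<partial>distr (exp_law a \<Otimes>\<^sub>M exp_field r) field_space (\<lambda>(x, w). w(p := x)))"
    by (simp only: exp_field_resample)
  also have "\<dots> = (\<integral>\<^sup>+z. g ((snd z)(p := fst z)) \<partial>(exp_law a \<Otimes>\<^sub>M exp_field r))"
    by (subst nn_integral_distr) (auto simp: case_prod_beta)
  also have "\<dots> = (\<integral>\<^sup>+x. \<integral>\<^sup>+w. g (w(p := x)) \<partial>exp_field r \<partial>exp_law a)"
    by (subst I.nn_integral_fst[symmetric]) (auto simp: case_prod_beta)
  finally show ?thesis .
qed

lemma nn_integral_exp_field_resample_same:
  assumes "g \<in> borel_measurable field_space"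
  shows "(\<integral>\<^sup>+w. g w \<partial>exp_field r) = (\<integral>\<^sup>+x. \<integral>\<^sup>+w. g (w(p := x)) \<partial>exp_field r \<partial>exp_law (r p))"
  using nn_integral_exp_field_resample[OF assms, of r p "r p"] by simp

lemma exp_field_sum_type:
  fixes r1 :: "'a \<Rightarrow> real" and r2 :: "'b \<Rightarrow> real"
  shows
  "exp_field (case_sum r1 r2) =
     distr (exp_field r1 \<Otimes>\<^sub>M exp_field r2) field_space (\<lambda>(x, y). case_sum x y)"
proof (rule sym, rule exp_field_eqI)
  interpret I: prob_space "exp_field r2" by simp
  have [measurable]: "(\<lambda>(x, y). case_sum x y) \<in> measurable (exp_field r1 \<Otimes>\<^sub>M exp_field r2) field_space"
  proof (rule measurable_field_map)
    show "(\<lambda>z. (case z of (x, y) \<Rightarrow> case_sum x y) p) \<in> borel_measurable (exp_field r1 \<Otimes>\<^sub>M exp_field r2)" for p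
      by (cases p) (auto simp: case_prod_beta)
  qed
  fix J :: "('a + 'b) set" and A assume J: "finite J" and A: "\<And>j. j \<in> J \<Longrightarrow> A j \<in> sets (borel::real measure)"
  let ?J1 = "Inl -` J" and ?J2 = "Inr -` J"
  have fin: "finite ?J1" "finite ?J2" using J by (auto intro: finite_vimageI)
  have JJ: "J = Inl ` ?J1 \<union> Inr ` ?J2" by (auto simp: image_iff) (metis sum.exhaust)
  have "emeasure (distr (exp_field r1 \<Otimes>\<^sub>M exp_field r2) field_space (\<lambda>(x, y). case_sum x y)) {w. \<forall>j\<in>J. w j \<in> A j}
     = emeasure (exp_field r1 \<Otimes>\<^sub>M exp_field r2)
         ({w. \<forall>j\<in>?J1. w j \<in> A (Inl j)} \<times> {w. \<forall>j\<in>?J2. w j \<in> A (Inr j)})"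
    using box_in_field_space[OF J A]
    by (subst emeasure_distr) (auto simp: space_pair_measure intro!: arg_cong[where f = "emeasure _"] split: sum.splits)
  also have "\<dots> = (\<Prod>j\<in>?J1. emeasure (exp_law (r1 j)) (A (Inl j))) * (\<Prod>j\<in>?J2. emeasure (exp_law (r2 j)) (A (Inr j)))"
    using fin A box_in_field_space[of ?J1 "\<lambda>j. A (Inl j)"] box_in_field_space[of ?J2 "\<lambda>j. A (Inr j)"]
      emeasure_exp_field_box[of ?J1 "\<lambda>j. A (Inl j)" r1] emeasure_exp_field_box[of ?J2 "\<lambda>j. A (Inr j)" r2]
    by (subst I.emeasure_pair_measure_Times) auto
  also have "\<dots> = (\<Prod>j\<in>J. emeasure (exp_law (case_sum r1 r2 j)) (A j))"
  proof -
    have "(\<Prod>j\<in>Inl ` ?J1 \<union> Inr ` ?J2. emeasure (exp_law (case_sum r1 r2 j)) (A j))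
      = (\<Prod>j\<in>?J1. emeasure (exp_law (r1 j)) (A (Inl j))) * (\<Prod>j\<in>?J2. emeasure (exp_law (r2 j)) (A (Inr j)))"
      using fin by (subst prod.union_disjoint) (auto simp: prod.reindex simp del: image_vimage_eq)
    then show ?thesis using JJ by simp
  qed
  finally show "emeasure (distr (exp_field r1 \<Otimes>\<^sub>M exp_field r2) field_space (\<lambda>(x, y). case_sum x y)) {w. \<forall>j\<in>J. w j \<in> A j}
     = (\<Prod>j\<in>J. emeasure (exp_law (case_sum r1 r2 j)) (A j))" .
qed simp

lemma AE_exp_law_nonneg: "AE x in exp_law r. 0 \<le> x"
proof (cases "r > 0")
  case True
  then show ?thesis
    unfolding exp_law_def by (auto simp: AE_density exponential_density_def)
next
  case False
  have "(AE x in return borel (0::real). 0 \<le> x) \<longleftrightarrow> 0 \<le> (0::real)" by (rule AE_return) auto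
  moreover have "exp_law r = return borel 0" using False by (simp add: exp_law_def)
  ultimately show ?thesis by (simp only: simp_thms order_refl)
qed

lemma AE_exp_field_component:
  assumes "AE x in exp_law (r p). P x"
  shows "AE w in exp_field r. P (w p)"
  unfolding exp_field_def by (rule AE_PiM_component) (use assms in auto)

lemma AE_exp_field_nonneg:
  fixes r :: "'i::countable \<Rightarrow> real"
  shows "AE w in exp_field r. \<forall>p. 0 \<le> w p"
  unfolding AE_all_countable by (auto intro: AE_exp_field_component AE_exp_law_nonneg)

lemma AE_exp_field_zero:
  assumes "\<not> r p > 0"
  shows "AE w in exp_field r. w p = 0"
proof (rule AE_exp_field_component)
  have "(AE x in return borel (0::real). x = 0) \<longleftrightarrow> 0 = (0::real)" by (rule AE_return) auto
  moreover have "exp_law (r p) = return borel 0" using assms by (simp add: exp_law_def)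
  ultimately show "AE x in exp_law (r p). x = 0" by (simp only: simp_thms)
qed

lemma nn_integral_exp_law_tilt:
  assumes "a > 0" "a + s > 0" and [measurable]: "f \<in> borel_measurable borel"
  shows "(\<integral>\<^sup>+x. ennreal (exp (- s * x)) * f x \<partial>exp_law a) = ennreal (a / (a + s)) * (\<integral>\<^sup>+x. f x \<partial>exp_law (a + s))"
proof -
  have "(\<integral>\<^sup>+x. ennreal (exp (- s * x)) * f x \<partial>exp_law a)
      = (\<integral>\<^sup>+x. ennreal (a / (a + s)) * (ennreal (exponential_density (a + s) x) * f x) \<partial>lborel)"
  proof (subst nn_integral_exp_law, fact, measurable, intro nn_integral_cong)
    fix x :: real
    have "exponential_density a x * exp (- s * x) = (a / (a + s)) * exponential_density (a + s) x"
      using assms by (auto simp: exponential_density_def field_simps exp_add[symmetric])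
    then show "ennreal (exponential_density a x) * (ennreal (exp (- s * x)) * f x) =
        ennreal (a / (a + s)) * (ennreal (exponential_density (a + s) x) * f x)"
      using assms by (simp add: mult.assoc[symmetric] ennreal_mult''[symmetric] ennreal_mult'[symmetric])
  qed
  also have "\<dots> = ennreal (a / (a + s)) * (\<integral>\<^sup>+x. f x \<partial>exp_law (a + s))"
    using assms by (subst nn_integral_cmult) (auto simp: nn_integral_exp_law)
  finally show ?thesis .
qed

lemma measurable_fun_upd_const [measurable]:
  "(\<lambda>w. w(p := x)) \<in> measurable field_space field_space"
  by (rule measurable_field_map) (auto simp: fun_upd_def)

text \<open>
An exponential factor in one coordinate changes the density of its law into that of another
exponential law.
\<close>

lemma nn_integral_exp_field_tilt:
  assumes "r p > 0" "r p + s > 0" and [measurable]: "g \<in> borel_measurable field_space"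
  shows "(\<integral>\<^sup>+w. ennreal (exp (- s * w p)) * g w \<partial>exp_field r)
    = ennreal (r p / (r p + s)) * (\<integral>\<^sup>+w. g w \<partial>exp_field (r(p := r p + s)))"
proof -
  interpret I: prob_space "exp_field r" by simp
  have 1: "(\<lambda>z. g ((snd z)(p := fst z))) \<in> borel_measurable (borel \<Otimes>\<^sub>M exp_field r)"
    using measurable_compose[OF fun_upd_measurable assms(3), of p] 
    by (simp add: case_prod_beta cong: measurable_cong_sets)
  have 2[measurable]: "(\<lambda>x. \<integral>\<^sup>+w. g (w(p := x)) \<partial>exp_field r) \<in> borel_measurable borel"
    using I.borel_measurable_nn_integral_fst[OF 1] by simp
  have m: "(\<lambda>w. g (w(p := x))) \<in> borel_measurable (exp_field r)" for x
    using measurable_compose[OF measurable_fun_upd_const assms(3), of p x]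
    by (simp cong: measurable_cong_sets)
  have "(\<integral>\<^sup>+w. ennreal (exp (- s * w p)) * g w \<partial>exp_field r)
     = (\<integral>\<^sup>+w. ennreal (exp (- s * w p)) * g w \<partial>exp_field (r(p := r p)))" by simp
  also have "\<dots> = (\<integral>\<^sup>+x. \<integral>\<^sup>+w. ennreal (exp (- s * x)) * g (w(p := x)) \<partial>exp_field r \<partial>exp_law (r p))"
    by (subst nn_integral_exp_field_resample) simp_all
  also have "\<dots> = (\<integral>\<^sup>+x. ennreal (exp (- s * x)) * (\<integral>\<^sup>+w. g (w(p := x)) \<partial>exp_field r) \<partial>exp_law (r p))"
    by (subst nn_integral_cmult) (use m in auto)
  also have "\<dots> = ennreal (r p / (r p + s)) * (\<integral>\<^sup>+x. \<integral>\<^sup>+w. g (w(p := x)) \<partial>exp_field r \<partial>exp_law (r p + s))"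
    using assms(1,2) by (rule nn_integral_exp_law_tilt) measurable
  also have "\<dots> = ennreal (r p / (r p + s)) * (\<integral>\<^sup>+w. g w \<partial>exp_field (r(p := r p + s)))"
    by (subst nn_integral_exp_field_resample) simp_all
  finally show ?thesis .
qed

lemma nn_integral_lborel_shift:
  fixes t :: real
  assumes "f \<in> borel_measurable borel"
  shows "(\<integral>\<^sup>+x. f (x + t) \<partial>lborel) = (\<integral>\<^sup>+x. f x \<partial>lborel)"
  using nn_integral_real_affine[of f 1 t] assms by (simp add: add.commute)

text \<open>
The map $(x,y,z) \mapsto (z+(x-y)^+, z+(y-x)^+, \min(x,y))$ preserves volume: in terms of $y$,
$d = x - y$ and $z$ it only performs translations, by $\min(d,0)$ in $y$, by $\max(0,-d)$ in $z$ and
finally by $z$ in $d$.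
\<close>

lemma lborel3_queue:
  fixes h :: "real \<times> real \<times> real \<Rightarrow> ennreal"
  assumes [measurable]: "h \<in> borel_measurable borel"
  shows "(\<integral>\<^sup>+x. \<integral>\<^sup>+y. \<integral>\<^sup>+z. h (z + max 0 (x - y), z + max 0 (y - x), min x y) \<partial>lborel \<partial>lborel \<partial>lborel)
    = (\<integral>\<^sup>+x. \<integral>\<^sup>+y. \<integral>\<^sup>+z. h (x, y, z) \<partial>lborel \<partial>lborel \<partial>lborel)"
proof -
  have [measurable]: "h \<in> borel_measurable (borel \<Otimes>\<^sub>M borel \<Otimes>\<^sub>M borel)"
    using assms by (simp add: borel_prod)
  have "(\<integral>\<^sup>+x. \<integral>\<^sup>+y. \<integral>\<^sup>+z. h (z + max 0 (x - y), z + max 0 (y - x), min x y) \<partial>lborel \<partial>lborel \<partial>lborel)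
     = (\<integral>\<^sup>+y. \<integral>\<^sup>+x. \<integral>\<^sup>+z. h (z + max 0 (x - y), z + max 0 (y - x), min x y) \<partial>lborel \<partial>lborel \<partial>lborel)"
    by (rule lborel_pair.Fubini') measurable
  also have "\<dots> = (\<integral>\<^sup>+y. \<integral>\<^sup>+d. \<integral>\<^sup>+z. h (z + max 0 d, z + max 0 (- d), y + min d 0) \<partial>lborel \<partial>lborel \<partial>lborel)"
  proof (rule nn_integral_cong)
    fix y :: real
    have "(\<integral>\<^sup>+x. \<integral>\<^sup>+z. h (z + max 0 (x - y), z + max 0 (y - x), min x y) \<partial>lborel \<partial>lborel)
      = (\<integral>\<^sup>+d. \<integral>\<^sup>+z. h (z + max 0 ((d + y) - y), z + max 0 (y - (d + y)), min (d + y) y) \<partial>lborel \<partial>lborel)"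
      by (rule nn_integral_lborel_shift[symmetric]) measurable
    also have "\<dots> = (\<integral>\<^sup>+d. \<integral>\<^sup>+z. h (z + max 0 d, z + max 0 (- d), y + min d 0) \<partial>lborel \<partial>lborel)"
      by (intro nn_integral_cong arg_cong[where f = h]) (auto simp: min_def)
    finally show "(\<integral>\<^sup>+x. \<integral>\<^sup>+z. h (z + max 0 (x - y), z + max 0 (y - x), min x y) \<partial>lborel \<partial>lborel)
      = (\<integral>\<^sup>+d. \<integral>\<^sup>+z. h (z + max 0 d, z + max 0 (- d), y + min d 0) \<partial>lborel \<partial>lborel)" .
  qed
  also have "\<dots> = (\<integral>\<^sup>+d. \<integral>\<^sup>+y. \<integral>\<^sup>+z. h (z + max 0 d, z + max 0 (- d), y + min d 0) \<partial>lborel \<partial>lborel \<partial>lborel)"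
    by (rule lborel_pair.Fubini') measurable
  also have "\<dots> = (\<integral>\<^sup>+d. \<integral>\<^sup>+y. \<integral>\<^sup>+z. h (z + max 0 d, z + max 0 (- d), y) \<partial>lborel \<partial>lborel \<partial>lborel)"
  proof (rule nn_integral_cong)
    fix d :: real
    show "(\<integral>\<^sup>+y. \<integral>\<^sup>+z. h (z + max 0 d, z + max 0 (- d), y + min d 0) \<partial>lborel \<partial>lborel)
      = (\<integral>\<^sup>+y. \<integral>\<^sup>+z. h (z + max 0 d, z + max 0 (- d), y) \<partial>lborel \<partial>lborel)"
      by (rule nn_integral_lborel_shift[where f = "\<lambda>y. \<integral>\<^sup>+z. h (z + max 0 d, z + max 0 (- d), y) \<partial>lborel"]) measurable
  qed
  also have "\<dots> = (\<integral>\<^sup>+d. \<integral>\<^sup>+y. \<integral>\<^sup>+z. h (z + d, z, y) \<partial>lborel \<partial>lborel \<partial>lborel)"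
  proof (rule nn_integral_cong, rule nn_integral_cong)
    fix d y :: real
    have "(\<integral>\<^sup>+z. h (z + max 0 d, z + max 0 (- d), y) \<partial>lborel)
       = (\<integral>\<^sup>+z. h ((z + max 0 (- d)) + d, z + max 0 (- d), y) \<partial>lborel)"
      by (intro nn_integral_cong arg_cong[where f = h]) auto
    also have "\<dots> = (\<integral>\<^sup>+z. h (z + d, z, y) \<partial>lborel)"
      by (rule nn_integral_lborel_shift[where f = "\<lambda>z. h (z + d, z, y)"]) measurable
    finally show "(\<integral>\<^sup>+z. h (z + max 0 d, z + max 0 (- d), y) \<partial>lborel) = (\<integral>\<^sup>+z. h (z + d, z, y) \<partial>lborel)" .
  qed
  also have "\<dots> = (\<integral>\<^sup>+d. \<integral>\<^sup>+z. \<integral>\<^sup>+y. h (z + d, z, y) \<partial>lborel \<partial>lborel \<partial>lborel)"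
    by (intro nn_integral_cong lborel_pair.Fubini') measurable
  also have "\<dots> = (\<integral>\<^sup>+z. \<integral>\<^sup>+d. \<integral>\<^sup>+y. h (z + d, z, y) \<partial>lborel \<partial>lborel \<partial>lborel)"
    by (rule lborel_pair.Fubini') measurable
  also have "\<dots> = (\<integral>\<^sup>+z. \<integral>\<^sup>+d. \<integral>\<^sup>+y. h (d, z, y) \<partial>lborel \<partial>lborel \<partial>lborel)"
  proof (rule nn_integral_cong)
    fix z :: real
    have "(\<integral>\<^sup>+d. \<integral>\<^sup>+y. h (z + d, z, y) \<partial>lborel \<partial>lborel) = (\<integral>\<^sup>+d. \<integral>\<^sup>+y. h (d + z, z, y) \<partial>lborel \<partial>lborel)"
      by (simp add: add.commute)
    also have "\<dots> = (\<integral>\<^sup>+d. \<integral>\<^sup>+y. h (d, z, y) \<partial>lborel \<partial>lborel)"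
      by (rule nn_integral_lborel_shift[where f = "\<lambda>d. \<integral>\<^sup>+y. h (d, z, y) \<partial>lborel"]) measurable
    finally show "(\<integral>\<^sup>+d. \<integral>\<^sup>+y. h (z + d, z, y) \<partial>lborel \<partial>lborel) = (\<integral>\<^sup>+d. \<integral>\<^sup>+y. h (d, z, y) \<partial>lborel \<partial>lborel)" .
  qed
  also have "\<dots> = (\<integral>\<^sup>+x. \<integral>\<^sup>+y. \<integral>\<^sup>+z. h (x, y, z) \<partial>lborel \<partial>lborel \<partial>lborel)"
    by (rule lborel_pair.Fubini') measurable
  finally show ?thesis .
qed

lemma nn_integral_exp_law3:
  fixes h :: "real \<times> real \<times> real \<Rightarrow> ennreal"
  assumes [measurable]: "h \<in> borel_measurable borel" and "a > 0" "b > 0" "c > 0"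
  shows "(\<integral>\<^sup>+x. \<integral>\<^sup>+y. \<integral>\<^sup>+z. h (x, y, z) \<partial>exp_law c \<partial>exp_law b \<partial>exp_law a)
    = (\<integral>\<^sup>+x. \<integral>\<^sup>+y. \<integral>\<^sup>+z. ennreal (exponential_density a x * exponential_density b y * exponential_density c z)
        * h (x, y, z) \<partial>lborel \<partial>lborel \<partial>lborel)"
proof -
  have [measurable]: "h \<in> borel_measurable (borel \<Otimes>\<^sub>M borel \<Otimes>\<^sub>M borel)"
    using assms by (simp add: borel_prod)
  have [simp]: "0 \<le> exponential_density a x" "0 \<le> exponential_density b x" "0 \<le> exponential_density c x" for x
    using assms by (auto simp: exponential_density_nonneg)
  have "(\<integral>\<^sup>+x. \<integral>\<^sup>+y. \<integral>\<^sup>+z. h (x, y, z) \<partial>exp_law c \<partial>exp_law b \<partial>exp_law a)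
     = (\<integral>\<^sup>+x. ennreal (exponential_density a x) * (\<integral>\<^sup>+y. ennreal (exponential_density b y) *
         (\<integral>\<^sup>+z. ennreal (exponential_density c z) * h (x, y, z) \<partial>lborel) \<partial>lborel) \<partial>lborel)"
    using assms by (simp add: nn_integral_exp_law)
  also have "\<dots> = (\<integral>\<^sup>+x. \<integral>\<^sup>+y. \<integral>\<^sup>+z. ennreal (exponential_density a x * exponential_density b y * exponential_density c z)
        * h (x, y, z) \<partial>lborel \<partial>lborel \<partial>lborel)"
    by (simp add: nn_integral_cmult[symmetric] ennreal_mult' mult.assoc)
  finally show ?thesis .
qed

text \<open>
The map preserves volume as well as the joint density, because
$a\,(z+(x-y)^+) + b\,(z+(y-x)^+) + (a+b)\min(x,y) = a x + b y + (a+b) z$. Here $x$ and $y$ are a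
horizontal and a vertical increment entering a square, $z$ is its weight, and the first two
components of the image are the increments that leave it.
\<close>

lemma exp_law3_queue:
  fixes h :: "real \<times> real \<times> real \<Rightarrow> ennreal"
  assumes [measurable]: "h \<in> borel_measurable borel" and ab: "a > 0" "b > 0" "a + b = c"
  shows "(\<integral>\<^sup>+x. \<integral>\<^sup>+y. \<integral>\<^sup>+z. h (z + max 0 (x - y), z + max 0 (y - x), min x y)
        \<partial>exp_law c \<partial>exp_law b \<partial>exp_law a)
    = (\<integral>\<^sup>+x. \<integral>\<^sup>+y. \<integral>\<^sup>+z. h (x, y, z) \<partial>exp_law c \<partial>exp_law b \<partial>exp_law a)"
proof -
  let ?d = "\<lambda>(x, y, z). exponential_density a x * exponential_density b y * exponential_density c z"
  have [measurable]: "h \<in> borel_measurable (borel \<Otimes>\<^sub>M borel \<Otimes>\<^sub>M borel)"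
    using assms by (simp add: borel_prod)
  have T: "(\<lambda>(x, y, z). (z + max 0 (x - y), z + max 0 (y - x), min x y)) \<in> borel_measurable (borel :: (real \<times> real \<times> real) measure)"
    unfolding borel_prod[symmetric] by measurable
  have d: "?d (z + max 0 (x - y), z + max 0 (y - x), min x y) = ?d (x, y, z)" for x y z
  proof (cases "x \<ge> 0 \<and> y \<ge> 0 \<and> z \<ge> 0")
    case True
    have "(z + max 0 (x - y)) * a + (z + max 0 (y - x)) * b + min x y * c = x * a + y * b + z * c"
      by (cases "x \<le> y") (auto simp: ab(3)[symmetric] algebra_simps)
    then show ?thesis using True
      by (auto simp: exponential_density_def exp_add[symmetric] mult.commute mult.left_commute)
         (simp add: algebra_simps)
  next
    case False
    then have "z + max 0 (x - y) < 0 \<or> z + max 0 (y - x) < 0 \<or> min x y < 0"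
      by auto
    with False show ?thesis by (auto simp: exponential_density_def)
  qed
  have m: "(\<lambda>v. ennreal (?d v) * h v) \<in> borel_measurable borel"
    unfolding borel_prod[symmetric] by measurable
  have "(\<integral>\<^sup>+x. \<integral>\<^sup>+y. \<integral>\<^sup>+z. h (z + max 0 (x - y), z + max 0 (y - x), min x y)
        \<partial>exp_law c \<partial>exp_law b \<partial>exp_law a)
    = (\<integral>\<^sup>+x. \<integral>\<^sup>+y. \<integral>\<^sup>+z. ennreal (?d (x, y, z)) * h (z + max 0 (x - y), z + max 0 (y - x), min x y)
        \<partial>lborel \<partial>lborel \<partial>lborel)"
    using nn_integral_exp_law3[OF measurable_compose[OF T assms(1)], of a b c] ab by simp
  also have "\<dots> = (\<integral>\<^sup>+x. \<integral>\<^sup>+y. \<integral>\<^sup>+z. ennreal (?d (x, y, z)) * h (x, y, z) \<partial>lborel \<partial>lborel \<partial>lborel)"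
    using lborel3_queue[OF m] unfolding d by simp
  also have "\<dots> = (\<integral>\<^sup>+x. \<integral>\<^sup>+y. \<integral>\<^sup>+z. h (x, y, z) \<partial>exp_law c \<partial>exp_law b \<partial>exp_law a)"
    using nn_integral_exp_law3[of h a b c] ab by simp
  finally show ?thesis .
qed

section \<open>Last-passage values and the competition interface\<close>

text \<open>
The recursion satisfied by the last-passage times; it replaces the enumeration of paths.
\<close>

fun lpp :: "(nat \<times> nat \<Rightarrow> real) \<Rightarrow> nat \<Rightarrow> nat \<Rightarrow> real" where
  "lpp w 0 0 = w (0, 0)"
| "lpp w (Suc i) 0 = lpp w i 0 + w (Suc i, 0)"
| "lpp w 0 (Suc j) = lpp w 0 j + w (0, Suc j)"
| "lpp w (Suc i) (Suc j) = w (Suc i, Suc j) + max (lpp w i (Suc j)) (lpp w (Suc i) j)"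

lemma grid_induct [case_names 1 2 3 4]:
  assumes "P 0 0" "\<And>i. P i 0 \<Longrightarrow> P (Suc i) 0" "\<And>j. P 0 j \<Longrightarrow> P 0 (Suc j)"
    "\<And>i j. P i (Suc j) \<Longrightarrow> P (Suc i) j \<Longrightarrow> P (Suc i) (Suc j)"
  shows "P i j"
proof (induction "i + j" arbitrary: i j rule: less_induct)
  case less
  then show ?case using assms by (cases i; cases j) auto
qed

lemma lattice_paths_snoc:
  assumes "q \<noteq> (0, 0)"
  shows "lattice_paths q = (\<Union>p\<in>{p. lattice_step p q}. (\<lambda>\<pi>. \<pi> @ [q]) ` lattice_paths p)"
proof (intro set_eqI iffI)
  fix \<pi> assume \<pi>: "\<pi> \<in> lattice_paths q"
  then have ne: "\<pi> \<noteq> []" and "hd \<pi> = (0, 0)" "last \<pi> = q" "successively lattice_step \<pi>"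
    by (auto simp: lattice_paths_def)
  then obtain \<pi>' where \<pi>': "\<pi> = \<pi>' @ [q]" by (metis append_butlast_last_id)
  with \<open>hd \<pi> = (0, 0)\<close> assms have "\<pi>' \<noteq> []" by (cases \<pi>') auto
  with \<pi>' \<pi> have "\<pi>' \<in> lattice_paths (last \<pi>')" "lattice_step (last \<pi>') q"
    by (auto simp: lattice_paths_def successively_append_iff)
  with \<pi>' show "\<pi> \<in> (\<Union>p\<in>{p. lattice_step p q}. (\<lambda>\<pi>. \<pi> @ [q]) ` lattice_paths p)"
    by (intro UN_I[of "last \<pi>'"] image_eqI[of _ _ \<pi>']) auto
next
  fix \<pi> assume "\<pi> \<in> (\<Union>p\<in>{p. lattice_step p q}. (\<lambda>\<pi>. \<pi> @ [q]) ` lattice_paths p)"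
  then show "\<pi> \<in> lattice_paths q"
    by (auto simp: lattice_paths_def successively_append_iff)
qed

lemma last_passage_snoc:
  assumes "q \<noteq> (0, 0)"
  shows "last_passage w q = w q + Max (last_passage w ` {p. lattice_step p q})"
proof -
  let ?S = "\<lambda>\<pi>. \<Sum>q\<leftarrow>\<pi>. w q" and ?P = "{p. lattice_step p q}"
  have fin: "finite ?P"
  proof (rule finite_subset)
    show "?P \<subseteq> {..fst q} \<times> {..snd q}" by (auto simp: lattice_step_def)
  qed simp
  have ne: "?P \<noteq> {}"
  proof (cases q)
    case (Pair i j)
    with assms show ?thesis
    proof (cases i)
      case (Suc a)
      then have "lattice_step (a, j) q" using Pair by (simp add: lattice_step_def)
      then show ?thesis by blast
    next
      case 0
      then obtain b where "j = Suc b" using assms Pair by (cases j) auto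
      then have "lattice_step (i, b) q" using Pair by (simp add: lattice_step_def)
      then show ?thesis by blast
    qed
  qed
  have Pne: "lattice_paths p \<noteq> {}" for p by (cases p) (simp add: lattice_paths_nonempty)
  have "?S ` lattice_paths q = (\<lambda>x. w q + x) ` (\<Union>p\<in>?P. ?S ` lattice_paths p)"
    unfolding lattice_paths_snoc[OF assms] by (auto simp: image_UN image_image add.commute)
  then have "last_passage w q = Max ((\<lambda>x. w q + x) ` (\<Union>p\<in>?P. ?S ` lattice_paths p))"
    by (simp add: last_passage_def)
  also have "\<dots> = w q + Max (\<Union>p\<in>?P. ?S ` lattice_paths p)"
    using fin ne finite_lattice_paths Pne
    by (intro mono_Max_commute[symmetric]) (auto simp: mono_def)
  also have "Max (\<Union>p\<in>?P. ?S ` lattice_paths p) = Max (last_passage w ` ?P)"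
  proof (rule Max_eqI)
    show "finite (\<Union>p\<in>?P. ?S ` lattice_paths p)" using fin finite_lattice_paths by auto
    show "y \<le> Max (last_passage w ` ?P)" if "y \<in> (\<Union>p\<in>?P. ?S ` lattice_paths p)" for y
    proof -
      from that obtain p where p: "p \<in> ?P" "y \<in> ?S ` lattice_paths p" by auto
      then have "y \<le> last_passage w p"
        unfolding last_passage_def using finite_lattice_paths by (intro Max_ge) auto
      also have "\<dots> \<le> Max (last_passage w ` ?P)" using p fin by (intro Max_ge) auto
      finally show ?thesis .
    qed
    have "Max (last_passage w ` ?P) \<in> last_passage w ` ?P"
      using fin ne by (intro Max_in) auto
    then obtain p where p: "p \<in> ?P" "Max (last_passage w ` ?P) = last_passage w p" by auto
    have "last_passage w p \<in> ?S ` lattice_paths p"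
      unfolding last_passage_def using finite_lattice_paths Pne by (intro Max_in) auto
    with p show "Max (last_passage w ` ?P) \<in> (\<Union>p\<in>?P. ?S ` lattice_paths p)" by (intro UN_I[of p]) auto
  qed
  finally show ?thesis .
qed

lemma last_passage_eq_lpp: "last_passage w (i, j) = lpp w i j"
proof (induction w i j rule: lpp.induct)
  case (1 w)
  have "\<pi> = [(0, 0)]" if "\<pi> \<in> lattice_paths (0, 0)" for \<pi>
    using that lattice_path_bounds[of \<pi>] by (cases \<pi>) (auto simp: lattice_paths_def)
  moreover have "[(0, 0)] \<in> lattice_paths (0, 0)" by (simp add: lattice_paths_def)
  ultimately have "lattice_paths (0, 0) = {[(0, 0)]}" by blast
  then show ?case by (simp add: last_passage_def)
next
  case (2 w i)
  have "{p. lattice_step p (Suc i, 0)} = {(i, 0)}" by (auto simp: lattice_step_def)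
  with 2 show ?case by (simp add: last_passage_snoc)
next
  case (3 w j)
  have "{p. lattice_step p (0, Suc j)} = {(0, j)}" by (auto simp: lattice_step_def)
  with 3 show ?case by (simp add: last_passage_snoc)
next
  case (4 w i j)
  have "{p. lattice_step p (Suc i, Suc j)} = {(i, Suc j), (Suc i, j)}" by (auto simp: lattice_step_def)
  with 4 show ?case by (simp add: last_passage_snoc)
qed

text \<open>
Reversing every path exchanges the two corners of the rectangle. This is the one property for which
paths are more convenient than the recursion.
\<close>

lemma lpp_reflect: "lpp (\<lambda>(i, j). w (M - i, N - j)) M N = lpp w M N"
proof -
  let ?\<rho> = "\<lambda>(i, j). (M - i, N - j)" and ?P = "lattice_paths (M, N)"
  let ?R = "\<lambda>\<pi>. rev (map ?\<rho> \<pi>)"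
  have box: "set \<pi> \<subseteq> {..M} \<times> {..N}" if "\<pi> \<in> ?P" for \<pi>
    using that lattice_path_bounds[of \<pi>] by (auto simp: lattice_paths_def)
  have inv: "?R (?R \<pi>) = \<pi>" if "\<pi> \<in> ?P" for \<pi>
  proof -
    have "map (?\<rho> \<circ> ?\<rho>) \<pi> = map id \<pi>"
      using box[OF that] by (intro map_cong) auto
    then show ?thesis by (simp add: rev_map)
  qed
  have R: "?R \<pi> \<in> ?P" if "\<pi> \<in> ?P" for \<pi>
  proof -
    have \<pi>: "\<pi> \<noteq> []" "hd \<pi> = (0, 0)" "last \<pi> = (M, N)" "successively lattice_step \<pi>"
      using that by (auto simp: lattice_paths_def)
    have "successively (\<lambda>x y. lattice_step (?\<rho> y) (?\<rho> x)) \<pi>"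
    proof (rule successively_mono[OF \<pi>(4)])
      fix x y assume "x \<in> set \<pi>" "y \<in> set \<pi>" "lattice_step x y"
      with box[OF that] show "lattice_step (?\<rho> y) (?\<rho> x)"
        by (cases x; cases y) (fastforce simp: lattice_step_def)
    qed
    with \<pi> show ?thesis
      by (simp add: lattice_paths_def hd_rev last_rev last_map hd_map successively_rev successively_map)
  qed
  have "?R ` ?P = ?P" using R inv by (auto simp: image_iff) metis
  moreover have "(\<Sum>q\<leftarrow>?R \<pi>. w q) = (\<Sum>q\<leftarrow>\<pi>. (\<lambda>(i, j). w (M - i, N - j)) q)" for \<pi>
    by (simp add: rev_map[symmetric] o_def case_prod_beta sum_list_rev)
  ultimately have "(\<lambda>\<pi>. \<Sum>q\<leftarrow>\<pi>. w q) ` ?P = (\<lambda>\<pi>. \<Sum>q\<leftarrow>\<pi>. (\<lambda>(i, j). w (M - i, N - j)) q) ` ?P"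
    by (metis (mono_tags, lifting) image_cong image_image)
  then show ?thesis
    by (simp only: last_passage_eq_lpp[symmetric] last_passage_def)
qed

lemma lpp_cong:
  "(\<And>i' j'. i' \<le> i \<Longrightarrow> j' \<le> j \<Longrightarrow> w (i', j') = w' (i', j')) \<Longrightarrow> lpp w i j = lpp w' i j"
  by (induction w i j rule: lpp.induct) auto

lemma lpp_mono:
  "(\<And>i' j'. i' \<le> i \<Longrightarrow> j' \<le> j \<Longrightarrow> w (i', j') \<le> w' (i', j')) \<Longrightarrow> lpp w i j \<le> lpp w' i j"
proof (induction w i j rule: lpp.induct)
  case (4 w i j)
  have "lpp w i (Suc j) \<le> lpp w' i (Suc j)" "lpp w (Suc i) j \<le> lpp w' (Suc i) j"
    using 4 by auto
  then show ?case using "4.prems"[of "Suc i" "Suc j"] by auto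
qed (auto intro: add_mono)

lemma lpp_nonneg: "(\<And>p. 0 \<le> w p) \<Longrightarrow> 0 \<le> lpp w i j"
  by (induction w i j rule: lpp.induct) (auto intro: add_nonneg_nonneg simp: le_max_iff_disj)

lemma lpp_zero_column: "(\<And>j'. j' \<le> j \<Longrightarrow> w (0, j') = 0) \<Longrightarrow> lpp w 0 j = 0"
  by (induction j) auto

lemma lpp_row0: "lpp w i 0 = (\<Sum>l\<le>i. w (l, 0))"
  by (induction i) auto

lemma lpp_col0: "lpp w 0 j = (\<Sum>l\<le>j. w (0, l))"
  by (induction j) auto

lemma lpp_swap: "lpp (\<lambda>(i, j). w (j, i)) i j = lpp w j i"
  by (induction w j i rule: lpp.induct) (auto simp: max.commute)

text \<open>
Setting the weights of one axis to zero selects the paths that avoid it: for nonnegative weights, a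
path that leaves the origin along an axis of zero weights, and ends off this axis, can be replaced by
one that leaves along the other axis and collects at least as much.
\<close>

definition hor_only :: "(nat \<times> nat \<Rightarrow> real) \<Rightarrow> nat \<times> nat \<Rightarrow> real" where
  "hor_only w = (\<lambda>(i, j). if i = 0 then 0 else w (i, j))"

definition ver_only :: "(nat \<times> nat \<Rightarrow> real) \<Rightarrow> nat \<times> nat \<Rightarrow> real" where
  "ver_only w = (\<lambda>(i, j). if j = 0 then 0 else w (i, j))"

text \<open>
If $I$ and $J$ are the horizontal and the vertical increment that enter a square of weight $w$, those
that leave it are $w + (I-J)^+$ and $w + (J-I)^+$. Both are monotone, increasing in one increment and
decreasing in the other, so an order between the axes propagates to all increments.
\<close>

lemma lpp_compare:
  assumes "\<And>i j. i \<ge> 1 \<Longrightarrow> j \<ge> 1 \<Longrightarrow> w' (i, j) = w (i, j)"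
    and "\<And>i. i \<ge> 1 \<Longrightarrow> w' (i, 0) \<le> w (i, 0)" and "\<And>j. j \<ge> 1 \<Longrightarrow> w (0, j) \<le> w' (0, j)"
  shows "lpp w' (Suc i) j - lpp w' i j \<le> lpp w (Suc i) j - lpp w i j
       \<and> lpp w i (Suc j) - lpp w i j \<le> lpp w' i (Suc j) - lpp w' i j"
proof (induction i j rule: grid_induct)
  case 1
  show ?case using assms(2)[of 1] assms(3)[of 1] by simp
next
  case (2 i)
  have "w' (Suc i, 1) = w (Suc i, 1)" "w' (Suc (Suc i), 0) \<le> w (Suc (Suc i), 0)"
    using assms(1)[of "Suc i" 1] assms(2)[of "Suc (Suc i)"] by auto
  with 2 show ?case by (auto simp: max_def)
next
  case (3 j)
  have "w' (1, Suc j) = w (1, Suc j)" "w (0, Suc (Suc j)) \<le> w' (0, Suc (Suc j))"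
    using assms(1)[of 1 "Suc j"] assms(3)[of "Suc (Suc j)"] by auto
  with 3 show ?case by (auto simp: max_def)
next
  case (4 i j)
  have "w' (Suc (Suc i), Suc j) = w (Suc (Suc i), Suc j)" "w' (Suc i, Suc (Suc j)) = w (Suc i, Suc (Suc j))"
    using assms(1) by auto
  then show ?case using 4
    unfolding lpp.simps(4)[of w "Suc i" j] lpp.simps(4)[of w' "Suc i" j]
      lpp.simps(4)[of w i "Suc j"] lpp.simps(4)[of w' i "Suc j"]
    by (simp add: max_def del: lpp.simps(4))
qed

lemma lpp_eq_max:
  assumes "\<And>p. 0 \<le> w p" "w (0, 0) = 0"
  shows "lpp w i j = max (lpp (hor_only w) i j) (lpp (ver_only w) i j)"
proof (induction i j rule: grid_induct)
  case 1
  then show ?case using assms(2) by (simp add: hor_only_def ver_only_def)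
next
  case (2 i)
  have "0 \<le> lpp (hor_only w) i 0" using assms(1) by (intro lpp_nonneg) (auto simp: hor_only_def)
  moreover have "lpp (ver_only w) i 0 = 0" by (simp add: lpp_row0 ver_only_def)
  ultimately show ?case using 2 assms(1)[of "(Suc i, 0)"] by (simp add: hor_only_def ver_only_def)
next
  case (3 j)
  have "0 \<le> lpp (ver_only w) 0 j" using assms(1) by (intro lpp_nonneg) (auto simp: ver_only_def)
  moreover have "lpp (hor_only w) 0 j = 0" by (simp add: lpp_col0 hor_only_def)
  ultimately show ?case using 3 assms(1)[of "(0, Suc j)"] by (simp add: hor_only_def ver_only_def)
next
  case (4 i j)
  then show ?case by (simp add: hor_only_def ver_only_def)
qed

definition exit_gap :: "(nat \<times> nat \<Rightarrow> real) \<Rightarrow> nat \<Rightarrow> nat \<Rightarrow> real" where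
  "exit_gap w i j = lpp (hor_only w) i j - lpp (ver_only w) i j"

lemma exit_gap_step:
  assumes "\<And>p. 0 \<le> w p"
  shows "exit_gap w i j \<le> exit_gap w (Suc i) j" "exit_gap w i (Suc j) \<le> exit_gap w i j"
proof -
  have "lpp (ver_only w) (Suc i) j - lpp (ver_only w) i j \<le> lpp (hor_only w) (Suc i) j - lpp (hor_only w) i j
    \<and> lpp (hor_only w) i (Suc j) - lpp (hor_only w) i j \<le> lpp (ver_only w) i (Suc j) - lpp (ver_only w) i j"
    by (rule lpp_compare) (use assms in \<open>auto simp: hor_only_def ver_only_def\<close>)
  then show "exit_gap w i j \<le> exit_gap w (Suc i) j" "exit_gap w i (Suc j) \<le> exit_gap w i j"
    by (auto simp: exit_gap_def)
qed

lemma exit_gap_mono: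
  assumes "\<And>p. 0 \<le> w p" "i \<le> i'"
  shows "exit_gap w i j \<le> exit_gap w i' j"
  using assms(2) by (rule lift_Suc_mono_le[of "\<lambda>i. exit_gap w i j", rotated]) (rule exit_gap_step[of w, OF assms(1)])

text \<open>
By the two signs $G$ equals $G_h$ at the right and $G_v$ at the upper neighbour of the interface.
Suppose that the smaller value is the one on the right. After the step to the right, the new upper
neighbour is entered by optimal paths through the old one, where $G = G_v$; this gives $D \le 0$ there,
and the other sign follows from the monotonicity of $D$. The other case is symmetric.
\<close>

lemma interface_invariant:
  assumes w: "\<And>p. 0 \<le> w p" "w (0, 0) = 0"
  shows "competition_interface w k = (i, j) \<Longrightarrow> 0 \<le> exit_gap w (Suc i) j \<and> exit_gap w i (Suc j) \<le> 0"
proof (induction k arbitrary: i j)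
  case 0
  then show ?case using w(1)[of "(1, 0)"] w(1)[of "(0, 1)"] by (auto simp: exit_gap_def hor_only_def ver_only_def)
next
  case (Suc k)
  obtain a b where ab: "competition_interface w k = (a, b)" by fastforce
  have IH: "0 \<le> exit_gap w (Suc a) b" "exit_gap w a (Suc b) \<le> 0" using Suc.IH[OF ab] by auto
  have bulk: "lpp (hor_only w) (Suc a) (Suc b) = w (Suc a, Suc b) + max (lpp (hor_only w) a (Suc b)) (lpp (hor_only w) (Suc a) b)"
    "lpp (ver_only w) (Suc a) (Suc b) = w (Suc a, Suc b) + max (lpp (ver_only w) a (Suc b)) (lpp (ver_only w) (Suc a) b)"
    by (auto simp: hor_only_def ver_only_def)
  show ?case
  proof (cases "lpp w (Suc a) b < lpp w a (Suc b)")
    case True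
    then have ij: "i = Suc a" "j = b" using Suc.prems ab by (auto simp: Let_def last_passage_eq_lpp)
    have "exit_gap w (Suc a) (Suc b) \<le> 0"
      using True IH lpp_eq_max[of w "Suc a" b, OF w] lpp_eq_max[of w a "Suc b", OF w] bulk
      by (auto simp: exit_gap_def max_def split: if_splits)
    then show ?thesis using ij IH exit_gap_step(1)[of w "Suc a" b, OF w(1)] by auto
  next
    case False
    then have ij: "i = a" "j = Suc b" using Suc.prems ab by (auto simp: Let_def last_passage_eq_lpp)
    have "0 \<le> exit_gap w (Suc a) (Suc b)"
      using False IH lpp_eq_max[of w "Suc a" b, OF w] lpp_eq_max[of w a "Suc b", OF w] bulk
      by (auto simp: exit_gap_def max_def split: if_splits)
    then show ?thesis using ij IH exit_gap_step(2)[of w a "Suc b", OF w(1)] by auto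
  qed
qed

lemma interface_mono:
  "k \<le> l \<Longrightarrow> fst (competition_interface w k) \<le> fst (competition_interface w l)
    \<and> snd (competition_interface w k) \<le> snd (competition_interface w l)"
  by (induction l rule: dec_induct) (auto simp: Let_def intro: order_trans)

lemma interface_v_cases:
  obtains (never) "interface_v w n = \<infinity>"
  | (hit) v k where "interface_v w n = enat v" "competition_interface w k = (v, n)"
      "\<forall>i k. competition_interface w k = (i, n) \<longrightarrow> v \<le> i"
proof -
  define S where "S = {i. \<exists>k. (i, n) = competition_interface w k}"
  have S: "interface_v w n = (INF i\<in>S. enat i)" by (simp add: S_def interface_v_def)
  show ?thesis
  proof (cases "S = {}")
    case True
    then show ?thesis using never S by (simp add: top_enat_def)
  next
    case False
    define v where "v = (LEAST i. i \<in> S)"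
    have v: "v \<in> S" using False unfolding v_def by (auto intro: LeastI)
    have least: "v \<le> i" if "i \<in> S" for i unfolding v_def by (rule Least_le) fact
    have "interface_v w n = enat v"
      unfolding S by (rule antisym) (auto intro!: INF_lower INF_greatest v least)
    moreover from v obtain k where "(v, n) = competition_interface w k" by (auto simp: S_def)
    then have "competition_interface w k = (v, n)" by simp
    moreover have "\<forall>i k. competition_interface w k = (i, n) \<longrightarrow> v \<le> i"
    proof (intro allI impI)
      fix i k assume "competition_interface w k = (i, n)"
      then have "i \<in> S" unfolding S_def by (auto intro: sym)
      then show "v \<le> i" by (rule least)
    qed
    ultimately show ?thesis by (rule hit)
  qed
qed

lemma pos_part_real: "real_of_ereal (max 0 (ereal (real m) - ereal_of_enat (enat v))) = max 0 (real m - real v)"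
  by (simp add: max_def)

text \<open>
Since the interface only moves to the right and up, it cannot pass to the left of $(m,n)$ on the row
$n$ and below it in the column $m$; at most one of the two terms of the signed distance is nonzero.
\<close>

lemma Zstar_pos_cases:
  assumes "0 < Zstar w m n"
  obtains v k where "v < m" "competition_interface w k = (v, n)"
      "\<forall>i k. competition_interface w k = (i, n) \<longrightarrow> v \<le> i" "Zstar w m n = real m - real v"
proof (cases rule: interface_v_cases[of w n])
  case never
  have "0 \<le> real_of_ereal (max 0 (ereal (real n) - ereal_of_enat (interface_w w m)))"
    by (intro real_of_ereal_pos) auto
  with never assms show ?thesis by (simp add: Zstar_def)
next
  case (hit v k)
  have nn: "0 \<le> real_of_ereal (max 0 (ereal (real n) - ereal_of_enat (interface_w w m)))"
    by (intro real_of_ereal_pos) auto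
  have eq: "Zstar w m n = max 0 (real m - real v) - real_of_ereal (max 0 (ereal (real n) - ereal_of_enat (interface_w w m)))"
    unfolding Zstar_def hit(1) pos_part_real ..
  with assms nn have vm: "v < m" by (auto simp: max_def split: if_splits)
  have "enat n \<le> interface_w w m"
    unfolding interface_w_def
  proof (rule INF_greatest)
    fix j assume "j \<in> {j. \<exists>k. (m, j) = competition_interface w k}"
    then obtain l where "(m, j) = competition_interface w l" by auto
    then have l: "competition_interface w l = (m, j)" by simp
    have "\<not> l \<le> k" using interface_mono[of l k w] l hit(2) vm by auto
    then show "enat n \<le> enat j" using interface_mono[of k l w] l hit(2) by auto
  qed
  then have "ereal (real n) \<le> ereal_of_enat (interface_w w m)"
    by (cases "interface_w w m") auto
  then have "ereal (real n) - ereal_of_enat (interface_w w m) \<le> 0"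
    by (cases "interface_w w m") auto
  then have "Zstar w m n = real m - real v" using eq vm by (simp add: max_absorb1)
  from that[OF vm hit(2,3) this] show ?thesis .
qed

lemma Zstar_ge_imp_exit_gap:
  assumes w: "\<And>p. 0 \<le> w p" "w (0, 0) = 0" and x: "0 < x" "x \<le> Zstar w m n"
  shows "\<exists>M\<ge>1. real M \<le> real m - x + 1 \<and> 0 \<le> exit_gap w M n"
proof -
  from x have "0 < Zstar w m n" by simp
  then obtain v k where v: "competition_interface w k = (v, n)" "Zstar w m n = real m - real v"
    by (rule Zstar_pos_cases)
  have "0 \<le> exit_gap w (Suc v) n" using interface_invariant[of w, OF w v(1)] by simp
  moreover have "real (Suc v) \<le> real m - x + 1" using v(2) x by simp
  ultimately show ?thesis by (intro exI[of _ "Suc v"]) simp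
qed

text \<open>
The first visit of the row $n$ is entered from below, and the interface invariant at the preceding
point gives the sign of $D$ at the point of entry.
\<close>

lemma Zstar_window_imp_exit_gap:
  assumes w: "\<And>p. 0 \<le> w p" "w (0, 0) = 0" and n: "n \<ge> 1"
    and Z: "1 \<le> Zstar w m n" "Zstar w m n \<le> real u"
  shows "exit_gap w (m - u) n \<le> 0 \<and> 0 \<le> exit_gap w m n"
proof -
  from Z have "0 < Zstar w m n" by simp
  then obtain v k where v: "v < m" "competition_interface w k = (v, n)"
    "\<forall>i k. competition_interface w k = (i, n) \<longrightarrow> v \<le> i" "Zstar w m n = real m - real v"
    by (rule Zstar_pos_cases)
  define k' where "k' = (LEAST k. snd (competition_interface w k) = n)"
  have k': "snd (competition_interface w k') = n" unfolding k'_def by (rule LeastI[of _ k]) (simp add: v)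
  have lt: "snd (competition_interface w l) \<noteq> n" if "l < k'" for l
    using not_less_Least[OF that[unfolded k'_def]] .
  obtain k0 where k0: "k' = Suc k0" using k' n by (cases k') auto
  obtain a b where ab: "competition_interface w k0 = (a, b)" by fastforce
  have step: "competition_interface w k' = (Suc a, b) \<or> competition_interface w k' = (a, Suc b)"
    using ab k0 by (auto simp: Let_def)
  have "b \<noteq> n" using lt[of k0] ab k0 by simp
  then have at: "competition_interface w k' = (a, Suc b)" "Suc b = n" using step k' by auto
  have "k' \<le> k" unfolding k'_def by (rule Least_le) (simp add: v)
  then have "a \<le> v" using interface_mono[of k' k w] at v(2) by simp
  moreover have "v \<le> a" using v(3) at by blast
  ultimately have "exit_gap w v n \<le> 0" using interface_invariant[of w, OF w ab] at by simp
  moreover have "exit_gap w (m - u) n \<le> exit_gap w v n"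
    using Z v(4) by (intro exit_gap_mono[of w, OF w(1)]) linarith
  moreover have "exit_gap w (Suc v) n \<le> exit_gap w m n"
    using v(1) by (intro exit_gap_mono[of w, OF w(1)]) auto
  ultimately show ?thesis using interface_invariant[of w, OF w v(2)] by auto
qed

text \<open>
Once the increments along the column $k$ are taken as the weights of a new vertical axis, everything
to the right of it is a last-passage problem of the same kind.
\<close>

lemma lpp_shift:
  assumes "w' (0, 0) = 0"
    and "\<And>j. 1 \<le> j \<Longrightarrow> j \<le> n \<Longrightarrow> w' (0, j) = lpp w k j - lpp w k (j - 1)"
    and "\<And>i j. 1 \<le> i \<Longrightarrow> w' (i, j) = w (k + i, j)"
  shows "j \<le> n \<Longrightarrow> lpp w (k + i) j = lpp w k 0 + lpp w' i j"
proof (induction i j rule: grid_induct)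
  case (2 i)
  then show ?case using assms(3)[of "Suc i" 0] by simp
next
  case (3 j)
  then show ?case using assms(2)[of "Suc j"] by simp
next
  case (4 i j)
  then show ?case using assms(3)[of "Suc i" "Suc j"] by simp
qed (use assms(1) in simp)

section \<open>Stationarity under shifts\<close>

lemma lpp_measurable [measurable]: "(\<lambda>w. lpp w i j) \<in> borel_measurable field_space"
  by (induction i j rule: grid_induct) auto

lemma lpp_measurable_compose [measurable (raw)]:
  "f \<in> measurable M field_space \<Longrightarrow> (\<lambda>x. lpp (f x) i j) \<in> borel_measurable M"
  by (rule measurable_compose[OF _ lpp_measurable])

lemma hor_only_measurable [measurable]: "hor_only \<in> measurable field_space field_space"
  by (rule measurable_field_map) (auto simp: hor_only_def case_prod_beta)

lemma ver_only_measurable [measurable]: "ver_only \<in> measurable field_space field_space"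
  by (rule measurable_field_map) (auto simp: ver_only_def case_prod_beta)

lemma exit_gap_measurable [measurable]: "(\<lambda>w. exit_gap w i j) \<in> borel_measurable field_space"
  unfolding exit_gap_def by measurable

text \<open>
At $p$ and $q$ the increments entering a square are replaced by those leaving it; the third output
makes the map a bijection that preserves the law.
\<close>

definition queue_move :: "'i \<Rightarrow> 'i \<Rightarrow> 'i \<Rightarrow> ('i \<Rightarrow> real) \<Rightarrow> 'i \<Rightarrow> real" where
  "queue_move p q s w =
     w(p := w s + max 0 (w p - w q), q := w s + max 0 (w q - w p), s := min (w p) (w q))"

lemma queue_move_measurable [measurable]: "queue_move p q s \<in> measurable field_space field_space"
  by (rule measurable_field_map) (auto simp: queue_move_def fun_upd_def)

lemma nn_integral_exp_field_resample3:
  assumes g[measurable]: "g \<in> borel_measurable field_space"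
  shows "(\<integral>\<^sup>+w. g w \<partial>exp_field r) =
    (\<integral>\<^sup>+x. \<integral>\<^sup>+y. \<integral>\<^sup>+z. (\<integral>\<^sup>+w. g (w(s := z, q := y, p := x)) \<partial>exp_field r) \<partial>exp_law (r s) \<partial>exp_law (r q) \<partial>exp_law (r p))"
proof -
  have m1: "(\<lambda>w. g (w(p := x))) \<in> borel_measurable field_space" for x
    using measurable_compose[OF measurable_fun_upd_const g] by simp
  have m2: "(\<lambda>w. g (w(q := y, p := x))) \<in> borel_measurable field_space" for x y
    using measurable_compose[OF measurable_fun_upd_const m1] by simp
  show ?thesis
    by (subst nn_integral_exp_field_resample_same[OF g, of _ p], subst nn_integral_exp_field_resample_same[OF m1, of _ _ q],
        subst nn_integral_exp_field_resample_same[OF m2, of _ _ _ s]) simp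
qed

lemma measure_eqI_nn_integral_distr:
  assumes "sets N = sets field_space" and [measurable]: "T \<in> measurable M field_space"
    and "\<And>g. g \<in> borel_measurable field_space \<Longrightarrow> (\<integral>\<^sup>+w. g (T w) \<partial>M) = (\<integral>\<^sup>+w. g w \<partial>N)"
  shows "distr M field_space T = N"
proof (rule measure_eqI)
  fix A assume "A \<in> sets (distr M field_space T)"
  then have A[measurable]: "A \<in> sets field_space" by simp
  have "emeasure (distr M field_space T) A = (\<integral>\<^sup>+w. indicator A w \<partial>distr M field_space T)" by simp
  also have "\<dots> = (\<integral>\<^sup>+w. indicator A (T w) \<partial>M)"
    by (rule nn_integral_distr) measurable
  also have "\<dots> = (\<integral>\<^sup>+w. indicator A w \<partial>N)" by (rule assms(3)) measurable
  also have "\<dots> = emeasure N A" using A assms(1) by simp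
  finally show "emeasure (distr M field_space T) A = emeasure N A" .
qed (use assms(1) in simp)

lemma distr_queue_move:
  assumes neq: "p \<noteq> q" "p \<noteq> s" "q \<noteq> s" and r: "r p > 0" "r q > 0" "r p + r q = r s"
  shows "distr (exp_field r) field_space (queue_move p q s) = exp_field r"
proof (rule measure_eqI_nn_integral_distr)
  show "queue_move p q s \<in> measurable (exp_field r) field_space" by measurable
  fix g :: "('a \<Rightarrow> real) \<Rightarrow> ennreal" assume g[measurable]: "g \<in> borel_measurable field_space"
  interpret I: prob_space "exp_field r" by simp
  define h where "h = (\<lambda>(x, y, z). \<integral>\<^sup>+w. g (w(s := z, q := y, p := x)) \<partial>exp_field r)"
  have upd: "(\<lambda>v. (snd v)(s := snd (snd (fst v)), q := fst (snd (fst v)), p := fst (fst v)))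
      \<in> measurable ((borel \<Otimes>\<^sub>M borel \<Otimes>\<^sub>M borel) \<Otimes>\<^sub>M exp_field r) field_space"
    by (rule measurable_field_map) (auto simp: fun_upd_def)
  have "(\<lambda>v. g ((snd v)(s := snd (snd (fst v)), q := fst (snd (fst v)), p := fst (fst v))))
      \<in> borel_measurable ((borel \<Otimes>\<^sub>M borel \<Otimes>\<^sub>M borel) \<Otimes>\<^sub>M exp_field r)"
    using measurable_compose[OF upd g] by simp
  from I.borel_measurable_nn_integral_fst[OF this]
  have h: "h \<in> borel_measurable borel"
    by (simp add: h_def case_prod_beta borel_prod)
  have qm: "queue_move p q s (w(s := z, q := y, p := x))
      = w(s := min x y, q := z + max 0 (y - x), p := z + max 0 (x - y))" for w x y z
    using neq by (auto simp: queue_move_def fun_eq_iff)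
  have "(\<integral>\<^sup>+w. g (queue_move p q s w) \<partial>exp_field r)
    = (\<integral>\<^sup>+x. \<integral>\<^sup>+y. \<integral>\<^sup>+z. h (z + max 0 (x - y), z + max 0 (y - x), min x y) \<partial>exp_law (r s) \<partial>exp_law (r q) \<partial>exp_law (r p))"
    by (subst nn_integral_exp_field_resample3[where p = p and q = q and s = s]) (simp_all add: qm h_def)
  also have "\<dots> = (\<integral>\<^sup>+x. \<integral>\<^sup>+y. \<integral>\<^sup>+z. h (x, y, z) \<partial>exp_law (r s) \<partial>exp_law (r q) \<partial>exp_law (r p))"
    using h r by (rule exp_law3_queue)
  also have "\<dots> = (\<integral>\<^sup>+w. g w \<partial>exp_field r)"
    by (subst nn_integral_exp_field_resample3[OF g, where p = p and q = q and s = s]) (simp add: h_def)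
  finally show "(\<integral>\<^sup>+w. g (queue_move p q s w) \<partial>exp_field r) = (\<integral>\<^sup>+w. g w \<partial>exp_field r)" .
qed simp

text \<open>
Column $0$ is pushed through column $1$ from the bottom to the row $n$. The coordinate $(1,0)$ carries
the horizontal increment, and $(0,j)$ receives the vertical increment of column $1$.
\<close>

primrec sweep :: "nat \<Rightarrow> (nat \<times> nat \<Rightarrow> real) \<Rightarrow> nat \<times> nat \<Rightarrow> real" where
  "sweep 0 w = w"
| "sweep (Suc n) w = queue_move (1, 0) (0, Suc n) (1, Suc n) (sweep n w)"

lemma sweep_measurable [measurable]: "sweep n \<in> measurable field_space field_space"
proof (induction n)
  case (Suc n)
  from measurable_compose[OF this queue_move_measurable] show ?case by simp
next
  case 0
  have "sweep 0 = (\<lambda>w. w)" by auto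
  then show ?case by simp
qed

lemma sweep_values:
  "sweep n w (1, 0) = lpp w 1 n - lpp w 0 n
   \<and> (\<forall>j. 1 \<le> j \<and> j \<le> n \<longrightarrow> sweep n w (0, j) = lpp w 1 j - lpp w 1 (j - 1))
   \<and> (\<forall>j. j = 0 \<or> n < j \<longrightarrow> sweep n w (0, j) = w (0, j))
   \<and> (\<forall>j. n < j \<longrightarrow> sweep n w (1, j) = w (1, j))
   \<and> (\<forall>i j. 2 \<le> i \<longrightarrow> sweep n w (i, j) = w (i, j))"
proof (induction n)
  case 0
  then show ?case by simp
next
  case (Suc n)
  have L: "lpp w 1 (Suc n) = w (1, Suc n) + max (lpp w 0 n + w (0, Suc n)) (lpp w 1 n)" by simp
  have q: "sweep n w (1, Suc n) = w (1, Suc n)" "sweep n w (0, Suc n) = w (0, Suc n)"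
    "sweep n w (1, 0) = lpp w 1 n - lpp w 0 n"
    using Suc by auto
  have a: "sweep (Suc n) w (1, 0) = lpp w 1 (Suc n) - lpp w 0 (Suc n)"
    using q L by (simp add: queue_move_def max_def del: lpp.simps(4))
  have b: "sweep (Suc n) w (0, Suc n) = lpp w 1 (Suc n) - lpp w 1 n"
    using q L by (simp add: queue_move_def max_def del: lpp.simps(4))
  have c: "sweep (Suc n) w p = sweep n w p" if "p \<noteq> (1, 0)" "p \<noteq> (0, Suc n)" "p \<noteq> (1, Suc n)" for p
    using that by (simp add: queue_move_def)
  show ?case using a b c Suc by (auto simp: le_Suc_eq)
qed

definition drop_column :: "(nat \<times> nat \<Rightarrow> real) \<Rightarrow> nat \<times> nat \<Rightarrow> real" where
  "drop_column w = (\<lambda>(i, j). if i = 0 then w (0, j) else w (Suc i, j))"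

text \<open>
The field seen from the point $(k,0)$. Only the rows up to $n$ are transformed; the higher ones keep
their vertical axis weights, so that the law is preserved exactly.
\<close>

definition col_shift :: "nat \<Rightarrow> nat \<Rightarrow> (nat \<times> nat \<Rightarrow> real) \<Rightarrow> nat \<times> nat \<Rightarrow> real" where
  "col_shift n k = ((\<lambda>w. drop_column (sweep n w)) ^^ k)"

lemma drop_column_measurable [measurable]: "drop_column \<in> measurable field_space field_space"
  by (rule measurable_field_map) (auto simp: drop_column_def case_prod_beta)

lemma col_shift_0 [simp]: "col_shift n 0 w = w"
  by (simp add: col_shift_def)

lemma col_shift_Suc: "col_shift n (Suc k) w = col_shift n k (drop_column (sweep n w))"
  by (simp add: col_shift_def funpow_Suc_right del: funpow.simps)

lemma col_shift_measurable [measurable]: "col_shift n k \<in> measurable field_space field_space"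
proof (induction k)
  case 0
  have "col_shift n 0 = (\<lambda>w. w)" by auto
  then show ?case by simp
next
  case (Suc k)
  have "col_shift n (Suc k) = (\<lambda>w. col_shift n k (drop_column (sweep n w)))" by (auto simp: col_shift_Suc)
  with Suc show ?case by simp
qed

lemma drop_column_sweep_props:
  assumes "w (0, 0) = 0"
  shows "drop_column (sweep n w) (0, 0) = 0"
    "i \<ge> 1 \<Longrightarrow> drop_column (sweep n w) (i, j) = w (Suc i, j)"
    "j \<le> n \<Longrightarrow> lpp w (Suc i) j = w (1, 0) + lpp (drop_column (sweep n w)) i j"
proof -
  show 1: "drop_column (sweep n w) (0, 0) = 0"
    using assms sweep_values[of n w] by (simp add: drop_column_def)
  show 2: "i \<ge> 1 \<Longrightarrow> drop_column (sweep n w) (i, j) = w (Suc i, j)" for i j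
    using sweep_values[of n w] by (simp add: drop_column_def)
  have "lpp w (1 + i) j = lpp w 1 0 + lpp (drop_column (sweep n w)) i j" if "j \<le> n" for j
  proof (rule lpp_shift[of "drop_column (sweep n w)" n w 1 j i])
    show "drop_column (sweep n w) (0, 0) = 0" "j \<le> n" by fact+
    show "drop_column (sweep n w) (0, j) = lpp w 1 j - lpp w 1 (j - 1)" if "1 \<le> j" "j \<le> n" for j
      using that sweep_values[of n w] by (simp add: drop_column_def)
    show "drop_column (sweep n w) (i, j) = w (1 + i, j)" if "1 \<le> i" for i j
      using 2[OF that] by simp
  qed
  then show "j \<le> n \<Longrightarrow> lpp w (Suc i) j = w (1, 0) + lpp (drop_column (sweep n w)) i j"
    using assms by simp
qed

lemma col_shift_props:
  assumes "w (0, 0) = 0"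
  shows "col_shift n k w (0, 0) = 0 \<and> (\<forall>i j. i \<ge> 1 \<longrightarrow> col_shift n k w (i, j) = w (k + i, j))
    \<and> (\<forall>i j. j \<le> n \<longrightarrow> lpp w (k + i) j = lpp w k 0 + lpp (col_shift n k w) i j)"
  using assms
proof (induction k arbitrary: w)
  case (Suc k)
  let ?w = "drop_column (sweep n w)"
  note P = drop_column_sweep_props[of w, OF Suc.prems, where n = n]
  note IH = Suc.IH[of ?w, OF P(1)]
  have "lpp w (Suc k + i) j = lpp w (Suc k) 0 + lpp (col_shift n k ?w) i j" if "j \<le> n" for i j
  proof -
    have "lpp w (Suc (k + i)) j = w (1, 0) + lpp ?w (k + i) j" using P(3)[of j "k + i"] that by simp
    also have "lpp ?w (k + i) j = lpp ?w k 0 + lpp (col_shift n k ?w) i j" using IH that by blast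
    finally show ?thesis using P(3)[of 0 k] by simp
  qed
  then show ?case using IH P(2) by (simp add: col_shift_Suc)
qed simp

lemma col_shift_nonneg:
  assumes "\<And>p. 0 \<le> w p"
  shows "0 \<le> col_shift n k w p"
  using assms
proof (induction k arbitrary: w)
  case (Suc k)
  have "0 \<le> sweep n w p" for p
    by (induction n arbitrary: p) (use Suc.prems in \<open>auto simp: queue_move_def\<close>)
  then have "0 \<le> drop_column (sweep n w) p" for p by (cases p) (auto simp: drop_column_def)
  then show ?case using Suc.IH by (simp add: col_shift_Suc)
qed simp

text \<open>
The rates for which the increments are stationary: the rates of the two axes add up to the bulk rate.
\<close>

definition stat_rate :: "real \<Rightarrow> nat \<times> nat \<Rightarrow> real" where
  "stat_rate \<rho> = (\<lambda>(i, j). if i = 0 then (if j = 0 then 0 else \<rho>) else if j = 0 then 1 - \<rho> else 1)"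

text \<open>
The Burke property: the vertical increments along any column are independent with the law of the
vertical axis, and independent of the weights to the right of the column.
\<close>

lemma distr_col_shift:
  assumes "0 < \<rho>" "\<rho> < 1"
  shows "distr (exp_field (stat_rate \<rho>)) field_space (col_shift n k) = exp_field (stat_rate \<rho>)"
proof -
  let ?F = "exp_field (stat_rate \<rho>)"
  have sw: "distr ?F field_space (sweep n) = ?F" for n
  proof (induction n)
    case 0
    have "sweep 0 = (\<lambda>w. w)" by auto
    then show ?case by (simp add: distr_id2)
  next
    case (Suc n)
    have "distr ?F field_space (sweep (Suc n))
        = distr (distr ?F field_space (sweep n)) field_space (queue_move (1, 0) (0, Suc n) (1, Suc n))"
      by (subst distr_distr) (auto intro!: arg_cong[where f = "distr ?F field_space"])
    also have "\<dots> = ?F" unfolding Suc.IH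
      by (rule distr_queue_move) (use assms in \<open>auto simp: stat_rate_def\<close>)
    finally show ?case .
  qed
  define \<sigma> where "\<sigma> = (\<lambda>(i, j). if i = 0 then (0, j) else (Suc i, j::nat))"
  have "inj \<sigma>" by (auto simp: inj_def \<sigma>_def split: if_splits)
  then have "distr ?F field_space (\<lambda>w p. w (\<sigma> p)) = exp_field (\<lambda>p. stat_rate \<rho> (\<sigma> p))"
    by (rule distr_exp_field_relabel)
  moreover have "(\<lambda>w p. w (\<sigma> p)) = drop_column"
    by (auto simp: \<sigma>_def drop_column_def fun_eq_iff)
  moreover have "(\<lambda>p. stat_rate \<rho> (\<sigma> p)) = stat_rate \<rho>"
    by (auto simp: \<sigma>_def stat_rate_def fun_eq_iff)
  ultimately have dr: "distr ?F field_space drop_column = ?F" by simp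
  have one: "distr ?F field_space (\<lambda>w. drop_column (sweep n w)) = ?F"
    using distr_distr[of drop_column field_space field_space "sweep n" ?F] sw[of n] dr
    by (simp add: comp_def)
  show ?thesis
  proof (induction k)
    case 0
    have "col_shift n 0 = (\<lambda>w. w)" by auto
    then show ?case by (simp add: distr_id2)
  next
    case (Suc k)
    have "distr ?F field_space (col_shift n (Suc k))
       = distr (distr ?F field_space (\<lambda>w. drop_column (sweep n w))) field_space (col_shift n k)"
      by (subst distr_distr) (auto simp: comp_def col_shift_Suc[abs_def])
    then show ?case using one Suc by simp
  qed
qed

section \<open>An exponential moment in closed form\<close>

lemma emeasure_exp_field_UNIV [simp]: "emeasure (exp_field r) UNIV = 1"
  by (metis prob_space.emeasure_space_1 prob_space_exp_field space_exp_field)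

lemma nn_integral_exp_field_tilt_finite:
  assumes "finite S" "\<And>p. p \<in> S \<Longrightarrow> r p = a" "a > 0" "a + s > 0"
    and g: "g \<in> borel_measurable field_space"
  shows "(\<integral>\<^sup>+w. ennreal (exp (- s * (\<Sum>p\<in>S. w p))) * g w \<partial>exp_field r)
    = ennreal ((a / (a + s)) ^ card S) * (\<integral>\<^sup>+w. g w \<partial>exp_field (\<lambda>p. if p \<in> S then a + s else r p))"
  using assms(1,2) g
proof (induction S arbitrary: g rule: finite_induct)
  case (insert q S)
  note g[measurable] = insert.prems(2)
  let ?r = "\<lambda>p. if p \<in> S then a + s else r p"
  have "(\<integral>\<^sup>+w. ennreal (exp (- s * (\<Sum>p\<in>insert q S. w p))) * g w \<partial>exp_field r)
    = (\<integral>\<^sup>+w. ennreal (exp (- s * (\<Sum>p\<in>S. w p))) * (ennreal (exp (- s * w q)) * g w) \<partial>exp_field r)"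
  proof (rule nn_integral_cong)
    fix w :: "'a \<Rightarrow> real"
    have "exp (- s * (\<Sum>p\<in>insert q S. w p)) = exp (- s * (\<Sum>p\<in>S. w p)) * exp (- s * w q)"
      using insert.hyps by (simp add: exp_add[symmetric] algebra_simps)
    then show "ennreal (exp (- s * (\<Sum>p\<in>insert q S. w p))) * g w
        = ennreal (exp (- s * (\<Sum>p\<in>S. w p))) * (ennreal (exp (- s * w q)) * g w)"
      by (simp only: ennreal_mult[OF exp_ge_zero exp_ge_zero] mult.assoc)
  qed
  also have "\<dots> = ennreal ((a / (a + s)) ^ card S) * (\<integral>\<^sup>+w. ennreal (exp (- s * w q)) * g w \<partial>exp_field ?r)"
    using insert.prems by (intro insert.IH) auto
  also have "(\<integral>\<^sup>+w. ennreal (exp (- s * w q)) * g w \<partial>exp_field ?r)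
      = ennreal (a / (a + s)) * (\<integral>\<^sup>+w. g w \<partial>exp_field (?r(q := a + s)))"
    using insert assms(3,4) nn_integral_exp_field_tilt[of ?r q s g] by simp
  also have "?r(q := a + s) = (\<lambda>p. if p \<in> insert q S then a + s else r p)"
    by (auto simp: fun_eq_iff)
  also have "ennreal ((a / (a + s)) ^ card S) * (ennreal (a / (a + s)) * (\<integral>\<^sup>+w. g w \<partial>exp_field (\<lambda>p. if p \<in> insert q S then a + s else r p)))
     = ennreal ((a / (a + s)) ^ card (insert q S)) * (\<integral>\<^sup>+w. g w \<partial>exp_field (\<lambda>p. if p \<in> insert q S then a + s else r p))"
  proof -
    have "ennreal ((a / (a + s)) ^ card (insert q S)) = ennreal ((a / (a + s)) ^ card S) * ennreal (a / (a + s))"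
      using insert.hyps assms(3,4) by (simp add: ennreal_mult[symmetric] mult.commute)
    then show ?thesis by (simp only: mult.assoc)
  qed
  finally show ?case .
qed simp

text \<open>
The field that is stationary with parameter $b$, except that the first $m$ weights on the horizontal
axis have rate $1 - a$.
\<close>

definition tilted_rate :: "real \<Rightarrow> real \<Rightarrow> nat \<Rightarrow> nat \<times> nat \<Rightarrow> real" where
  "tilted_rate a b m = (\<lambda>p. if p \<in> (\<lambda>i. (i, 0)) ` {1..m} then 1 - a else stat_rate b p)"

text \<open>
Going to $(m,n)$ along the axis and then up, $G(m,n)$ is the sum of $m$ horizontal axis weights and of
$n$ increments along the column $m$. In the stationary field the latter are independent exponentials,
so $e^{(b-a)(G(m,n)-G(m,0))}$ has a product expectation, and the factor $e^{-(b-a)G(m,0)}$ is absorbed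
as a change of the rate of the horizontal axis from $1-b$ to $1-a$.
\<close>

lemma lpp_mgf:
  assumes a: "0 < a" "a < 1" and b: "0 < b" "b < 1"
  shows "(\<integral>\<^sup>+w. ennreal (exp ((b - a) * lpp w m n)) \<partial>exp_field (tilted_rate a b m))
    = ennreal ((b / a) ^ n * ((1 - a) / (1 - b)) ^ m)"
proof -
  let ?F = "exp_field (stat_rate b)" and ?s = "b - a"
  let ?H = "(\<lambda>i. (i, 0)) ` {1..m} :: (nat \<times> nat) set" and ?V = "(\<lambda>j. (0, j)) ` {1..n} :: (nat \<times> nat) set"
  have cH: "card ?H = m" and cV: "card ?V = n" by (auto simp: card_image inj_on_def)
  have zero: "AE w in ?F. w (0, 0) = 0" by (rule AE_exp_field_zero) (simp add: stat_rate_def)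
  have V: "lpp w 0 n = (\<Sum>p\<in>?V. w p)" and H: "lpp w m 0 = (\<Sum>p\<in>?H. w p)" if "w (0, 0) = 0" for w
    using that by (simp_all add: lpp_col0 lpp_row0 sum.reindex inj_on_def atMost_atLeast0 sum.atLeast_Suc_atMost)
  have "(\<integral>\<^sup>+w. ennreal (exp (?s * (lpp w m n - lpp w m 0))) \<partial>?F)
      = (\<integral>\<^sup>+w. ennreal (exp (?s * lpp (col_shift n m w) 0 n)) \<partial>?F)"
  proof (rule nn_integral_cong_AE, rule eventually_mono[OF zero])
    fix w :: "nat \<times> nat \<Rightarrow> real" assume "w (0, 0) = 0"
    then have "lpp w (m + 0) n = lpp w m 0 + lpp (col_shift n m w) 0 n"
      using col_shift_props[of w n m] by blast
    then show "ennreal (exp (?s * (lpp w m n - lpp w m 0))) = ennreal (exp (?s * lpp (col_shift n m w) 0 n))"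
      by simp
  qed
  also have "\<dots> = (\<integral>\<^sup>+w. ennreal (exp (?s * lpp w 0 n)) \<partial>distr ?F field_space (col_shift n m))"
    by (rule nn_integral_distr[symmetric]) measurable
  also have "\<dots> = (\<integral>\<^sup>+w. ennreal (exp (?s * lpp w 0 n)) \<partial>?F)"
    by (simp only: distr_col_shift[OF b])
  also have "\<dots> = (\<integral>\<^sup>+w. ennreal (exp (- (a - b) * (\<Sum>p\<in>?V. w p))) * 1 \<partial>?F)"
    by (rule nn_integral_cong_AE, rule eventually_mono[OF zero]) (simp add: V)
  also have "\<dots> = ennreal ((b / (b + (a - b))) ^ n)"
    using a b cV
    by (subst nn_integral_exp_field_tilt_finite[where a = b]) (auto simp: stat_rate_def)
  finally have 1: "(\<integral>\<^sup>+w. ennreal (exp (?s * (lpp w m n - lpp w m 0))) \<partial>?F) = ennreal ((b / a) ^ n)" by simp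
  have "(\<integral>\<^sup>+w. ennreal (exp (?s * (lpp w m n - lpp w m 0))) \<partial>?F)
      = (\<integral>\<^sup>+w. ennreal (exp (- ?s * (\<Sum>p\<in>?H. w p))) * ennreal (exp (?s * lpp w m n)) \<partial>?F)"
    by (rule nn_integral_cong_AE, rule eventually_mono[OF zero])
       (simp add: H ennreal_mult''[symmetric] exp_add[symmetric] algebra_simps)
  also have "\<dots> = ennreal (((1 - b) / (1 - b + ?s)) ^ card ?H) *
      (\<integral>\<^sup>+w. ennreal (exp (?s * lpp w m n)) \<partial>exp_field (\<lambda>p. if p \<in> ?H then 1 - b + ?s else stat_rate b p))"
    using a b by (intro nn_integral_exp_field_tilt_finite) (auto simp: stat_rate_def)
  also have "(\<lambda>p. if p \<in> ?H then 1 - b + ?s else stat_rate b p) = tilted_rate a b m"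
    by (auto simp: tilted_rate_def)
  finally have 2: "ennreal ((b / a) ^ n) = ennreal (((1 - b) / (1 - a)) ^ m) *
      (\<integral>\<^sup>+w. ennreal (exp (?s * lpp w m n)) \<partial>exp_field (tilted_rate a b m))"
    using cH 1 by simp
  have "ennreal (((1 - a) / (1 - b)) ^ m) * ennreal ((b / a) ^ n)
     = ennreal (((1 - a) / (1 - b)) ^ m * ((1 - b) / (1 - a)) ^ m) *
      (\<integral>\<^sup>+w. ennreal (exp (?s * lpp w m n)) \<partial>exp_field (tilted_rate a b m))"
    unfolding 2 using a b by (simp add: mult.assoc[symmetric] ennreal_mult)
  also have "((1 - a) / (1 - b)) ^ m * ((1 - b) / (1 - a)) ^ m = 1"
    using a b by (simp add: power_mult_distrib[symmetric])
  finally show ?thesis using a b by (simp add: ennreal_mult[symmetric] mult.commute)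
qed

lemma distr_exp_field_scale:
  assumes "\<And>p. c p > 0" "\<And>p. r p / c p = r' p"
  shows "distr (exp_field r) field_space (\<lambda>w p. c p * w p) = exp_field r'"
  using assms by (intro distr_exp_field_coordinatewise[where f = "\<lambda>p x. c p * x" and \<sigma> = "\<lambda>p. p"])
    (auto simp: distr_exp_law_scale)

lemma scale_measurable [measurable]: "(\<lambda>w p. c p * w p) \<in> measurable field_space field_space"
  by (rule measurable_field_map) auto

text \<open>
Enlarging the horizontal axis weights to the rate $1-\sigma$ only increases $D$. There $e^{-sG}$ has
an explicit expectation $A$, and that of $e^{sG_h}$ is at most the explicit $B$ obtained by giving
the vertical axis the rate $\rho+2s$, which does not affect $G_h$. On $D \ge 0$ the two exponentials are
reciprocal, so $1 \le (\kappa e^{-sG} + \kappa^{-1} e^{sG_h})/2$; the best $\kappa$ gives $\sqrt{AB}$. With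
$f(x) = N\log x - M\log(1-x)$ the logarithm of the bound is half the second difference of $f$ over the
points $\rho$, $\sigma$ and $\rho+2s$. Its linear terms have cancelled, and the curvature measures the
distance of $(M,N)$ from the characteristic direction.
\<close>

lemma exit_gap_bound:
  fixes \<rho> s :: real
  assumes \<rho>: "0 < \<rho>" and s: "0 < s" "\<rho> + 2 * s < 1"
  defines "\<sigma> \<equiv> \<rho> + s"
  shows "measure (exp_field (stat_rate \<rho>)) {w. 0 \<le> exit_gap w M N}
    \<le> sqrt ((1 - s\<^sup>2 / \<sigma>\<^sup>2) ^ N / (1 - s\<^sup>2 / (1 - \<sigma>)\<^sup>2) ^ M)"
proof -
  let ?F = "exp_field (stat_rate \<rho>)" and ?Q = "exp_field (tilted_rate \<sigma> \<rho> M)"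
  let ?H = "(\<lambda>i. (i, 0)) ` {1..M} :: (nat \<times> nat) set"
  let ?E = "{w. 0 \<le> exit_gap w M N}"
  interpret F: prob_space ?F by simp
  interpret Q: prob_space ?Q by simp
  have \<sigma>: "0 < \<sigma>" "\<sigma> < 1" "\<rho> < 1" using \<rho> s by (auto simp: \<sigma>_def)
  have E: "?E \<in> sets field_space" by (rule sets_field_Collect) measurable
  \<comment> \<open>The factor that lowers the rate of the first $M$ horizontal axis weights to $1-\sigma$.\<close>
  define c where "c p = (if p \<in> ?H then (1 - \<rho>) / (1 - \<sigma>) else 1)" for p
  have c1: "1 \<le> c p" for p using \<sigma> s by (auto simp: c_def \<sigma>_def)
  have cQ: "distr ?F field_space (\<lambda>w p. c p * w p) = ?Q"
  proof (rule distr_exp_field_scale)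
    show "0 < c p" for p using c1[of p] by linarith
    show "stat_rate \<rho> p / c p = tilted_rate \<sigma> \<rho> M p" for p
      using \<sigma> by (cases p) (auto simp: c_def tilted_rate_def stat_rate_def)
  qed
  have "measure ?F ?E \<le> measure ?F ((\<lambda>w p. c p * w p) -` ?E \<inter> space ?F)"
  proof (rule F.finite_measure_mono_AE)
    show "(\<lambda>w p. c p * w p) -` ?E \<inter> space ?F \<in> sets ?F"
      using E by (intro measurable_sets[OF _ E]) simp
    show "AE w in ?F. w \<in> ?E \<longrightarrow> w \<in> (\<lambda>w p. c p * w p) -` ?E \<inter> space ?F"
    proof (rule eventually_mono[OF AE_exp_field_nonneg], intro impI)
      fix w :: "nat \<times> nat \<Rightarrow> real" assume w: "\<forall>p. 0 \<le> w p" and "w \<in> ?E"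
      have le: "w p \<le> c p * w p" for p using mult_right_mono[OF c1[of p], of "w p"] w by simp
      have "lpp (hor_only w) M N \<le> lpp (hor_only (\<lambda>p. c p * w p)) M N"
        using le by (intro lpp_mono) (auto simp: hor_only_def)
      moreover have "lpp (ver_only w) M N = lpp (ver_only (\<lambda>p. c p * w p)) M N"
        by (intro lpp_cong) (auto simp: ver_only_def c_def)
      ultimately show "w \<in> (\<lambda>w p. c p * w p) -` ?E \<inter> space ?F"
        using \<open>w \<in> ?E\<close> by (auto simp: exit_gap_def)
    qed
  qed
  also have "\<dots> = measure ?Q ?E"
    unfolding cQ[symmetric] by (rule measure_distr[symmetric]) (use E in simp_all)
  finally have FQ: "measure ?F ?E \<le> measure ?Q ?E" .

  define A where "A = (\<rho> / \<sigma>) ^ N * ((1 - \<sigma>) / (1 - \<rho>)) ^ M"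
  define B where "B = ((\<rho> + 2 * s) / \<sigma>) ^ N * ((1 - \<sigma>) / (1 - (\<rho> + 2 * s))) ^ M"
  have AB: "A > 0" "B > 0" using \<sigma> \<rho> s by (auto simp: A_def B_def)
  have intA: "(\<integral>\<^sup>+w. ennreal (exp (- s * lpp w M N)) \<partial>?Q) = ennreal A"
    using lpp_mgf[of \<sigma> \<rho> M N] \<sigma> \<rho> by (simp add: A_def \<sigma>_def)
  define c' where "c' p = stat_rate \<rho> p / stat_rate (\<rho> + 2 * s) p" for p
  \<comment> \<open>The factor that gives both axes the parameter $\rho+2s$ wherever $G_h(M,N)$ is not affected.\<close>
  define d where "d p = (if p \<in> ?H \<or> p = (0, 0) then 1 else c' p)" for p
  have d0: "d p > 0" for p using \<rho> s \<sigma> by (cases p) (auto simp: d_def c'_def stat_rate_def)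
  have dQ: "distr ?Q field_space (\<lambda>w p. d p * w p) = exp_field (tilted_rate \<sigma> (\<rho> + 2 * s) M)"
  proof (rule distr_exp_field_scale[OF d0])
    show "tilted_rate \<sigma> \<rho> M p / d p = tilted_rate \<sigma> (\<rho> + 2 * s) M p" for p
      using \<rho> s \<sigma> by (cases p) (auto simp: d_def c'_def tilted_rate_def stat_rate_def)
  qed
  have nnQ: "AE w in ?Q. \<forall>p. 0 \<le> w p" by (rule AE_exp_field_nonneg)
  have "(\<integral>\<^sup>+w. ennreal (exp (s * lpp (hor_only w) M N)) \<partial>?Q)
      \<le> (\<integral>\<^sup>+w. ennreal (exp (s * lpp (\<lambda>p. d p * w p) M N)) \<partial>?Q)"
  proof (rule nn_integral_mono_AE, rule eventually_mono[OF nnQ])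
    fix w :: "nat \<times> nat \<Rightarrow> real" assume w: "\<forall>p. 0 \<le> w p"
    have d1: "d (i, j) = 1" if "1 \<le> i" "i \<le> M" for i j
      using that by (auto simp: d_def c'_def stat_rate_def)
    have "lpp (hor_only w) M N \<le> lpp (\<lambda>p. d p * w p) M N"
      using w d0[THEN less_imp_le] d1 by (intro lpp_mono) (auto simp: hor_only_def)
    then show "ennreal (exp (s * lpp (hor_only w) M N)) \<le> ennreal (exp (s * lpp (\<lambda>p. d p * w p) M N))"
      using s by (intro ennreal_leI) simp
  qed
  also have "\<dots> = (\<integral>\<^sup>+w. ennreal (exp (s * lpp w M N)) \<partial>distr ?Q field_space (\<lambda>w p. d p * w p))"
    by (rule nn_integral_distr[symmetric]) measurable
  also have "\<dots> = ennreal B"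
    unfolding dQ using lpp_mgf[of \<sigma> "\<rho> + 2 * s" M N] \<sigma> \<rho> s by (simp add: B_def \<sigma>_def)
  finally have intB: "(\<integral>\<^sup>+w. ennreal (exp (s * lpp (hor_only w) M N)) \<partial>?Q) \<le> ennreal B" .

  \<comment> \<open>The minimizer of $\kappa A + B/\kappa$.\<close>
  define \<kappa> where "\<kappa> = sqrt (B / A)"
  have \<kappa>: "\<kappa> > 0" using AB by (simp add: \<kappa>_def)
  have zQ: "AE w in ?Q. w (0, 0) = 0"
    by (rule AE_exp_field_zero) (auto simp: tilted_rate_def stat_rate_def)
  have "ennreal (measure ?Q ?E) = (\<integral>\<^sup>+w. indicator ?E w \<partial>?Q)"
    using E by (simp add: Q.emeasure_eq_measure)
  also have "\<dots> \<le> (\<integral>\<^sup>+w. ennreal (\<kappa> / 2) * ennreal (exp (- s * lpp w M N))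
      + ennreal (1 / (2 * \<kappa>)) * ennreal (exp (s * lpp (hor_only w) M N)) \<partial>?Q)"
  proof (rule nn_integral_mono_AE, use nnQ zQ in eventually_elim)
    fix w :: "nat \<times> nat \<Rightarrow> real" assume w: "\<forall>p. 0 \<le> w p" "w (0, 0) = 0"
    show "indicator ?E w \<le> ennreal (\<kappa> / 2) * ennreal (exp (- s * lpp w M N))
      + ennreal (1 / (2 * \<kappa>)) * ennreal (exp (s * lpp (hor_only w) M N))"
    proof (cases "w \<in> ?E")
      case True
      then have eq: "lpp (hor_only w) M N = lpp w M N"
        using w lpp_eq_max[of w M N] by (auto simp: exit_gap_def max_def)
      define x where "x = exp (s * lpp w M N)"
      have x: "x > 0" "exp (- s * lpp w M N) = 1 / x"
        by (auto simp: x_def exp_minus field_simps)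
      have "0 \<le> (\<kappa> - x)\<^sup>2 / (2 * \<kappa> * x)" using x \<kappa> by simp
      also have "\<dots> = \<kappa> / 2 * (1 / x) + 1 / (2 * \<kappa>) * x - 1"
        using x \<kappa> by (simp add: field_simps power2_eq_square)
      finally have "1 \<le> \<kappa> / 2 * (1 / x) + 1 / (2 * \<kappa>) * x" by simp
      then have "ennreal 1 \<le> ennreal (\<kappa> / 2 * (1 / x) + 1 / (2 * \<kappa>) * x)" by (rule ennreal_leI)
      also have "\<dots> = ennreal (\<kappa> / 2) * ennreal (1 / x) + ennreal (1 / (2 * \<kappa>)) * ennreal x"
        using x \<kappa> by (simp add: ennreal_mult[symmetric] ennreal_plus[symmetric] del: ennreal_plus)
      finally show ?thesis using True x(2) by (simp add: eq x_def)
    qed simp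
  qed
  also have "\<dots> = ennreal (\<kappa> / 2) * (\<integral>\<^sup>+w. ennreal (exp (- s * lpp w M N)) \<partial>?Q)
      + ennreal (1 / (2 * \<kappa>)) * (\<integral>\<^sup>+w. ennreal (exp (s * lpp (hor_only w) M N)) \<partial>?Q)"
    by (simp add: nn_integral_add nn_integral_cmult)
  also have "\<dots> \<le> ennreal (\<kappa> / 2) * ennreal A + ennreal (1 / (2 * \<kappa>)) * ennreal B"
    unfolding intA by (intro add_mono mult_left_mono intB order_refl) auto
  also have "\<dots> = ennreal (\<kappa> / 2 * A + 1 / (2 * \<kappa>) * B)"
    using \<kappa> AB by (simp add: ennreal_mult[symmetric] ennreal_plus[symmetric] del: ennreal_plus)
  finally have "measure ?Q ?E \<le> \<kappa> / 2 * A + 1 / (2 * \<kappa>) * B"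
    using \<kappa> AB by (subst (asm) ennreal_le_iff) auto
  also have "\<dots> = sqrt (A * B)"
  proof -
    define p q where "p = sqrt A" and "q = sqrt B"
    have pq: "A = p * p" "B = q * q" "p > 0" "q > 0" "\<kappa> = q / p" "sqrt (A * B) = p * q"
      using AB by (auto simp: p_def q_def \<kappa>_def real_sqrt_divide real_sqrt_mult)
    then have "\<kappa> / 2 * A = p * q / 2" "1 / (2 * \<kappa>) * B = p * q / 2" by simp_all
    with pq(6) show ?thesis by simp
  qed
  also have "A * B = (1 - s\<^sup>2 / \<sigma>\<^sup>2) ^ N / (1 - s\<^sup>2 / (1 - \<sigma>)\<^sup>2) ^ M"
  proof -
    have "\<sigma>\<^sup>2 - s\<^sup>2 = \<rho> * (\<rho> + 2 * s)"
      by (simp add: \<sigma>_def algebra_simps power2_eq_square)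
    moreover have "1 - s\<^sup>2 / \<sigma>\<^sup>2 = (\<sigma>\<^sup>2 - s\<^sup>2) / \<sigma>\<^sup>2"
      using \<sigma> by (simp add: diff_divide_distrib)
    ultimately have "\<rho> / \<sigma> * ((\<rho> + 2 * s) / \<sigma>) = 1 - s\<^sup>2 / \<sigma>\<^sup>2"
      by (simp add: power2_eq_square)
    moreover have "(1 - \<sigma>) / (1 - \<rho>) * ((1 - \<sigma>) / (1 - (\<rho> + 2 * s))) = 1 / (1 - s\<^sup>2 / (1 - \<sigma>)\<^sup>2)"
    proof -
      have "(1 - \<sigma>)\<^sup>2 - s\<^sup>2 = (1 - \<rho>) * (1 - (\<rho> + 2 * s))"
        by (simp add: \<sigma>_def algebra_simps power2_eq_square)
      moreover have "1 - s\<^sup>2 / (1 - \<sigma>)\<^sup>2 = ((1 - \<sigma>)\<^sup>2 - s\<^sup>2) / (1 - \<sigma>)\<^sup>2"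
        using \<sigma> by (simp add: diff_divide_distrib)
      ultimately have "1 - s\<^sup>2 / (1 - \<sigma>)\<^sup>2 = ((1 - \<rho>) * (1 - (\<rho> + 2 * s))) / (1 - \<sigma>)\<^sup>2"
        by simp
      then show ?thesis using \<sigma> by (simp add: power2_eq_square)
    qed
    moreover have "A * B = (\<rho> / \<sigma> * ((\<rho> + 2 * s) / \<sigma>)) ^ N * ((1 - \<sigma>) / (1 - \<rho>) * ((1 - \<sigma>) / (1 - (\<rho> + 2 * s)))) ^ M"
      by (simp only: A_def B_def power_mult_distrib mult_ac)
    ultimately show ?thesis by (simp add: power_one_over)
  qed
  finally show ?thesis using FQ by simp
qed

section \<open>The tail of the signed distance\<close>

lemma power_one_minus_le_exp:
  assumes "0 \<le> x" "x \<le> (1::real)"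
  shows "(1 - x) ^ n \<le> exp (- (x * real n))"
proof -
  have "(1 - x) ^ n \<le> exp (- x) ^ n"
    using assms exp_ge_add_one_self[of "- x"] by (intro power_mono) auto
  then show ?thesis by (simp add: exp_of_nat_mult[symmetric] mult.commute)
qed

lemma inverse_power_one_minus_le_exp:
  assumes "0 \<le> x" "x \<le> (1/2::real)"
  shows "1 / (1 - x) ^ n \<le> exp ((x + 2 * x\<^sup>2) * real n)"
proof -
  have "- x - 2 * x\<^sup>2 \<le> ln (1 - x)" using assms by (rule ln_one_minus_pos_lower_bound)
  then have "exp (- (x + 2 * x\<^sup>2)) \<le> 1 - x"
    using assms by (subst (asm) ln_ge_iff) auto
  then have "exp (- (x + 2 * x\<^sup>2)) ^ n \<le> (1 - x) ^ n" by (intro power_mono) auto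
  moreover have "exp (- (x + 2 * x\<^sup>2)) ^ n = exp (- ((x + 2 * x\<^sup>2) * real n))"
    by (simp only: exp_of_nat_mult[symmetric]) (simp add: algebra_simps)
  ultimately have "exp (- ((x + 2 * x\<^sup>2) * real n)) \<le> (1 - x) ^ n" by simp
  moreover have "0 < (1 - x) ^ n" using assms by simp
  ultimately have "1 / (1 - x) ^ n \<le> 1 / exp (- ((x + 2 * x\<^sup>2) * real n))"
    by (intro divide_left_mono) auto
  then show ?thesis by (simp add: exp_minus inverse_eq_divide)
qed

lemma exit_gap_bound_exp:
  fixes \<rho> s :: real
  assumes \<rho>: "0 < \<rho>" and s: "0 < s" "\<rho> + 2 * s < 1" and small: "2 * s \<le> 1 - (\<rho> + s)"
  shows "measure (exp_field (stat_rate \<rho>)) {w. 0 \<le> exit_gap w M N}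
    \<le> exp (s\<^sup>2 / 2 * (real M / (1 - (\<rho> + s))\<^sup>2 + 2 * s\<^sup>2 * real M / (1 - (\<rho> + s)) ^ 4 - real N / (\<rho> + s)\<^sup>2))"
proof -
  define \<sigma> where "\<sigma> = \<rho> + s"
  define x y where "x = s\<^sup>2 / \<sigma>\<^sup>2" and "y = s\<^sup>2 / (1 - \<sigma>)\<^sup>2"
  have \<sigma>: "0 < \<sigma>" "\<sigma> < 1" "s \<le> \<sigma>" using \<rho> s by (auto simp: \<sigma>_def)
  have x: "0 \<le> x" "x \<le> 1" using \<sigma> s by (auto simp: x_def power_mono)
  have "(2 * s)\<^sup>2 \<le> (1 - \<sigma>)\<^sup>2" using small s by (intro power_mono) (auto simp: \<sigma>_def)
  then have "4 * s\<^sup>2 \<le> (1 - \<sigma>)\<^sup>2" by (simp add: power_mult_distrib)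
  then have "2 * s\<^sup>2 \<le> (1 - \<sigma>)\<^sup>2" using zero_le_power2[of s] by linarith
  then have y: "0 \<le> y" "y \<le> 1/2" using \<sigma> by (auto simp: y_def field_simps)
  have "measure (exp_field (stat_rate \<rho>)) {w. 0 \<le> exit_gap w M N} \<le> sqrt ((1 - x) ^ N / (1 - y) ^ M)"
    using exit_gap_bound[OF \<rho> s, of M N] by (simp add: x_def y_def \<sigma>_def)
  also have "\<dots> \<le> sqrt (exp (- (x * real N)) * exp ((y + 2 * y\<^sup>2) * real M))"
  proof (rule real_sqrt_le_mono)
    have "(1 - x) ^ N * (1 / (1 - y) ^ M) \<le> exp (- (x * real N)) * exp ((y + 2 * y\<^sup>2) * real M)"
      using x y by (intro mult_mono power_one_minus_le_exp inverse_power_one_minus_le_exp) auto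
    then show "(1 - x) ^ N / (1 - y) ^ M \<le> exp (- (x * real N)) * exp ((y + 2 * y\<^sup>2) * real M)" by simp
  qed
  also have "\<dots> = exp (((y + 2 * y\<^sup>2) * real M - x * real N) / 2)"
    by (simp add: exp_add[symmetric] real_sqrt_unique power2_eq_square)
  also have "((y + 2 * y\<^sup>2) * real M - x * real N) / 2
      = s\<^sup>2 / 2 * (real M / (1 - \<sigma>)\<^sup>2 + 2 * s\<^sup>2 * real M / (1 - \<sigma>) ^ 4 - real N / \<sigma>\<^sup>2)"
  proof -
    define T where "T = 1 - \<sigma>"
    have "y\<^sup>2 = s\<^sup>2 * s\<^sup>2 / T ^ 4"
      unfolding y_def T_def[symmetric] by (simp add: power_divide power2_eq_square power4_eq_xxxx)
    then show ?thesis unfolding x_def y_def T_def[symmetric]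
      by (simp add: algebra_simps add_divide_distrib diff_divide_distrib)
  qed
  finally show ?thesis by (simp add: \<sigma>_def)
qed

lemma exit_gap_swap: "exit_gap (\<lambda>(i, j). w (j, i)) i j = - exit_gap w j i"
proof -
  have "hor_only (\<lambda>(i, j). w (j, i)) = (\<lambda>(i, j). ver_only w (j, i))"
    "ver_only (\<lambda>(i, j). w (j, i)) = (\<lambda>(i, j). hor_only w (j, i))"
    by (auto simp: hor_only_def ver_only_def fun_eq_iff)
  then show ?thesis by (simp add: exit_gap_def lpp_swap)
qed

lemma measurable_exit_gap_sets [measurable]:
  "{w. 0 \<le> exit_gap w i j} \<in> sets field_space" "{w. exit_gap w i j \<le> 0} \<in> sets field_space"
  "{w. 0 < exit_gap w i j} \<in> sets field_space" "{w. exit_gap w i j = 0} \<in> sets field_space"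
  by (rule sets_field_Collect, measurable)+

lemma distr_swap_stat_rate:
  "distr (exp_field (stat_rate \<rho>)) field_space (\<lambda>w (i, j). w (j, i)) = exp_field (stat_rate (1 - \<rho>))"
proof -
  have "inj (\<lambda>(i, j). (j, i) :: nat \<times> nat)" by (auto simp: inj_def)
  from distr_exp_field_relabel[OF this, of "stat_rate \<rho>"]
  have 1: "distr (exp_field (stat_rate \<rho>)) field_space (\<lambda>w p. w (case p of (i, j) \<Rightarrow> (j, i)))
    = exp_field (\<lambda>p. stat_rate \<rho> (case p of (i, j) \<Rightarrow> (j, i)))" .
  have 2: "(\<lambda>w p. w (case p of (i, j) \<Rightarrow> (j, i))) = (\<lambda>w (i, j). w (j, i) :: real)"
    by (auto simp: fun_eq_iff)
  have 3: "(\<lambda>p. stat_rate \<rho> (case p of (i, j) \<Rightarrow> (j, i))) = stat_rate (1 - \<rho>)"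
    by (auto simp: fun_eq_iff stat_rate_def)
  show ?thesis using 1 unfolding 2 3 .
qed

lemma measure_exit_gap_swap:
  "measure (exp_field (stat_rate \<rho>)) {w. exit_gap w M N \<le> 0}
     = measure (exp_field (stat_rate (1 - \<rho>))) {w. 0 \<le> exit_gap w N M}"
proof -
  have m: "(\<lambda>w (i, j). w (j, i)) \<in> measurable (exp_field (stat_rate \<rho>)) field_space"
    by (rule measurable_field_map) (auto simp: case_prod_beta)
  have "measure (exp_field (stat_rate (1 - \<rho>))) {w. 0 \<le> exit_gap w N M}
    = measure (distr (exp_field (stat_rate \<rho>)) field_space (\<lambda>w (i, j). w (j, i))) {w. 0 \<le> exit_gap w N M}"
    by (simp only: distr_swap_stat_rate)
  also have "\<dots> = measure (exp_field (stat_rate \<rho>))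
      ((\<lambda>w (i, j). w (j, i)) -` {w. 0 \<le> exit_gap w N M} \<inter> space (exp_field (stat_rate \<rho>)))"
    by (rule measure_distr[OF m]) measurable
  also have "\<dots> = measure (exp_field (stat_rate \<rho>)) {w. exit_gap w M N \<le> 0}"
    by (auto simp: exit_gap_swap intro!: arg_cong[where f = "measure _"])
  finally show ?thesis ..
qed

lemma distr_stationary_lpp:
  assumes "stationary_lpp M \<omega> \<rho>" "0 < \<rho>" "\<rho> < 1"
  shows "distr M field_space (\<lambda>x p. \<omega> p x) = exp_field (stat_rate \<rho>)"
proof -
  interpret stationary_lpp M \<omega> \<rho> by fact
  have D: "distr M borel X = exp_law r" if "distributed M lborel X (exponential_density r)" "r > 0" for X r
  proof -
    have "distr M borel X = distr M lborel X" by (rule distr_cong) auto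
    also have "\<dots> = exp_law r"
      using distributed_distr_eq_density[OF that(1)] that(2) by (simp add: exp_law_def)
    finally show ?thesis .
  qed
  have law: "distr M borel (\<omega> p) = exp_law (stat_rate \<rho> p)" for p
  proof (cases p)
    case (Pair i j)
    show ?thesis
    proof (cases "i = 0 \<and> j = 0")
      case True
      have "distr M borel (\<omega> (0, 0)) = distr M borel (\<lambda>_. 0)"
        using weight_origin weights_measurable by (intro distr_cong_AE) auto
      also have "\<dots> = return borel 0" by (rule distr_const) simp
      finally show ?thesis using True Pair by (simp add: stat_rate_def exp_law_def)
    next
      case False
      then show ?thesis
        using weight_horizontal[of i] weight_vertical[of j] weight_bulk[of i j] assms(2,3) Pair
        by (cases i; cases j) (auto simp: stat_rate_def intro!: D)
    qed
  qed
  have "distr M (PiM UNIV (\<lambda>_. borel)) (\<lambda>x. \<lambda>i\<in>UNIV. \<omega> i x) = PiM UNIV (\<lambda>i. distr M borel (\<omega> i))"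
    using weights_indep weights_measurable
    by (subst indep_vars_iff_distr_eq_PiM[symmetric]) auto
  then show ?thesis by (simp add: law exp_field_def restrict_UNIV)
qed

text \<open>
Only the joint law of the weights matters, so events of any stationary field can be estimated in the
canonical one.
\<close>

lemma measure_stationary_lpp:
  assumes "stationary_lpp M \<omega> \<rho>" "0 < \<rho>" "\<rho> < 1" and A: "A \<in> sets field_space"
    and imp: "\<And>w. (\<And>p. 0 \<le> w p) \<Longrightarrow> w (0, 0) = 0 \<Longrightarrow> P w \<Longrightarrow> w \<in> A"
  shows "measure M {x \<in> space M. P (\<lambda>p. \<omega> p x)} \<le> measure (exp_field (stat_rate \<rho>)) A"
proof -
  interpret stationary_lpp M \<omega> \<rho> by fact
  let ?T = "\<lambda>x p. \<omega> p x"
  have T[measurable]: "?T \<in> measurable M field_space"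
    by (rule measurable_field_map) (rule weights_measurable)
  have "AE w in exp_field (stat_rate \<rho>). (\<forall>p. 0 \<le> w p) \<and> w (0, 0) = 0"
    by (intro AE_conjI AE_exp_field_nonneg AE_exp_field_zero) (simp add: stat_rate_def)
  then have "AE w in distr M field_space ?T. (\<forall>p. 0 \<le> w p) \<and> w (0, 0) = 0"
    by (simp only: distr_stationary_lpp[OF assms(1-3)])
  then have ae: "AE x in M. (\<forall>p. 0 \<le> \<omega> p x) \<and> \<omega> (0, 0) x = 0"
    by (rule AE_distrD[OF T])
  have "measure M {x \<in> space M. P (?T x)} \<le> measure M (?T -` A \<inter> space M)"
  proof (rule finite_measure_mono_AE)
    show "?T -` A \<inter> space M \<in> sets M" by (rule measurable_sets[OF T A])
    show "AE x in M. x \<in> {x \<in> space M. P (?T x)} \<longrightarrow> x \<in> ?T -` A \<inter> space M"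
      using ae by eventually_elim (use imp in auto)
  qed
  also have "\<dots> = measure (distr M field_space ?T) A" by (rule measure_distr[OF T A, symmetric])
  finally show ?thesis by (simp only: distr_stationary_lpp[OF assms(1-3)])
qed

text \<open>
With $s = \kappa x/t$ the exponent in \<open>exit_gap_bound_exp\<close> is at most
$s^2(-x/2 + C_1)/2$: the point lies $x$ to the left of the characteristic direction, and the errors from expanding in $s$ are of order
$st = \kappa x$, hence absorbed for small $\kappa$.
\<close>

lemma exit_gap_tail:
  fixes \<rho> :: real
  assumes "0 < \<rho>" "\<rho> < 1"
  obtains c C where "c > 0" "C > 0"
    "\<And>t x M. 0 < x \<Longrightarrow> x \<le> t \<Longrightarrow> real M \<le> (1 - \<rho>)\<^sup>2 * t - x + 1 \<Longrightarrow>
      measure (exp_field (stat_rate \<rho>)) {w. 0 \<le> exit_gap w M (nat \<lfloor>\<rho>\<^sup>2 * t\<rfloor>)} \<le> C * exp (- c * x ^ 3 / t\<^sup>2)"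
proof -
  define \<alpha> where "\<alpha> = 1 - \<rho>"
  have \<alpha>: "0 < \<alpha>" "\<alpha> < 1" using assms by (auto simp: \<alpha>_def)
  \<comment> \<open>$L s t$ and $C_1$ will bound the errors from expanding the exponent in $s$ and from rounding.\<close>
  define L where "L = 2 / \<rho> + 6 / \<alpha> + 8 / \<alpha> ^ 4"
  define \<kappa> where "\<kappa> = min (\<alpha> / 4) (1 / (2 * L))"
  have L: "L > 0" using assms \<alpha> by (simp add: L_def add_pos_pos)
  have \<kappa>': "\<kappa> \<le> \<alpha> / 4" "\<kappa> \<le> 1 / (2 * L)" by (auto simp: \<kappa>_def)
  have \<kappa>: "\<kappa> > 0" "\<kappa> \<le> \<alpha> / 4" "\<kappa> * L \<le> 1/2" "\<kappa> \<le> 1"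
    using \<alpha> L \<kappa>' mult_right_mono[OF \<kappa>'(2), of L] by (auto simp: \<kappa>_def)
  define C1 where "C1 = 1 / \<rho>\<^sup>2 + 4 / \<alpha>\<^sup>2 + 8 / \<alpha> ^ 4"
  have bound: "measure (exp_field (stat_rate \<rho>)) {w. 0 \<le> exit_gap w M (nat \<lfloor>\<rho>\<^sup>2 * t\<rfloor>)}
      \<le> exp (\<kappa>\<^sup>2 * C1 / 2) * exp (- (\<kappa>\<^sup>2 / 4) * x ^ 3 / t\<^sup>2)"
    if x: "0 < x" "x \<le> t" and M: "real M \<le> (1 - \<rho>)\<^sup>2 * t - x + 1" for t x M
  proof -
    define s where "s = \<kappa> * x / t"
    have t: "t > 0" using x by simp
    have s: "s > 0" "s \<le> \<kappa>" using \<kappa> x t by (auto simp: s_def field_simps)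
    have st: "s * t = \<kappa> * x" using t by (simp add: s_def)
    let ?N = "real (nat \<lfloor>\<rho>\<^sup>2 * t\<rfloor>)" and ?\<sigma> = "\<rho> + s" and ?\<tau> = "\<alpha> - s"
    have \<tau>: "?\<tau> \<ge> 3/4 * \<alpha>" "?\<tau> > 0" "?\<tau> < 1" using s \<kappa> \<alpha> by auto
    have N: "?N \<ge> \<rho>\<^sup>2 * t - 1" using t by linarith
    have 1: "t - 2 / \<rho> * (s * t) - 1 / \<rho>\<^sup>2 \<le> ?N / ?\<sigma>\<^sup>2"
    proof -
      have "(1 - 2 * s / \<rho>) * ?\<sigma>\<^sup>2 = \<rho>\<^sup>2 - 3 * s\<^sup>2 - 2 * s ^ 3 / \<rho>"
        using assms by (simp add: field_simps power2_eq_square power3_eq_cube)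
      also have "\<dots> \<le> \<rho>\<^sup>2"
      proof -
        have "0 \<le> 2 * s ^ 3 / \<rho>" using s assms by simp
        then show ?thesis using zero_le_power2[of s] by linarith
      qed
      finally have "(1 - 2 * s / \<rho>) * ?\<sigma>\<^sup>2 * t \<le> \<rho>\<^sup>2 * t" using t by (intro mult_right_mono) auto
      then have "((1 - 2 * s / \<rho>) * t * ?\<sigma>\<^sup>2 - 1) / ?\<sigma>\<^sup>2 \<le> ?N / ?\<sigma>\<^sup>2"
        using N by (intro divide_right_mono) (auto simp: mult_ac)
      moreover have "((1 - 2 * s / \<rho>) * t * ?\<sigma>\<^sup>2 - 1) / ?\<sigma>\<^sup>2 = (1 - 2 * s / \<rho>) * t - 1 / ?\<sigma>\<^sup>2"
        using assms s by (simp add: diff_divide_distrib)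
      moreover have "1 / ?\<sigma>\<^sup>2 \<le> 1 / \<rho>\<^sup>2"
        using assms s by (intro divide_left_mono power_mono) auto
      ultimately show ?thesis by (simp add: algebra_simps)
    qed
    have 2: "real M / ?\<tau>\<^sup>2 \<le> t + 6 / \<alpha> * (s * t) + 4 / \<alpha>\<^sup>2 - x"
    proof -
      have "(1 + 6 * s / \<alpha>) * ?\<tau>\<^sup>2 = \<alpha>\<^sup>2 + s * (4 * \<alpha> - 11 * s) + 6 * s ^ 3 / \<alpha>"
        using \<alpha> by (simp add: field_simps power2_eq_square power3_eq_cube)
      moreover have "0 \<le> s * (4 * \<alpha> - 11 * s)" using s \<kappa> by (intro mult_nonneg_nonneg) auto
      ultimately have "\<alpha>\<^sup>2 \<le> (1 + 6 * s / \<alpha>) * ?\<tau>\<^sup>2" using s \<alpha> by simp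
      then have "\<alpha>\<^sup>2 * t \<le> (1 + 6 * s / \<alpha>) * ?\<tau>\<^sup>2 * t" using t by (intro mult_right_mono) auto
      then have "real M / ?\<tau>\<^sup>2 \<le> ((1 + 6 * s / \<alpha>) * t * ?\<tau>\<^sup>2 + 1 - x) / ?\<tau>\<^sup>2"
        using M by (intro divide_right_mono) (auto simp: mult_ac \<alpha>_def)
      moreover have "((1 + 6 * s / \<alpha>) * t * ?\<tau>\<^sup>2 + 1 - x) / ?\<tau>\<^sup>2 = (1 + 6 * s / \<alpha>) * t + 1 / ?\<tau>\<^sup>2 - x / ?\<tau>\<^sup>2"
        using \<tau> by (simp add: diff_divide_distrib add_divide_distrib)
      moreover have "1 / ?\<tau>\<^sup>2 \<le> 1 / (\<alpha> / 2)\<^sup>2"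
        using \<tau> \<alpha> by (intro divide_left_mono power_mono) auto
      moreover have "x \<le> x / ?\<tau>\<^sup>2"
      proof -
        have "?\<tau>\<^sup>2 \<le> 1" using \<tau> by (intro power_le_one) auto
        then show ?thesis using x \<tau> mult_left_mono[of "?\<tau>\<^sup>2" 1 x] by (simp add: field_simps)
      qed
      ultimately show ?thesis by (simp add: algebra_simps power_divide)
    qed
    have 3: "2 * s\<^sup>2 * real M / ?\<tau> ^ 4 \<le> 8 / \<alpha> ^ 4 * (s * t) + 8 / \<alpha> ^ 4"
    proof -
      have "(1 - \<rho>)\<^sup>2 * t \<le> 1 * t" using assms t by (intro mult_right_mono power_le_one) auto
      then have "real M \<le> t + 1" using M x by linarith
      moreover have "s\<^sup>2 \<le> s" "s \<le> 1" using s \<kappa> by (auto simp: power2_eq_square mult_left_le)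
      ultimately have "s\<^sup>2 * real M \<le> s * (t + 1)" using s t by (intro mult_mono) auto
      also have "\<dots> \<le> s * t + 1" using \<open>s \<le> 1\<close> by (simp add: algebra_simps)
      finally have a: "2 * s\<^sup>2 * real M \<le> 2 * (s * t + 1)" by simp
      have "\<alpha> ^ 4 / 4 \<le> (3/4 * \<alpha>) ^ 4" using \<alpha> by (simp add: power_mult_distrib power_divide)
      also have "\<dots> \<le> ?\<tau> ^ 4" using \<tau> \<alpha> by (intro power_mono) auto
      finally have "2 * s\<^sup>2 * real M / ?\<tau> ^ 4 \<le> 2 * (s * t + 1) / (\<alpha> ^ 4 / 4)"
        using a s t \<alpha> by (intro frac_le) auto
      then show ?thesis by (simp add: algebra_simps add_divide_distrib)
    qed
    have "real M / ?\<tau>\<^sup>2 + 2 * s\<^sup>2 * real M / ?\<tau> ^ 4 - ?N / ?\<sigma>\<^sup>2 \<le> L * (s * t) - x + C1"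
      using 1 2 3 by (simp add: L_def C1_def algebra_simps)
    also have "L * (s * t) = (\<kappa> * L) * x" by (simp add: st)
    also have "(\<kappa> * L) * x - x + C1 \<le> - x / 2 + C1"
    proof -
      have "(\<kappa> * L) * x \<le> 1 / 2 * x" using \<kappa>(3) x by (intro mult_right_mono) auto
      then show ?thesis by linarith
    qed
    finally have br: "real M / ?\<tau>\<^sup>2 + 2 * s\<^sup>2 * real M / ?\<tau> ^ 4 - ?N / ?\<sigma>\<^sup>2 \<le> - x / 2 + C1" .
    have "measure (exp_field (stat_rate \<rho>)) {w. 0 \<le> exit_gap w M (nat \<lfloor>\<rho>\<^sup>2 * t\<rfloor>)}
      \<le> exp (s\<^sup>2 / 2 * (real M / ?\<tau>\<^sup>2 + 2 * s\<^sup>2 * real M / ?\<tau> ^ 4 - ?N / ?\<sigma>\<^sup>2))"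
      using exit_gap_bound_exp[of \<rho> s M "nat \<lfloor>\<rho>\<^sup>2 * t\<rfloor>"] assms s \<kappa> \<tau>
      by (simp add: \<alpha>_def algebra_simps)
    also have "\<dots> \<le> exp (\<kappa>\<^sup>2 * C1 / 2 - (\<kappa>\<^sup>2 / 4) * x ^ 3 / t\<^sup>2)"
    proof (subst exp_le_cancel_iff)
      have "s\<^sup>2 / 2 * (real M / ?\<tau>\<^sup>2 + 2 * s\<^sup>2 * real M / ?\<tau> ^ 4 - ?N / ?\<sigma>\<^sup>2) \<le> s\<^sup>2 / 2 * (- x / 2 + C1)"
        using br by (intro mult_left_mono) auto
      also have "\<dots> = s\<^sup>2 * C1 / 2 - (\<kappa>\<^sup>2 / 4) * x ^ 3 / t\<^sup>2"
        using t by (simp add: s_def field_simps power2_eq_square power3_eq_cube)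
      also have "s\<^sup>2 * C1 / 2 \<le> \<kappa>\<^sup>2 * C1 / 2"
        using s assms \<alpha> by (intro divide_right_mono mult_right_mono power_mono) (auto simp: C1_def)
      finally show "s\<^sup>2 / 2 * (real M / ?\<tau>\<^sup>2 + 2 * s\<^sup>2 * real M / ?\<tau> ^ 4 - ?N / ?\<sigma>\<^sup>2)
        \<le> \<kappa>\<^sup>2 * C1 / 2 - (\<kappa>\<^sup>2 / 4) * x ^ 3 / t\<^sup>2" by simp
    qed
    also have "\<dots> = exp (\<kappa>\<^sup>2 * C1 / 2) * exp (- (\<kappa>\<^sup>2 / 4) * x ^ 3 / t\<^sup>2)"
      by (simp add: exp_add[symmetric])
    finally show ?thesis .
  qed
  show ?thesis by (rule that[of "\<kappa>\<^sup>2 / 4" "exp (\<kappa>\<^sup>2 * C1 / 2)"]) (use \<kappa> bound in auto)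
qed

text \<open>
For $x = a t^{2/3}$ the quotient $x^3/t^2$ equals $a^3$, independently of $t$.
\<close>

lemma Zstar_at_tail:
  fixes \<rho> :: real
  assumes "0 < \<rho>" "\<rho> < 1"
  shows "\<exists>C. \<forall>(M :: 'a measure) \<omega>. stationary_lpp M \<omega> \<rho> \<longrightarrow> (\<forall>a>0. \<forall>t>0.
    \<P>(x in M. Zstar_at \<rho> (\<lambda>p. \<omega> p x) t \<ge> a * t powr (2/3)) \<le> C * a powr (-3))"
proof -
  obtain c C where c: "c > 0" "C > 0" and tail:
    "\<And>t x M. 0 < x \<Longrightarrow> x \<le> t \<Longrightarrow> real M \<le> (1 - \<rho>)\<^sup>2 * t - x + 1 \<Longrightarrow>
      measure (exp_field (stat_rate \<rho>)) {w. 0 \<le> exit_gap w M (nat \<lfloor>\<rho>\<^sup>2 * t\<rfloor>)} \<le> C * exp (- c * x ^ 3 / t\<^sup>2)"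
    using exit_gap_tail[OF assms] by metis
  have "\<P>(x in M. Zstar_at \<rho> (\<lambda>p. \<omega> p x) t \<ge> a * t powr (2/3)) \<le> C / c * a powr (-3)"
    if st: "stationary_lpp M \<omega> \<rho>" and a: "a > 0" and t: "t > 0" for M :: "'a measure" and \<omega> a t
  proof -
    define z where "z = a * t powr (2/3)"
    define m n where "m = nat \<lfloor>(1 - \<rho>)\<^sup>2 * t\<rfloor>" and "n = nat \<lfloor>\<rho>\<^sup>2 * t\<rfloor>"
    have z: "z > 0" using a t by (simp add: z_def)
    have mt: "real m \<le> (1 - \<rho>)\<^sup>2 * t" using t unfolding m_def by simp
    have z3: "z ^ 3 / t\<^sup>2 = a ^ 3"
    proof -
      have "(t powr (2/3)) ^ 3 = t powr (of_nat 3 * (2/3))" using t by (intro powr_power) simp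
      also have "\<dots> = t\<^sup>2" using t by simp
      finally show ?thesis using t by (simp add: z_def power_mult_distrib)
    qed
    have "\<P>(x in M. Zstar_at \<rho> (\<lambda>p. \<omega> p x) t \<ge> a * t powr (2/3)) \<le> C * exp (- c * a ^ 3)"
    proof (cases "z \<le> real m")
      case True
      define N where "N = nat \<lfloor>real m - z + 1\<rfloor>"
      have "real N \<le> real m - z + 1" using True unfolding N_def by simp
      have "measure M {x \<in> space M. a * t powr (2/3) \<le> Zstar_at \<rho> (\<lambda>p. \<omega> p x) t}
        \<le> measure (exp_field (stat_rate \<rho>)) {w. 0 \<le> exit_gap w N n}"
      proof (rule measure_stationary_lpp[OF st assms])
        fix w :: "nat \<times> nat \<Rightarrow> real"
        assume w: "\<And>p. 0 \<le> w p" "w (0, 0) = 0" and "a * t powr (2/3) \<le> Zstar_at \<rho> w t"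
        then have "z \<le> Zstar w m n" by (simp add: z_def m_def n_def Zstar_at_def)
        with Zstar_ge_imp_exit_gap[of w z m n] w z obtain K
          where K: "real K \<le> real m - z + 1" "0 \<le> exit_gap w K n" by auto
        have "K \<le> N" using K(1) unfolding N_def by linarith
        then have "exit_gap w K n \<le> exit_gap w N n" by (rule exit_gap_mono[of w, OF w(1)])
        with K show "w \<in> {w. 0 \<le> exit_gap w N n}" by simp
      qed measurable
      also have "\<dots> \<le> C * exp (- c * z ^ 3 / t\<^sup>2)"
      proof -
        have "(1 - \<rho>)\<^sup>2 * t \<le> 1 * t" using assms t by (intro mult_right_mono power_le_one) auto
        then show ?thesis unfolding n_def
          using z True mt \<open>real N \<le> real m - z + 1\<close> by (intro tail) auto
      qed
      finally show ?thesis using z3 by (simp flip: times_divide_eq_right)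
    next
      case False
      have "measure M {x \<in> space M. a * t powr (2/3) \<le> Zstar_at \<rho> (\<lambda>p. \<omega> p x) t}
        \<le> measure (exp_field (stat_rate \<rho>)) {}"
      proof (rule measure_stationary_lpp[OF st assms])
        fix w :: "nat \<times> nat \<Rightarrow> real"
        assume w: "\<And>p. 0 \<le> w p" "w (0, 0) = 0" and "a * t powr (2/3) \<le> Zstar_at \<rho> w t"
        then have "z \<le> Zstar w m n" by (simp add: z_def m_def n_def Zstar_at_def)
        with Zstar_ge_imp_exit_gap[of w z m n] w z False show "w \<in> {}" by fastforce
      qed simp
      moreover have "0 \<le> C * exp (- c * a ^ 3)" using c by simp
      ultimately show ?thesis by simp
    qed
    also have "C * exp (- c * a ^ 3) \<le> C / c * a powr (-3)"
    proof -
      have "c * a ^ 3 \<le> exp (c * a ^ 3)" using exp_ge_add_one_self[of "c * a ^ 3"] by linarith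
      then have "exp (- (c * a ^ 3)) \<le> 1 / (c * a ^ 3)"
        using a c by (simp add: exp_minus field_simps)
      moreover have "a powr (-3) = 1 / a ^ 3"
        using a by (simp add: powr_minus_divide powr_numeral)
      ultimately show ?thesis using c mult_left_mono[of "exp (- (c * a ^ 3))" "1 / (c * a ^ 3)" C] by simp
    qed
    finally show ?thesis .
  qed
  then show ?thesis by blast
qed

section \<open>Early exits as random walk events\<close>

definition bulk_only :: "(nat \<times> nat \<Rightarrow> real) \<Rightarrow> nat \<times> nat \<Rightarrow> real" where
  "bulk_only w = (\<lambda>(i, j). if i = 0 \<or> j = 0 then 0 else w (i, j))"

text \<open>
Beyond $u$ the horizontal axis offers nothing, so that leaving it at $u$ or earlier is optimal.
\<close>

definition cut_row :: "nat \<Rightarrow> (nat \<times> nat \<Rightarrow> real) \<Rightarrow> nat \<times> nat \<Rightarrow> real" where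
  "cut_row u w = (\<lambda>(i, j). if j = 0 \<and> u < i then 0 else w (i, j))"

text \<open>
The best weight of a path that leaves the horizontal axis beyond $u$: such a path collects the first
$u$ axis weights and starts horizontally in the field seen from $(u,0)$.
\<close>

definition late_exit :: "nat \<Rightarrow> nat \<Rightarrow> nat \<Rightarrow> (nat \<times> nat \<Rightarrow> real) \<Rightarrow> real" where
  "late_exit m n u w = lpp w u 0 + lpp (hor_only (col_shift n u w)) (m - u) n"

definition early_exit :: "nat \<Rightarrow> nat \<Rightarrow> nat \<Rightarrow> (nat \<times> nat \<Rightarrow> real) \<Rightarrow> real" where
  "early_exit m n u w = lpp (hor_only (cut_row u w)) m n"

text \<open>
Seen from $(u,0)$, starting vertically means that the path has not used the axis beyond $u$. If this
is optimal there although starting horizontally is strictly optimal at the origin, then the best path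
leaves the horizontal axis between $1$ and $u$.
\<close>

lemma gap_change_imp_early_exit:
  assumes w: "\<And>p. 0 \<le> w p" "w (0, 0) = 0" and u: "u \<le> m"
    and gap: "0 < exit_gap w m n" "exit_gap (col_shift n u w) (m - u) n \<le> 0"
  shows "late_exit m n u w \<le> early_exit m n u w"
proof -
  define v where "v = cut_row u w"
  define w' v' where "w' = col_shift n u w" and "v' = col_shift n u v"
  have v0: "\<And>p. 0 \<le> v p" "v (0, 0) = 0" using w by (auto simp: v_def cut_row_def)
  have W: "w' (0, 0) = 0" "\<And>i j. i \<ge> 1 \<Longrightarrow> w' (i, j) = w (u + i, j)"
    "\<And>i j. j \<le> n \<Longrightarrow> lpp w (u + i) j = lpp w u 0 + lpp w' i j"
    using col_shift_props[of w n u, OF w(2)] unfolding w'_def by blast+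
  have V: "v' (0, 0) = 0" "\<And>i j. i \<ge> 1 \<Longrightarrow> v' (i, j) = v (u + i, j)"
    "\<And>i j. j \<le> n \<Longrightarrow> lpp v (u + i) j = lpp v u 0 + lpp v' i j"
    using col_shift_props[of v n u, OF v0(2)] unfolding v'_def by blast+
  have w'0: "0 \<le> w' p" for p unfolding w'_def by (rule col_shift_nonneg[of w, OF w(1)])
  have same: "lpp v u j = lpp w u j" for j by (rule lpp_cong) (simp add: v_def cut_row_def)
  have col: "lpp v' 0 j = lpp w' 0 j" if "j \<le> n" for j
    using W(3)[OF that, of 0] V(3)[OF that, of 0] same[of j] same[of 0] by simp
  have edge: "v' (0, j) = w' (0, j)" if "j \<le> n" for j
  proof (cases j)
    case (Suc k)
    then show ?thesis using col[of j] col[of k] that by simp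
  qed (simp add: V W)
  have "lpp v' (m - u) n = lpp (ver_only w') (m - u) n"
  proof (rule lpp_cong)
    fix i j assume "j \<le> n"
    then show "v' (i, j) = ver_only w' (i, j)"
      using edge[of j] V(1,2) W(2)
      by (cases "i = 0"; cases "j = 0") (auto simp: ver_only_def v_def cut_row_def)
  qed
  then have cut: "lpp v m n = lpp w u 0 + lpp (ver_only w') (m - u) n"
    using V(3)[of n "m - u"] u same[of 0] by simp
  have "ver_only v = ver_only w" by (auto simp: ver_only_def v_def cut_row_def fun_eq_iff)
  then have vmax: "lpp v m n = max (early_exit m n u w) (lpp (ver_only w) m n)"
    using lpp_eq_max[of v m n, OF v0] by (simp add: early_exit_def v_def)
  have "lpp w m n = lpp w u 0 + max (lpp (hor_only w') (m - u) n) (lpp (ver_only w') (m - u) n)"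
    using W(3)[of n "m - u"] u lpp_eq_max[of w' "m - u" n, OF w'0 W(1)] by simp
  then have "lpp w m n = max (late_exit m n u w) (lpp v m n)"
    using cut by (simp add: late_exit_def w'_def max_def)
  moreover have "lpp (ver_only w) m n < lpp w m n"
    using gap(1) lpp_eq_max[of w m n, OF w] by (simp add: exit_gap_def)
  moreover have "late_exit m n u w \<le> lpp v m n"
    using gap(2) cut by (simp add: late_exit_def w'_def exit_gap_def)
  ultimately show ?thesis using vmax by (simp add: max_def split: if_splits)
qed

lemma lpp_strip_column:
  assumes "\<And>j. x (0, j) = 0" "\<And>p. 0 \<le> x p"
  shows "lpp x (Suc i) j = lpp (\<lambda>(i, j). x (Suc i, j)) i j"
proof (induction i j rule: grid_induct)
  case (3 j)
  have "lpp x 0 (Suc j) = 0" using assms(1) by (intro lpp_zero_column)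
  moreover have "0 \<le> lpp x (Suc 0) j" using assms(2) by (rule lpp_nonneg)
  ultimately show ?case using 3 by simp
qed (use assms in auto)

lemma lpp_strip_row:
  assumes "\<And>i. x (i, 0) = 0" "\<And>p. 0 \<le> x p"
  shows "lpp x i (Suc j) = lpp (\<lambda>(i, j). x (i, Suc j)) i j"
proof -
  have "lpp (\<lambda>(i, j). x (j, i)) (Suc j) i = lpp (\<lambda>(i, j). case (Suc i, j) of (i, j) \<Rightarrow> x (j, i)) j i"
    using assms by (intro lpp_strip_column) auto
  then show ?thesis
    using lpp_swap[of x "Suc j" i] lpp_swap[of "\<lambda>(i, j). x (i, Suc j)" j i] by simp
qed

lemma lpp_last_row_ge:
  "i' \<le> i \<Longrightarrow> lpp x i' j + (\<Sum>l\<in>{i'..i}. x (l, Suc j)) \<le> lpp x i (Suc j)"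
proof (induction i)
  case (Suc i)
  show ?case
  proof (cases "i' = Suc i")
    case False
    then have "i' \<le> i" using Suc.prems by simp
    then show ?thesis using Suc.IH by simp
  qed simp
qed simp

lemma lpp_last_row_eq:
  "\<exists>i'\<le>i. lpp x i (Suc j) = lpp x i' j + (\<Sum>l\<in>{i'..i}. x (l, Suc j))"
proof (induction i)
  case (Suc i)
  then obtain i' where i': "i' \<le> i" "lpp x i (Suc j) = lpp x i' j + (\<Sum>l\<in>{i'..i}. x (l, Suc j))" by blast
  show ?case
  proof (cases "lpp x i (Suc j) \<le> lpp x (Suc i) j")
    case True
    then show ?thesis by (intro exI[of _ "Suc i"]) simp
  next
    case False
    then show ?thesis using i' by (intro exI[of _ i']) simp
  qed
qed simp

text \<open>
The bulk of the rectangle seen from its upper right corner, with zero weights on the axes.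
\<close>

definition bulk_reflect :: "nat \<Rightarrow> nat \<Rightarrow> (nat \<times> nat \<Rightarrow> real) \<Rightarrow> nat \<times> nat \<Rightarrow> real" where
  "bulk_reflect m n w = bulk_only (\<lambda>(i, j). w (m + 1 - i, n + 1 - j))"

text \<open>
After the reflection the horizontal axis is the last row, so a path that leaves the axis at $z$ turns
into one that enters the last row at the mirror image of $z$.
\<close>

lemma lpp_hor_only_reflect:
  assumes w: "\<And>p. 0 \<le> w p" and m: "m \<ge> 1" and n: "n \<ge> 1"
  shows "\<exists>R. lpp (hor_only w) m n = lpp R (m - 1) n
    \<and> (\<forall>l<m. R (l, n) = w (m - l, 0))
    \<and> (\<forall>i<m. lpp R i (n - 1) = lpp (bulk_reflect m n w) (Suc i) n)"
proof -
  obtain m' n' where mn: "m = Suc m'" "n = Suc n'" using m n by (metis Suc_le_D One_nat_def)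
  define R where "R = (\<lambda>(i, j). case (m' - i, n - j) of (i, j) \<Rightarrow> w (Suc i, j))"
  have "lpp (hor_only w) m n = lpp (\<lambda>(i, j). hor_only w (Suc i, j)) m' n"
    unfolding mn(1) using w by (intro lpp_strip_column) (auto simp: hor_only_def)
  also have "\<dots> = lpp (\<lambda>(i, j). w (Suc i, j)) m' n"
    by (intro lpp_cong) (simp add: hor_only_def)
  also have "\<dots> = lpp R m' n"
    using lpp_reflect[of "\<lambda>(i, j). w (Suc i, j)" m' n] by (simp add: R_def)
  finally have 1: "lpp (hor_only w) m n = lpp R (m - 1) n" using mn by simp
  have 2: "R (l, n) = w (m - l, 0)" if "l < m" for l
    using that mn by (simp add: R_def Suc_diff_le)
  have 3: "lpp R i (n - 1) = lpp (bulk_reflect m n w) (Suc i) n" if "i < m" for i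
  proof -
    let ?x = "bulk_reflect m n w"
    have x: "\<And>j. ?x (0, j) = 0" "\<And>i. ?x (i, 0) = 0" "\<And>p. 0 \<le> ?x p"
      using w by (auto simp: bulk_reflect_def bulk_only_def)
    have "lpp ?x (Suc i) n = lpp (\<lambda>(i, j). ?x (Suc i, j)) i n"
      using x by (intro lpp_strip_column)
    also have "\<dots> = lpp (\<lambda>(i, j). case (i, Suc j) of (i, j) \<Rightarrow> ?x (Suc i, j)) i n'"
      unfolding mn(2) by (intro lpp_strip_row) (auto simp: bulk_reflect_def bulk_only_def w)
    also have "\<dots> = lpp R i n'"
      using that mn by (intro lpp_cong) (auto simp: R_def bulk_reflect_def bulk_only_def Suc_diff_le)
    finally show ?thesis using mn by simp
  qed
  show ?thesis using 1 2 3 by blast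
qed

lemma sum_reflect:
  fixes f :: "nat \<Rightarrow> real"
  assumes "i < m"
  shows "(\<Sum>l\<in>{i..m - 1}. f (m - l)) = (\<Sum>z\<in>{1..m - i}. f z)"
  using assms by (intro sum.reindex_bij_witness[of _ "\<lambda>z. m - z" "\<lambda>l. m - l"]) auto

lemma lpp_hor_only_ge_profile:
  assumes w: "\<And>p. 0 \<le> w p" and n: "n \<ge> 1" and z: "1 \<le> z" "z \<le> m"
  shows "(\<Sum>l\<in>{1..z}. w (l, 0)) + lpp (bulk_reflect m n w) (m + 1 - z) n \<le> lpp (hor_only w) m n"
proof -
  have m: "m \<ge> 1" using z by simp
  obtain R where R: "lpp (hor_only w) m n = lpp R (m - 1) n" "\<forall>l<m. R (l, n) = w (m - l, 0)"
    "\<forall>i<m. lpp R i (n - 1) = lpp (bulk_reflect m n w) (Suc i) n"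
    using lpp_hor_only_reflect[of w m n, OF w m n] by blast
  have "lpp R (m - z) (n - 1) + (\<Sum>l\<in>{m - z..m - 1}. R (l, Suc (n - 1))) \<le> lpp R (m - 1) (Suc (n - 1))"
    using z by (intro lpp_last_row_ge) simp
  moreover have "(\<Sum>l\<in>{m - z..m - 1}. R (l, n)) = (\<Sum>l\<in>{m - z..m - 1}. w (m - l, 0))"
    using R(2) m by (intro sum.cong) auto
  moreover have "\<dots> = (\<Sum>l\<in>{1..z}. w (l, 0))"
    using sum_reflect[of "m - z" m "\<lambda>l. w (l, 0)"] z by simp
  moreover have "Suc (m - z) = m + 1 - z" using z by simp
  ultimately show ?thesis using R(1,3) z n by (simp add: R(3))
qed

lemma lpp_hor_only_eq_profile:
  assumes w: "\<And>p. 0 \<le> w p" and n: "n \<ge> 1" and m: "m \<ge> 1"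
  shows "\<exists>z. 1 \<le> z \<and> z \<le> m \<and>
    lpp (hor_only w) m n = (\<Sum>l\<in>{1..z}. w (l, 0)) + lpp (bulk_reflect m n w) (m + 1 - z) n"
proof -
  obtain R where R: "lpp (hor_only w) m n = lpp R (m - 1) n" "\<forall>l<m. R (l, n) = w (m - l, 0)"
    "\<forall>i<m. lpp R i (n - 1) = lpp (bulk_reflect m n w) (Suc i) n"
    using lpp_hor_only_reflect[of w m n, OF w m n] by blast
  obtain i where i: "i \<le> m - 1"
    "lpp R (m - 1) (Suc (n - 1)) = lpp R i (n - 1) + (\<Sum>l\<in>{i..m - 1}. R (l, Suc (n - 1)))"
    using lpp_last_row_eq[of "m - 1" R "n - 1"] by blast
  have "(\<Sum>l\<in>{i..m - 1}. R (l, n)) = (\<Sum>l\<in>{i..m - 1}. w (m - l, 0))"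
    using R(2) m by (intro sum.cong) auto
  also have "\<dots> = (\<Sum>l\<in>{1..m - i}. w (l, 0))"
    using i(1) m by (intro sum_reflect) simp
  finally show ?thesis
    using i R(1,3) m n by (intro exI[of _ "m - i"]) (simp add: R(3))
qed

lemma lpp_mono_col:
  assumes "\<And>p. 0 \<le> x p" "i \<le> i'"
  shows "lpp x i j \<le> lpp x i' j"
proof -
  have "lpp x i j \<le> lpp x (Suc i) j" for i
    using assms(1) by (cases j) (simp_all add: add_increasing)
  then show ?thesis using assms(2) by (rule lift_Suc_mono_le)
qed

text \<open>
Comparing the best exit $y \le u$ with an exit at $z > u$ compares sums of axis weights with differences
of bulk last-passage values; $Y$ bounds the latter from above. Both sides are written as walks that
start at $u$, since an upper bound on the bulk increments is then all that is needed.
\<close>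

lemma early_exit_imp_walk:
  fixes Y :: "nat \<Rightarrow> real"
  assumes w: "\<And>p. 0 \<le> w p" "w (0, 0) = 0" and n: "n \<ge> 1" and uv: "1 \<le> u" "u \<le> v" "v \<le> m"
    and early: "late_exit m n u w \<le> early_exit m n u w"
    and Y: "\<And>z. 1 \<le> z \<Longrightarrow> z < v \<Longrightarrow>
      lpp (bulk_reflect m n w) (m + 1 - z) n - lpp (bulk_reflect m n w) (m - z) n \<le> Y z"
  shows "\<exists>y. 1 \<le> y \<and> y \<le> u \<and> (\<forall>z. u < z \<and> z \<le> v \<longrightarrow>
    (\<Sum>i\<in>{u..<z}. w (Suc i, 0) - Y i) \<le> (\<Sum>i\<in>{y..<u}. Y i - w (Suc i, 0)))"
proof -
  define a where "a i = lpp (bulk_reflect m n w) i n" for i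
  define U where "U z = (\<Sum>l\<in>{1..z}. w (l, 0))" for z
  have a_mono: "a i \<le> a i'" if "i \<le> i'" for i i'
    unfolding a_def using w that by (intro lpp_mono_col) (auto simp: bulk_reflect_def bulk_only_def)
  have U_diff: "(\<Sum>i\<in>{y..<z}. w (Suc i, 0)) = U z - U y" if "y \<le> z" for y z
    using that
  proof (induction z rule: dec_induct)
    case (step z)
    then show ?case by (simp add: U_def)
  qed simp
  have a_diff: "a (m + 1 - y) - a (m + 1 - z) \<le> (\<Sum>i\<in>{y..<z}. Y i)" if "1 \<le> y" "y \<le> z" "z \<le> v" for y z
    using that(2,3)
  proof (induction z rule: dec_induct)
    case (step z)
    have "a (m + 1 - z) - a (m - z) \<le> Y z" using Y[of z] step that by (simp add: a_def)
    then show ?case using step by simp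
  qed simp
  have cut0: "\<And>p. 0 \<le> cut_row u w p" using w by (auto simp: cut_row_def)
  have m: "m \<ge> 1" using uv by simp
  from lpp_hor_only_eq_profile[of "cut_row u w" n m, OF cut0 n m] obtain z0 where z0: "1 \<le> z0" "z0 \<le> m"
    "early_exit m n u w = (\<Sum>l\<in>{1..z0}. cut_row u w (l, 0)) + lpp (bulk_reflect m n (cut_row u w)) (m + 1 - z0) n"
    unfolding early_exit_def by blast
  have refl_cut: "lpp (bulk_reflect m n (cut_row u w)) (m + 1 - z0) n = a (m + 1 - z0)"
    unfolding a_def by (intro lpp_cong) (auto simp: bulk_reflect_def bulk_only_def cut_row_def)
  \<comment> \<open>Beyond $u$ the cut axis has weight zero, so an exit at $z_0 > u$ is no better than one at $u$.\<close>
  define y where "y = min z0 u"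
  have y: "1 \<le> y" "y \<le> u" using z0 uv by (auto simp: y_def)
  have "(\<Sum>l\<in>{1..z0}. cut_row u w (l, 0)) = U y"
    unfolding U_def by (rule sum.mono_neutral_cong_right) (auto simp: y_def cut_row_def)
  moreover have "a (m + 1 - z0) \<le> a (m + 1 - y)" by (rule a_mono) (auto simp: y_def)
  ultimately have K: "early_exit m n u w \<le> U y + a (m + 1 - y)" using z0(3) refl_cut by simp
  have H: "U z + a (m + 1 - z) \<le> late_exit m n u w" if z: "u < z" "z \<le> v" for z
  proof -
    define w' where "w' = col_shift n u w"
    have w'0: "\<And>p. 0 \<le> w' p" unfolding w'_def by (rule col_shift_nonneg[of w, OF w(1)])
    have w's: "w' (i, j) = w (u + i, j)" if "i \<ge> 1" for i j
      using col_shift_props[of w n u, OF w(2)] that unfolding w'_def by blast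
    have "(\<Sum>l\<in>{1..z - u}. w' (l, 0)) + lpp (bulk_reflect (m - u) n w') (m - u + 1 - (z - u)) n \<le> lpp (hor_only w') (m - u) n"
      using z uv by (intro lpp_hor_only_ge_profile w'0 n) auto
    moreover have "m - u + 1 - (z - u) = m + 1 - z" using z uv by simp
    moreover have "lpp (bulk_reflect (m - u) n w') (m + 1 - z) n = a (m + 1 - z)"
      unfolding a_def using z uv
      by (intro lpp_cong) (auto simp: bulk_reflect_def bulk_only_def w's)
    moreover have "(\<Sum>l\<in>{1..z - u}. w' (l, 0)) = U z - U u"
    proof -
      have "(\<Sum>l\<in>{1..z - u}. w' (l, 0)) = (\<Sum>l\<in>{1..z - u}. w (u + l, 0))"
        using w's by (intro sum.cong) auto
      also have "\<dots> = (\<Sum>i\<in>{u..<z}. w (Suc i, 0))"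
        using z by (intro sum.reindex_bij_witness[of _ "\<lambda>i. Suc i - u" "\<lambda>l. u + l - 1"]) auto
      finally show ?thesis using U_diff z by simp
    qed
    moreover have "lpp w u 0 = U u"
      using w(2) by (simp add: lpp_row0 U_def atMost_atLeast0 sum.atLeast_Suc_atMost)
    ultimately show ?thesis by (simp add: late_exit_def w'_def)
  qed
  have "(\<Sum>i\<in>{u..<z}. w (Suc i, 0) - Y i) \<le> (\<Sum>i\<in>{y..<u}. Y i - w (Suc i, 0))" if z: "u < z" "z \<le> v" for z
    using H[OF z] K early U_diff[of u z] U_diff[of y u] a_diff[of u z] a_diff[of y u] z y uv
    by (simp add: sum_subtractf)
  with y show ?thesis by blast
qed

text \<open>
Where $D \ge 0$ the full last-passage values agree with those of $G_h$, and the horizontal weights only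
increase horizontal increments.
\<close>

lemma bulk_increment_le:
  assumes w: "\<And>p. 0 \<le> w p" "w (0, 0) = 0" and gap: "0 \<le> exit_gap w i0 n" and i: "i0 \<le> i"
  shows "lpp (bulk_only w) (Suc i) n - lpp (bulk_only w) i n \<le> lpp w (Suc i) n - lpp w i n"
proof -
  have eq: "lpp w k n = lpp (hor_only w) k n" if "i0 \<le> k" for k
    using lpp_eq_max[of w k n, OF w] gap exit_gap_mono[of w, OF w(1) that, of n]
    by (simp add: exit_gap_def)
  have "lpp (bulk_only w) (Suc i) n - lpp (bulk_only w) i n \<le> lpp (hor_only w) (Suc i) n - lpp (hor_only w) i n"
    using lpp_compare[of "bulk_only w" "hor_only w" i n] w by (auto simp: bulk_only_def hor_only_def)
  then show ?thesis using eq[of i] eq[of "Suc i"] i by simp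
qed

section \<open>Random walks with exponential steps\<close>

text \<open>
The partial sums of the steps $w(p_i) - w(q_i)$ from the index $j$ on. The starting index is a
parameter because the estimates condition on the first step.
\<close>

definition walk :: "(nat \<Rightarrow> 'i) \<Rightarrow> (nat \<Rightarrow> 'i) \<Rightarrow> nat \<Rightarrow> ('i \<Rightarrow> real) \<Rightarrow> nat \<Rightarrow> real" where
  "walk p q j w z = (\<Sum>i<z. w (p (j + i)) - w (q (j + i)))"

definition walk_below :: "(nat \<Rightarrow> 'i) \<Rightarrow> (nat \<Rightarrow> 'i) \<Rightarrow> nat \<Rightarrow> nat \<Rightarrow> real \<Rightarrow> ('i \<Rightarrow> real) \<Rightarrow> bool" where
  "walk_below p q k j x w \<longleftrightarrow> (\<forall>z<k. walk p q j w (Suc z) \<le> x)"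

definition walk_above :: "(nat \<Rightarrow> 'i) \<Rightarrow> (nat \<Rightarrow> 'i) \<Rightarrow> nat \<Rightarrow> nat \<Rightarrow> real \<Rightarrow> ('i \<Rightarrow> real) \<Rightarrow> bool" where
  "walk_above p q k j x w \<longleftrightarrow> (\<exists>z<Suc k. x \<le> walk p q j w z)"

lemma walk_Suc: "walk p q j w (Suc z) = (w (p j) - w (q j)) + walk p q (Suc j) w z"
  unfolding walk_def by (subst sum.lessThan_Suc_shift) simp

lemma walk_below_simps [simp]:
  "walk_below p q 0 j x w"
  "walk_below p q (Suc k) j x w \<longleftrightarrow>
     w (p j) - w (q j) \<le> x \<and> walk_below p q k (Suc j) (x - (w (p j) - w (q j))) w"
  by (auto simp: walk_below_def All_less_Suc2 walk_Suc[of p q j] walk_def[of _ _ _ _ 0] algebra_simps)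

lemma walk_above_simps [simp]:
  "walk_above p q 0 j x w \<longleftrightarrow> x \<le> 0"
  "walk_above p q (Suc k) j x w \<longleftrightarrow>
     x \<le> 0 \<or> walk_above p q k (Suc j) (x - (w (p j) - w (q j))) w"
  unfolding walk_above_def Ex_less_Suc2[of "Suc k"]
  by (auto simp: walk_Suc[of p q j] walk_def[of _ _ _ _ 0] algebra_simps)

lemma walk_measurable [measurable]: "(\<lambda>w. walk p q j w z) \<in> borel_measurable field_space"
  unfolding walk_def by measurable

lemma walk_sets [measurable]:
  "{w. walk_below p q k j x w} \<in> sets field_space" "{w. walk_above p q k j x w} \<in> sets field_space"
  unfolding walk_below_def walk_above_def by (rule sets_field_Collect, measurable)+

lemma nn_integral_exp_law_exp:
  assumes "a > 0" "a + s > 0"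
  shows "(\<integral>\<^sup>+x. ennreal (exp (- s * x)) \<partial>exp_law a) = ennreal (a / (a + s))"
proof -
  have "emeasure (exp_law (a + s)) UNIV = 1"
    using prob_space.emeasure_space_1[OF prob_space_exp_law[of "a + s"]] by simp
  then show ?thesis using nn_integral_exp_law_tilt[OF assms, of "\<lambda>_. 1"] by simp
qed

lemma emeasure_resample2:
  assumes A: "{w. P w} \<in> sets field_space" and pq: "p \<noteq> q"
  shows "emeasure (exp_field r) {w. P w} =
    (\<integral>\<^sup>+x. \<integral>\<^sup>+y. emeasure (exp_field r) {w. P (w(q := y, p := x))} \<partial>exp_law (r q) \<partial>exp_law (r p))"
proof -
  let ?g = "indicator {w. P w} :: _ \<Rightarrow> ennreal"
  have g: "?g \<in> borel_measurable field_space" using A by simp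
  have m1: "(\<lambda>w. ?g (w(p := x))) \<in> borel_measurable field_space" for x
    using measurable_compose[OF measurable_fun_upd_const g] by simp
  have m2: "(\<lambda>w. ?g (w(q := y, p := x))) \<in> borel_measurable field_space" for x y
    using measurable_compose[OF measurable_fun_upd_const m1] by simp
  have s2: "{w. P (w(q := y, p := x))} \<in> sets field_space" for x y
  proof -
    have "(\<lambda>w. w(q := y, p := x)) \<in> measurable field_space field_space"
      by (rule measurable_field_map) (auto simp: fun_upd_def)
    from measurable_sets[OF this A] show ?thesis by (simp add: vimage_def)
  qed
  have "emeasure (exp_field r) {w. P w} = (\<integral>\<^sup>+w. ?g w \<partial>exp_field r)" using A by simp
  also have "\<dots> = (\<integral>\<^sup>+x. \<integral>\<^sup>+y. \<integral>\<^sup>+w. ?g (w(q := y, p := x)) \<partial>exp_field r \<partial>exp_law (r q) \<partial>exp_law (r p))"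
    by (subst nn_integral_exp_field_resample_same[OF g, of _ p], subst nn_integral_exp_field_resample_same[OF m1, of _ _ q]) simp
  also have "\<dots> = (\<integral>\<^sup>+x. \<integral>\<^sup>+y. emeasure (exp_field r) {w. P (w(q := y, p := x))} \<partial>exp_law (r q) \<partial>exp_law (r p))"
  proof (rule nn_integral_cong, rule nn_integral_cong)
    fix x y
    have "(\<integral>\<^sup>+w. ?g (w(q := y, p := x)) \<partial>exp_field r) = (\<integral>\<^sup>+w. indicator {w. P (w(q := y, p := x))} w \<partial>exp_field r)"
      by (rule nn_integral_cong) (simp add: indicator_def)
    also have "\<dots> = emeasure (exp_field r) {w. P (w(q := y, p := x))}"
      using s2[of y x] by (intro nn_integral_indicator) simp
    finally show "(\<integral>\<^sup>+w. ?g (w(q := y, p := x)) \<partial>exp_field r) = emeasure (exp_field r) {w. P (w(q := y, p := x))}" .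
  qed
  finally show ?thesis .
qed

locale walk_field =
  fixes p q :: "nat \<Rightarrow> 'i" and N :: nat and r :: "'i \<Rightarrow> real" and \<alpha> \<beta> :: real
  assumes p_inj: "inj_on p {..<N}" and q_inj: "inj_on q {..<N}"
    and pq: "\<And>i j. i < N \<Longrightarrow> j < N \<Longrightarrow> p i \<noteq> q j"
    and rp: "\<And>i. i < N \<Longrightarrow> r (p i) = \<alpha>" and rq: "\<And>i. i < N \<Longrightarrow> r (q i) = \<beta>"
    and pos: "0 < \<alpha>" "0 < \<beta>"
begin

lemma walk_upd:
  assumes "j < j'" "j' + z \<le> N"
  shows "walk p q j' (w(q j := b, p j := a)) z = walk p q j' w z"
  unfolding walk_def
proof (rule sum.cong)
  fix i assume "i \<in> {..<z}"
  then have "j' + i < N" "j < N" "j \<noteq> j' + i" using assms by auto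
  then have "p (j' + i) \<noteq> p j" "q (j' + i) \<noteq> q j" "p (j' + i) \<noteq> q j" "q (j' + i) \<noteq> p j"
    using p_inj q_inj pq[of "j' + i" j] pq[of j "j' + i"] by (auto simp: inj_on_def)
  then show "(w(q j := b, p j := a)) (p (j' + i)) - (w(q j := b, p j := a)) (q (j' + i)) = w (p (j' + i)) - w (q (j' + i))"
    by simp
qed simp

lemma walk_above_upd:
  "j < j' \<Longrightarrow> j' + k \<le> N \<Longrightarrow> walk_above p q k j' x (w(q j := b, p j := a)) = walk_above p q k j' x w"
  unfolding walk_above_def by (intro ex_cong conj_cong refl) (simp add: walk_upd)

lemma walk_below_upd:
  "j < j' \<Longrightarrow> j' + k \<le> N \<Longrightarrow> walk_below p q k j' x (w(q j := b, p j := a)) = walk_below p q k j' x w"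
  unfolding walk_below_def by (intro all_cong) (simp add: walk_upd)

text \<open>
The exponential maximal inequality: $e^{\theta S_k} \varphi^{-k}$ is a martingale for the partial sums
$S_k$ of the walk. The induction on the number of steps conditions on the first one.
\<close>

lemma walk_above_bound:
  assumes \<theta>: "0 < \<theta>" "\<theta> < \<alpha>" and \<phi>: "\<phi> = \<alpha> / (\<alpha> - \<theta>) * (\<beta> / (\<beta> + \<theta>))" "1 \<le> \<phi>"
  shows "j + k \<le> N \<Longrightarrow> emeasure (exp_field r) {w. walk_above p q k j x w} \<le> ennreal (exp (- \<theta> * x) * \<phi> ^ k)"
proof (induction k arbitrary: j x)
  case 0
  have "emeasure (exp_field r) {w :: 'i \<Rightarrow> real. x \<le> 0} \<le> ennreal (exp (- \<theta> * x))"
  proof (cases "x \<le> 0")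
    case True
    then have "1 \<le> exp (- \<theta> * x)" using \<theta> by (simp add: mult_nonneg_nonpos)
    then show ?thesis using True by (simp add: ennreal_1[symmetric] del: ennreal_1)
  qed simp
  then show ?case by simp
next
  case (Suc k)
  show ?case
  proof (cases "x \<le> 0")
    case True
    then have "1 \<le> exp (- \<theta> * x)" "1 \<le> \<phi> ^ Suc k" using \<theta> \<phi>(2) by (auto simp: mult_nonneg_nonpos simp del: power_Suc)
    then have "1 \<le> exp (- \<theta> * x) * \<phi> ^ Suc k" using mult_mono[of 1 "exp (- \<theta> * x)" 1 "\<phi> ^ Suc k"] by simp
    then have "ennreal 1 \<le> ennreal (exp (- \<theta> * x) * \<phi> ^ Suc k)" by (rule ennreal_leI)
    then show ?thesis using True by simp
  next
    case False
    have jN: "j < N" using Suc.prems by simp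
    have "emeasure (exp_field r) {w. walk_above p q (Suc k) j x w}
      = (\<integral>\<^sup>+a. \<integral>\<^sup>+b. emeasure (exp_field r) {w. walk_above p q (Suc k) j x (w(q j := b, p j := a))}
          \<partial>exp_law \<beta> \<partial>exp_law \<alpha>)"
      using emeasure_resample2[where P = "walk_above p q (Suc k) j x" and p = "p j" and q = "q j" and r = r,
          OF walk_sets(2) pq[OF jN jN]] rp[OF jN] rq[OF jN] by simp
    also have "\<dots> = (\<integral>\<^sup>+a. \<integral>\<^sup>+b. emeasure (exp_field r) {w. walk_above p q k (Suc j) (x - (a - b)) w}
          \<partial>exp_law \<beta> \<partial>exp_law \<alpha>)"
      using False pq[OF jN jN] Suc.prems by (simp add: walk_above_upd)
    also have "\<dots> \<le> (\<integral>\<^sup>+a. \<integral>\<^sup>+b. ennreal (exp (- \<theta> * (x - (a - b))) * \<phi> ^ k) \<partial>exp_law \<beta> \<partial>exp_law \<alpha>)"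
      using Suc.prems by (intro nn_integral_mono Suc.IH) simp
    also have "\<dots> = (\<integral>\<^sup>+a. \<integral>\<^sup>+b. ennreal (exp (- \<theta> * x) * \<phi> ^ k) * (ennreal (exp (- (- \<theta>) * a)) * ennreal (exp (- \<theta> * b)))
        \<partial>exp_law \<beta> \<partial>exp_law \<alpha>)"
    proof (rule nn_integral_cong, rule nn_integral_cong)
      fix a b :: real
      have "exp (- \<theta> * (x - (a - b))) = exp (- \<theta> * x) * (exp (- (- \<theta>) * a) * exp (- \<theta> * b))"
        by (simp add: exp_add[symmetric] algebra_simps)
      then have "exp (- \<theta> * (x - (a - b))) * \<phi> ^ k = (exp (- \<theta> * x) * \<phi> ^ k) * (exp (- (- \<theta>) * a) * exp (- \<theta> * b))"
        by (simp only: mult_ac)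
      then show "ennreal (exp (- \<theta> * (x - (a - b))) * \<phi> ^ k)
        = ennreal (exp (- \<theta> * x) * \<phi> ^ k) * (ennreal (exp (- (- \<theta>) * a)) * ennreal (exp (- \<theta> * b)))"
        using \<phi>(2) by (simp add: ennreal_mult[symmetric])
    qed
    also have "\<dots> = ennreal (exp (- \<theta> * x) * \<phi> ^ k) * (ennreal (\<alpha> / (\<alpha> - \<theta>)) * ennreal (\<beta> / (\<beta> + \<theta>)))"
      using nn_integral_exp_law_exp[of \<alpha> "- \<theta>"] nn_integral_exp_law_exp[of \<beta> \<theta>] pos \<theta>
      by (simp add: nn_integral_cmult nn_integral_multc)
    also have "\<dots> = ennreal (exp (- \<theta> * x) * \<phi> ^ Suc k)"
      using pos \<theta> \<phi> by (simp add: ennreal_mult[symmetric] mult_ac)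
    finally show ?thesis .
  qed
qed

text \<open>
Given that an exponential variable of rate $\alpha$ exceeds $y$, its excess is again exponential, and
$\beta/\alpha$ is exactly the factor for which $\mathbf E\, (\beta/\alpha) e^{s\xi} = 1$ for this excess
$\xi$. Hence the contribution of the values above $y$ to the expectation of
$1 - (\beta/\alpha) e^{-s(y-a)}$ vanishes.
\<close>

lemma exp_law_overshoot:
  assumes s: "0 < s" "\<alpha> = \<beta> + s" and y: "0 \<le> y"
  shows "(\<integral>\<^sup>+a. (if a \<le> y then ennreal (1 - \<beta> / \<alpha> * exp (- s * (y - a))) else 0) \<partial>exp_law \<alpha>)
    = ennreal (1 - exp (- s * y))"
proof -
  let ?f = "\<lambda>a. \<alpha> * exp (- \<alpha> * a) - \<beta> * exp (- s * y) * exp (- \<beta> * a)"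
  let ?F = "\<lambda>a. - exp (- \<alpha> * a) + exp (- s * y) * exp (- \<beta> * a)"
  have f: "\<alpha> * exp (- a * \<alpha>) * (1 - \<beta> / \<alpha> * exp (- s * (y - a))) = ?f a" for a
  proof -
    have "exp (- a * \<alpha>) * exp (- s * (y - a)) = exp (- s * y) * exp (- \<beta> * a)"
      by (simp add: exp_add[symmetric] s(2) algebra_simps)
    moreover have "\<alpha> * exp (- a * \<alpha>) * (1 - \<beta> / \<alpha> * exp (- s * (y - a)))
      = \<alpha> * exp (- a * \<alpha>) - \<beta> * (exp (- a * \<alpha>) * exp (- s * (y - a)))"
      using pos by (simp add: field_simps)
    ultimately show ?thesis by (simp add: mult.commute mult.left_commute)
  qed
  have nonneg: "0 \<le> 1 - \<beta> / \<alpha> * exp (- s * (y - a))" if "a \<le> y" for a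
  proof -
    have "\<beta> / \<alpha> \<le> 1" using s pos by simp
    moreover have "exp (- s * (y - a)) \<le> 1" using s that by simp
    ultimately have "\<beta> / \<alpha> * exp (- s * (y - a)) \<le> 1 * 1" using pos by (intro mult_mono) auto
    then show ?thesis by simp
  qed
  have "(\<integral>\<^sup>+a. (if a \<le> y then ennreal (1 - \<beta> / \<alpha> * exp (- s * (y - a))) else 0) \<partial>exp_law \<alpha>)
    = (\<integral>\<^sup>+a. ennreal (?f a) * indicator {0..y} a \<partial>lborel)"
  proof (subst nn_integral_exp_law[OF pos(1)], measurable, rule nn_integral_cong)
    fix a :: real
    show "ennreal (exponential_density \<alpha> a) * (if a \<le> y then ennreal (1 - \<beta> / \<alpha> * exp (- s * (y - a))) else 0)
      = ennreal (?f a) * indicator {0..y} a"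
    proof (cases "0 \<le> a \<and> a \<le> y")
      case True
      then have "ennreal (exponential_density \<alpha> a) * ennreal (1 - \<beta> / \<alpha> * exp (- s * (y - a)))
        = ennreal (\<alpha> * exp (- a * \<alpha>) * (1 - \<beta> / \<alpha> * exp (- s * (y - a))))"
        using nonneg[of a] pos by (subst ennreal_mult[symmetric]) (auto simp: exponential_density_def)
      then show ?thesis using True by (simp only: f) simp
    qed (auto simp: exponential_density_def)
  qed
  also have "\<dots> = ennreal (?F y - ?F 0)"
  proof (rule nn_integral_FTC_Icc)
    show "(?F has_real_derivative ?f a) (at a)" for a
      by (auto intro!: derivative_eq_intros simp: algebra_simps)
    show "0 \<le> ?f a" if "a \<in> {0..y}" for a
      unfolding f[symmetric] using nonneg[of a] that pos by (intro mult_nonneg_nonneg) auto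
  qed (use y in auto)
  also have "?F y - ?F 0 = 1 - exp (- s * y)"
    by (simp add: s(2) exp_add[symmetric] algebra_simps)
  finally show ?thesis .
qed

lemma exp_law_one_minus_exp:
  assumes s: "0 < s" "\<alpha> = \<beta> + s" and x: "0 \<le> x"
  shows "(\<integral>\<^sup>+b. ennreal (1 - exp (- s * (x + b))) \<partial>exp_law \<beta>) = ennreal (1 - \<beta> / \<alpha> * exp (- s * x))"
proof -
  let ?c = "\<beta> / \<alpha> * exp (- s * x)"
  have c: "0 \<le> ?c" using pos by simp
  have E: "(\<integral>\<^sup>+b. ennreal (exp (- s * (x + b))) \<partial>exp_law \<beta>) = ennreal ?c"
  proof -
    have "(\<integral>\<^sup>+b. ennreal (exp (- s * (x + b))) \<partial>exp_law \<beta>)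
      = (\<integral>\<^sup>+b. ennreal (exp (- s * x)) * ennreal (exp (- s * b)) \<partial>exp_law \<beta>)"
      by (simp add: ennreal_mult[symmetric] exp_add[symmetric] algebra_simps)
    also have "\<dots> = ennreal (exp (- s * x)) * ennreal (\<beta> / (\<beta> + s))"
      using nn_integral_exp_law_exp[of \<beta> s] pos s by (simp add: nn_integral_cmult)
    finally show ?thesis using pos by (simp add: s(2) ennreal_mult[symmetric] mult.commute)
  qed
  have one: "emeasure (exp_law \<beta>) UNIV = 1"
    using prob_space.emeasure_space_1[OF prob_space_exp_law[of \<beta>]] by simp
  have "(\<integral>\<^sup>+b. ennreal (1 - exp (- s * (x + b))) \<partial>exp_law \<beta>) + ennreal ?c
    = (\<integral>\<^sup>+b. ennreal (1 - exp (- s * (x + b))) + ennreal (exp (- s * (x + b))) \<partial>exp_law \<beta>)"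
    unfolding E[symmetric] by (rule nn_integral_add[symmetric]) measurable
  also have "\<dots> = (\<integral>\<^sup>+b. 1 \<partial>exp_law \<beta>)"
  proof (rule nn_integral_cong_AE, rule eventually_mono[OF AE_exp_law_nonneg])
    fix b :: real assume "0 \<le> b"
    then have "0 \<le> s * (x + b)" using s x by simp
    then show "ennreal (1 - exp (- s * (x + b))) + ennreal (exp (- s * (x + b))) = 1"
      by (subst ennreal_plus[symmetric]) auto
  qed
  also have "\<dots> = 1" using one by simp
  finally have "(\<integral>\<^sup>+b. ennreal (1 - exp (- s * (x + b))) \<partial>exp_law \<beta>) + ennreal ?c = 1" .
  then have "(\<integral>\<^sup>+b. ennreal (1 - exp (- s * (x + b))) \<partial>exp_law \<beta>) = 1 - ennreal ?c"
    by (metis ennreal_add_diff_cancel_right ennreal_neq_top)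
  then show ?thesis using c by (simp add: ennreal_minus flip: ennreal_1)
qed

text \<open>
The walk $S$ has drift $1/\alpha - 1/\beta < 0$, and $e^{sS}$ is a martingale. Over an infinite time
horizon it stays below $x$ with probability exactly $1 - (\beta/\alpha)e^{-sx}$, since the overshoot of
the level $x$ is exponential. The second term pays for the finite horizon: the expectation of
$e^{sS/2}$ decays by the factor $\varphi < 1$ in each step. Conditioning on the first step preserves the
first term and multiplies the second one by at most $\varphi$.
\<close>

lemma walk_below_bound:
  assumes s: "0 < s" "\<alpha> = \<beta> + s" and \<phi>: "\<phi> = \<alpha> / (\<alpha> - s / 2) * (\<beta> / (\<beta> + s / 2))"
  shows "0 \<le> x \<Longrightarrow> j + k \<le> N \<Longrightarrow> emeasure (exp_field r) {w. walk_below p q k j x w}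
    \<le> ennreal (1 - \<beta> / \<alpha> * exp (- s * x)) + ennreal (exp (- (s / 2) * x) * \<phi> ^ k)"
proof (induction k arbitrary: j x)
  case 0
  have "exp (- s * x) \<le> exp (- (s / 2) * x)" using s 0 by (simp add: mult_right_mono)
  moreover have "\<beta> / \<alpha> * exp (- s * x) \<le> 1 * exp (- s * x)" using s pos by (intro mult_right_mono) auto
  ultimately have "1 \<le> (1 - \<beta> / \<alpha> * exp (- s * x)) + exp (- (s / 2) * x)" by linarith
  then have "ennreal 1 \<le> ennreal ((1 - \<beta> / \<alpha> * exp (- s * x)) + exp (- (s / 2) * x))" by (rule ennreal_leI)
  also have "\<dots> = ennreal (1 - \<beta> / \<alpha> * exp (- s * x)) + ennreal (exp (- (s / 2) * x))"
  proof (rule ennreal_plus)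
    have "exp (- s * x) \<le> 1" using s 0 by simp
    then show "0 \<le> 1 - \<beta> / \<alpha> * exp (- s * x)"
      using \<open>\<beta> / \<alpha> * exp (- s * x) \<le> 1 * exp (- s * x)\<close> by linarith
  qed simp
  finally show ?case by simp
next
  case (Suc k)
  have jN: "j < N" using Suc.prems by simp
  have \<phi>0: "0 \<le> \<phi>" using \<phi> s pos by simp
  let ?H = "\<lambda>y. ennreal (1 - \<beta> / \<alpha> * exp (- s * y)) + ennreal (exp (- (s / 2) * y) * \<phi> ^ k)"
  have "emeasure (exp_field r) {w. walk_below p q (Suc k) j x w}
    = (\<integral>\<^sup>+b. \<integral>\<^sup>+a. emeasure (exp_field r) {w. walk_below p q (Suc k) j x (w(p j := a, q j := b))}
        \<partial>exp_law \<alpha> \<partial>exp_law \<beta>)"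
    using emeasure_resample2[where P = "walk_below p q (Suc k) j x" and p = "q j" and q = "p j" and r = r,
        OF walk_sets(1) not_sym[OF pq[OF jN jN]]] rp[OF jN] rq[OF jN] by simp
  also have "\<dots> \<le> (\<integral>\<^sup>+b. ennreal (1 - exp (- s * (x + b))) + ennreal (exp (- (s / 2) * (x + b)) * \<phi> ^ k * (\<alpha> / (\<alpha> - s / 2))) \<partial>exp_law \<beta>)"
  proof (rule nn_integral_mono_AE, rule eventually_mono[OF AE_exp_law_nonneg])
    fix b :: real assume b: "0 \<le> b"
    define y where "y = x + b"
    have y: "0 \<le> y" using b Suc.prems by (simp add: y_def)
    have pt: "emeasure (exp_field r) {w. walk_below p q (Suc k) j x (w(p j := a, q j := b))}
      \<le> (if a \<le> y then ennreal (1 - \<beta> / \<alpha> * exp (- s * (y - a))) else 0)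
        + ennreal (exp (- (s / 2) * y) * \<phi> ^ k) * ennreal (exp (- (- (s / 2)) * a))" for a
    proof -
      have "walk_below p q (Suc k) j x (w(p j := a, q j := b)) \<longleftrightarrow> a \<le> y \<and> walk_below p q k (Suc j) (y - a) w" for w
      proof -
        have "w(p j := a, q j := b) = w(q j := b, p j := a)" using pq[OF jN jN] by (rule fun_upd_twist)
        then show ?thesis using Suc.prems pq[OF jN jN]
          by (auto simp: walk_below_upd y_def algebra_simps)
      qed
      then have eq: "{w. walk_below p q (Suc k) j x (w(p j := a, q j := b))}
        = (if a \<le> y then {w. walk_below p q k (Suc j) (y - a) w} else {})" by auto
      have ex: "exp (- (s / 2) * (y - a)) * \<phi> ^ k = (exp (- (s / 2) * y) * \<phi> ^ k) * exp (- (- (s / 2)) * a)"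
      proof -
        have "exp (- (s / 2) * (y - a)) = exp (- (s / 2) * y) * exp (- (- (s / 2)) * a)"
          by (simp add: exp_add[symmetric] algebra_simps diff_divide_distrib)
        then show ?thesis by (simp only: mult_ac)
      qed
      show ?thesis
      proof (cases "a \<le> y")
        case True
        have "emeasure (exp_field r) {w. walk_below p q k (Suc j) (y - a) w} \<le> ?H (y - a)"
          using True Suc.prems by (intro Suc.IH) auto
        also have "ennreal (exp (- (s / 2) * (y - a)) * \<phi> ^ k)
          = ennreal (exp (- (s / 2) * y) * \<phi> ^ k) * ennreal (exp (- (- (s / 2)) * a))"
          unfolding ex using \<phi>0 by (intro ennreal_mult) auto
        finally show ?thesis unfolding eq using True by simp
      next
        case False
        then show ?thesis unfolding eq by simp
      qed
    qed
    have "(\<integral>\<^sup>+a. emeasure (exp_field r) {w. walk_below p q (Suc k) j x (w(p j := a, q j := b))} \<partial>exp_law \<alpha>)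
      \<le> (\<integral>\<^sup>+a. (if a \<le> y then ennreal (1 - \<beta> / \<alpha> * exp (- s * (y - a))) else 0)
        + ennreal (exp (- (s / 2) * y) * \<phi> ^ k) * ennreal (exp (- (- (s / 2)) * a)) \<partial>exp_law \<alpha>)"
      by (rule nn_integral_mono) (rule pt)
    also have "\<dots> = (\<integral>\<^sup>+a. (if a \<le> y then ennreal (1 - \<beta> / \<alpha> * exp (- s * (y - a))) else 0) \<partial>exp_law \<alpha>)
        + ennreal (exp (- (s / 2) * y) * \<phi> ^ k) * (\<integral>\<^sup>+a. ennreal (exp (- (- (s / 2)) * a)) \<partial>exp_law \<alpha>)"
      by (subst nn_integral_add, measurable, subst nn_integral_cmult, measurable)
    also have "\<dots> = ennreal (1 - exp (- s * y)) + ennreal (exp (- (s / 2) * y) * \<phi> ^ k) * ennreal (\<alpha> / (\<alpha> - s / 2))"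
      using exp_law_overshoot[OF s y] nn_integral_exp_law_exp[of \<alpha> "- (s / 2)"] pos s by simp
    also have "\<dots> = ennreal (1 - exp (- s * y)) + ennreal (exp (- (s / 2) * y) * \<phi> ^ k * (\<alpha> / (\<alpha> - s / 2)))"
      using \<phi>0 pos s by (subst ennreal_mult[symmetric]) auto
    finally show "(\<integral>\<^sup>+a. emeasure (exp_field r) {w. walk_below p q (Suc k) j x (w(p j := a, q j := b))} \<partial>exp_law \<alpha>)
      \<le> ennreal (1 - exp (- s * (x + b))) + ennreal (exp (- (s / 2) * (x + b)) * \<phi> ^ k * (\<alpha> / (\<alpha> - s / 2)))"
      by (simp only: y_def)
  qed
  also have "\<dots> = (\<integral>\<^sup>+b. ennreal (1 - exp (- s * (x + b))) \<partial>exp_law \<beta>)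
      + (\<integral>\<^sup>+b. ennreal (exp (- (s / 2) * (x + b)) * \<phi> ^ k * (\<alpha> / (\<alpha> - s / 2))) \<partial>exp_law \<beta>)"
    by (rule nn_integral_add) measurable
  also have "(\<integral>\<^sup>+b. ennreal (exp (- (s / 2) * (x + b)) * \<phi> ^ k * (\<alpha> / (\<alpha> - s / 2))) \<partial>exp_law \<beta>)
    = (\<integral>\<^sup>+b. ennreal (exp (- (s / 2) * x) * \<phi> ^ k * (\<alpha> / (\<alpha> - s / 2))) * ennreal (exp (- (s / 2) * b)) \<partial>exp_law \<beta>)"
  proof (rule nn_integral_cong)
    fix b :: real
    have "exp (- (s / 2) * (x + b)) = exp (- (s / 2) * x) * exp (- (s / 2) * b)"
      by (simp add: exp_add[symmetric] algebra_simps)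
    then have "exp (- (s / 2) * (x + b)) * \<phi> ^ k * (\<alpha> / (\<alpha> - s / 2))
      = (exp (- (s / 2) * x) * \<phi> ^ k * (\<alpha> / (\<alpha> - s / 2))) * exp (- (s / 2) * b)" by (simp only: mult_ac)
    then show "ennreal (exp (- (s / 2) * (x + b)) * \<phi> ^ k * (\<alpha> / (\<alpha> - s / 2)))
      = ennreal (exp (- (s / 2) * x) * \<phi> ^ k * (\<alpha> / (\<alpha> - s / 2))) * ennreal (exp (- (s / 2) * b))"
      using \<phi>0 pos s by (simp only: ennreal_mult'' exp_ge_zero)
  qed
  also have "\<dots> = ennreal (exp (- (s / 2) * x) * \<phi> ^ k * (\<alpha> / (\<alpha> - s / 2))) * ennreal (\<beta> / (\<beta> + s / 2))"
    using nn_integral_exp_law_exp[of \<beta> "s / 2"] pos s by (simp add: nn_integral_cmult)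
  also have "\<dots> = ennreal (exp (- (s / 2) * x) * \<phi> ^ k * (\<alpha> / (\<alpha> - s / 2)) * (\<beta> / (\<beta> + s / 2)))"
    using pos s by (subst ennreal_mult''[symmetric]) auto
  also have "exp (- (s / 2) * x) * \<phi> ^ k * (\<alpha> / (\<alpha> - s / 2)) * (\<beta> / (\<beta> + s / 2)) = exp (- (s / 2) * x) * \<phi> ^ Suc k"
    by (simp add: \<phi>)
  also have "(\<integral>\<^sup>+b. ennreal (1 - exp (- s * (x + b))) \<partial>exp_law \<beta>) = ennreal (1 - \<beta> / \<alpha> * exp (- s * x))"
    using s Suc.prems by (intro exp_law_one_minus_exp) auto
  finally show ?case .
qed

end

section \<open>Early exits are unlikely\<close>

lemma lpp_origin: "lpp y i j = y (0, 0) + lpp (y((0, 0) := 0)) i j"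
  by (induction i j rule: grid_induct) (auto simp: max_add_distrib_right)

lemma AE_exp_law_neq: "r > 0 \<Longrightarrow> AE x in exp_law r. x \<noteq> c"
proof -
  assume "r > 0"
  have "AE x in lborel. x \<noteq> (c::real)" by (rule AE_lborel_singleton)
  with \<open>r > 0\<close> show ?thesis
    unfolding exp_law_def by (auto simp: AE_density elim!: eventually_mono)
qed

lemma exit_gap_first_weight:
  assumes w: "\<And>p. 0 \<le> w p" and x: "0 \<le> x" and i: "1 \<le> i"
  shows "exit_gap (w((1, 0) := x)) i j = x + exit_gap (w((1, 0) := 0)) i j"
proof -
  obtain i' where i': "i = Suc i'" using i by (cases i) auto
  have *: "lpp (hor_only (w((1, 0) := x))) i j = lpp (\<lambda>(i, j). (w((1, 0) := x)) (Suc i, j)) i' j" if "0 \<le> x" for x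
  proof -
    have "lpp (hor_only (w((1, 0) := x))) (Suc i') j = lpp (\<lambda>(i, j). hor_only (w((1, 0) := x)) (Suc i, j)) i' j"
      using w that by (intro lpp_strip_column) (auto simp: hor_only_def)
    also have "\<dots> = lpp (\<lambda>(i, j). (w((1, 0) := x)) (Suc i, j)) i' j"
      by (intro lpp_cong) (simp add: hor_only_def)
    finally show ?thesis by (simp add: i')
  qed
  have "lpp (hor_only (w((1, 0) := x))) i j = x + lpp (hor_only (w((1, 0) := 0))) i j"
    unfolding *[OF x] *[OF order_refl]
    by (subst lpp_origin) (auto intro!: lpp_cong)
  moreover have "ver_only (w((1, 0) := x)) = ver_only (w((1, 0) := 0))"
    by (auto simp: ver_only_def fun_eq_iff)
  ultimately show ?thesis by (simp add: exit_gap_def)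
qed

text \<open>
Every path that starts horizontally uses the weight at $(1,0)$, and no other path does. So $D$ is this
weight plus an independent variable, and an exponential law has no atoms.
\<close>

lemma exit_gap_no_tie:
  assumes \<rho>: "\<rho> < 1" and i: "1 \<le> i"
  shows "measure (exp_field (stat_rate \<rho>)) {w. exit_gap w i j = 0} = 0"
proof -
  let ?F = "exp_field (stat_rate \<rho>)" and ?E = "exp_law (stat_rate \<rho> (1, 0))"
  let ?S = "{w. exit_gap w i j = 0}" and ?g = "\<lambda>w x. indicator {w. exit_gap w i j = 0} (w((1, 0) := x)) :: ennreal"
  interpret F: prob_space ?F by simp
  interpret E: prob_space ?E by simp
  interpret P: pair_sigma_finite ?F ?E ..
  have [measurable]: "?S \<in> sets field_space" by measurable
  have m: "case_prod ?g \<in> borel_measurable (?F \<Otimes>\<^sub>M ?E)"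
  proof -
    have "(\<lambda>v. (fst v)((1, 0) := snd v)) \<in> measurable (?F \<Otimes>\<^sub>M ?E) field_space"
      by (rule measurable_field_map) (auto simp: fun_upd_def)
    from measurable_compose[OF this, of "indicator ?S :: _ \<Rightarrow> ennreal" borel] show ?thesis
      by (simp add: case_prod_beta)
  qed
  have "emeasure ?F ?S = (\<integral>\<^sup>+w. indicator ?S w \<partial>?F)" by simp
  also have "\<dots> = (\<integral>\<^sup>+x. \<integral>\<^sup>+w. ?g w x \<partial>?F \<partial>?E)"
    using nn_integral_exp_field_resample[of "indicator ?S" "stat_rate \<rho>" "(1, 0)" "stat_rate \<rho> (1, 0)"] by simp
  also have "\<dots> = (\<integral>\<^sup>+w. \<integral>\<^sup>+x. ?g w x \<partial>?E \<partial>?F)"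
    by (rule P.Fubini'[OF m])
  also have "\<dots> = (\<integral>\<^sup>+w. 0 \<partial>?F)"
  proof (rule nn_integral_cong_AE, rule eventually_mono[OF AE_exp_field_nonneg])
    fix w :: "nat \<times> nat \<Rightarrow> real" assume w: "\<forall>p. 0 \<le> w p"
    have r: "0 < stat_rate \<rho> (1, 0)" using \<rho> by (simp add: stat_rate_def)
    have "AE x in ?E. ?g w x = 0"
      using AE_exp_law_nonneg AE_exp_law_neq[OF r, of "- exit_gap (w((1, 0) := 0)) i j"]
    proof eventually_elim
      fix x assume "0 \<le> x" "x \<noteq> - exit_gap (w((1, 0) := 0)) i j"
      then show "?g w x = 0" using exit_gap_first_weight[of w x i j] w i by (auto simp: indicator_def)
    qed
    then have "(\<integral>\<^sup>+x. ?g w x \<partial>?E) = (\<integral>\<^sup>+x. 0 \<partial>?E)" by (rule nn_integral_cong_AE)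
    then show "(\<integral>\<^sup>+x. ?g w x \<partial>?E) = 0" by simp
  qed
  finally show ?thesis by (simp add: measure_def)
qed

lemma exit_measurable [measurable]:
  "(\<lambda>w. late_exit m n u w) \<in> borel_measurable field_space"
  "(\<lambda>w. early_exit m n u w) \<in> borel_measurable field_space"
proof -
  have [measurable]: "cut_row u \<in> measurable field_space field_space"
    by (rule measurable_field_map) (auto simp: cut_row_def case_prod_beta)
  show "(\<lambda>w. late_exit m n u w) \<in> borel_measurable field_space"
    unfolding late_exit_def by measurable
  show "(\<lambda>w. early_exit m n u w) \<in> borel_measurable field_space"
    unfolding early_exit_def by measurable
qed

lemma late_le_early_sets [measurable]: "{w. late_exit m n u w \<le> early_exit m n u w} \<in> sets field_space"
proof -
  have "{w \<in> space field_space. late_exit m n u w \<le> early_exit m n u w} \<in> sets field_space" by measurable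
  then show ?thesis by simp
qed

text \<open>
The probability on the left is that of $D(m,n) \ge 0$ minus that of $D(m-u,n) > 0$. In the latter, the
field may be replaced by the one seen from $(u,0)$, which has the same law; the difference then
concerns two events on the same field, as required by the lemma on early exits.
\<close>

lemma gap_window_le_early_exit:
  assumes \<rho>: "0 < \<rho>" "\<rho> < 1" and m: "1 \<le> m" and u: "u \<le> m"
  shows "measure (exp_field (stat_rate \<rho>)) {w. exit_gap w (m - u) n \<le> 0 \<and> 0 \<le> exit_gap w m n}
    \<le> measure (exp_field (stat_rate \<rho>)) {w. late_exit m n u w \<le> early_exit m n u w}"
proof -
  let ?F = "exp_field (stat_rate \<rho>)"
  interpret F: prob_space ?F by simp
  let ?D0 = "{w. 0 \<le> exit_gap w m n}" and ?Dp = "{w. 0 < exit_gap w m n}" and ?Z = "{w. exit_gap w m n = 0}"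
  let ?E0 = "{w. 0 < exit_gap w (m - u) n}" and ?E1 = "{w. 0 < exit_gap (col_shift n u w) (m - u) n}"
  let ?B = "{w. late_exit m n u w \<le> early_exit m n u w}"
  have E1: "?E1 = col_shift n u -` ?E0 \<inter> space ?F" by auto
  have sets: "?D0 \<in> sets ?F" "?Dp \<in> sets ?F" "?Z \<in> sets ?F" "?E0 \<in> sets ?F" "?B \<in> sets ?F"
    by simp_all
  have sE1: "?E1 \<in> sets ?F" unfolding E1 by (rule measurable_sets[of _ _ field_space]) simp_all
  have ae: "AE w in ?F. (\<forall>p. 0 \<le> w p) \<and> w (0, 0) = 0"
    by (intro AE_conjI AE_exp_field_nonneg AE_exp_field_zero) (simp add: stat_rate_def)
  have "{w. exit_gap w (m - u) n \<le> 0 \<and> 0 \<le> exit_gap w m n} = ?D0 - ?E0" by auto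
  then have "measure ?F {w. exit_gap w (m - u) n \<le> 0 \<and> 0 \<le> exit_gap w m n} = measure ?F ?D0 - measure ?F (?D0 \<inter> ?E0)"
    using F.finite_measure_Diff'[OF sets(1,4)] by simp
  moreover have "measure ?F ?E0 \<le> measure ?F (?D0 \<inter> ?E0)"
  proof (rule F.finite_measure_mono_AE)
    show "AE w in ?F. w \<in> ?E0 \<longrightarrow> w \<in> ?D0 \<inter> ?E0"
    proof (rule eventually_mono[OF ae], intro impI)
      fix w :: "nat \<times> nat \<Rightarrow> real" assume w: "(\<forall>p. 0 \<le> w p) \<and> w (0, 0) = 0" "w \<in> ?E0"
      then show "w \<in> ?D0 \<inter> ?E0" using exit_gap_mono[of w "m - u" m n] by auto
    qed
  qed (use sets in auto)
  moreover have "measure ?F ?E0 = measure ?F ?E1"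
  proof -
    have "measure ?F ?E0 = measure (distr ?F field_space (col_shift n u)) ?E0"
      by (simp only: distr_col_shift[OF \<rho>])
    also have "\<dots> = measure ?F ?E1"
      unfolding E1 by (rule measure_distr) simp_all
    finally show ?thesis .
  qed
  moreover have "measure ?F ?D0 \<le> measure ?F ?Dp + measure ?F ?Z"
  proof -
    have "?D0 = ?Dp \<union> ?Z" by auto
    then show ?thesis using measure_Un_le[OF sets(2,3)] by simp
  qed
  moreover have "measure ?F ?Z = 0" using \<rho> m by (intro exit_gap_no_tie)
  moreover have "measure ?F ?Dp \<le> measure ?F ?E1 + measure ?F ?B"
  proof -
    have "measure ?F ?Dp \<le> measure ?F (?E1 \<union> ?B)"
    proof (rule F.finite_measure_mono_AE)
      show "AE w in ?F. w \<in> ?Dp \<longrightarrow> w \<in> ?E1 \<union> ?B"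
      proof (rule eventually_mono[OF ae], intro impI)
        fix w :: "nat \<times> nat \<Rightarrow> real" assume w: "(\<forall>p. 0 \<le> w p) \<and> w (0, 0) = 0" "w \<in> ?Dp"
        then show "w \<in> ?E1 \<union> ?B" using gap_change_imp_early_exit[of w u m n] u
            by (cases "exit_gap (col_shift n u w) (m - u) n \<le> 0") auto
      qed
    qed (use sets sE1 in auto)
    also have "\<dots> \<le> measure ?F ?E1 + measure ?F ?B"
      using sE1 sets(5) by (rule measure_Un_le)
    finally show ?thesis .
  qed
  ultimately show ?thesis by linarith
qed

lemma distr_exp_field_sum_map:
  fixes r1 :: "'a \<Rightarrow> real" and r2 r2' :: "'b \<Rightarrow> real"
  assumes T[measurable]: "T \<in> measurable field_space field_space"
    and law: "distr (exp_field r2) field_space T = exp_field r2'"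
  shows "(\<lambda>w :: 'a + 'b \<Rightarrow> real. case_sum (\<lambda>p. w (Inl p)) (T (\<lambda>p. w (Inr p)))) \<in> measurable field_space field_space" (is ?m)
    and "distr (exp_field (case_sum r1 r2)) field_space (\<lambda>w. case_sum (\<lambda>p. w (Inl p)) (T (\<lambda>p. w (Inr p))))
      = exp_field (case_sum r1 r2')"
proof -
  have inr: "(\<lambda>w p. w (Inr p)) \<in> measurable field_space (field_space :: ('b \<Rightarrow> real) measure)"
    by (rule measurable_field_map) simp
  have TT: "(\<lambda>w. T (\<lambda>p. w (Inr p)) q) \<in> borel_measurable (field_space :: ('a + 'b \<Rightarrow> real) measure)" for q
    using measurable_compose[OF measurable_compose[OF inr T] measurable_component_singleton[of q UNIV "\<lambda>_. borel"]] by simp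
  show m: ?m
  proof (rule measurable_field_map)
    fix q :: "'a + 'b"
    show "(\<lambda>w. case_sum (\<lambda>p. w (Inl p)) (T (\<lambda>p. w (Inr p))) q) \<in> borel_measurable field_space"
      by (cases q) (auto simp: TT)
  qed
  let ?S = "\<lambda>(x, y). case_sum x y :: 'a + 'b \<Rightarrow> real"
  interpret R2: prob_space "exp_field r2" by simp
  interpret R2': prob_space "exp_field r2'" by simp
  have S: "?S \<in> measurable (field_space \<Otimes>\<^sub>M field_space) field_space"
  proof (rule measurable_field_map)
    show "(\<lambda>z. (case z of (x, y) \<Rightarrow> case_sum x y) p) \<in> borel_measurable (field_space \<Otimes>\<^sub>M field_space)" for p :: "'a + 'b"
      by (cases p) (auto simp: case_prod_beta)
  qed
  have sF: "sets (exp_field r1 \<Otimes>\<^sub>M exp_field r) = sets (field_space \<Otimes>\<^sub>M field_space)" for r :: "'b \<Rightarrow> real"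
    by (intro sets_pair_measure_cong) simp_all
  have S1: "?S \<in> measurable (exp_field r1 \<Otimes>\<^sub>M exp_field r) field_space" for r
    using S measurable_cong_sets[OF sF[of r] refl] by blast
  have Tp: "(\<lambda>(x, y). (x, T y)) \<in> measurable (exp_field r1 \<Otimes>\<^sub>M exp_field r2) (field_space \<Otimes>\<^sub>M field_space)"
    by measurable
  have "distr (exp_field (case_sum r1 r2)) field_space (\<lambda>w. case_sum (\<lambda>p. w (Inl p)) (T (\<lambda>p. w (Inr p))))
    = distr (exp_field r1 \<Otimes>\<^sub>M exp_field r2) field_space (?S \<circ> (\<lambda>(x, y). (x, T y)))"
    unfolding exp_field_sum_type
    by (subst distr_distr[OF _ S1]) (auto simp: m comp_def case_prod_beta)
  also have "\<dots> = distr (distr (exp_field r1 \<Otimes>\<^sub>M exp_field r2) (field_space \<Otimes>\<^sub>M field_space) (\<lambda>(x, y). (x, T y))) field_space ?S"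
    by (rule distr_distr[OF S Tp, symmetric])
  also have "distr (exp_field r1 \<Otimes>\<^sub>M exp_field r2) (field_space \<Otimes>\<^sub>M field_space) (\<lambda>(x, y). (x, T y))
    = exp_field r1 \<Otimes>\<^sub>M exp_field r2'"
  proof -
    have id: "distr (exp_field r1) field_space (\<lambda>x. x) = exp_field r1"
      by (rule distr_id2) simp
    have "distr (exp_field r1) field_space (\<lambda>x. x) \<Otimes>\<^sub>M distr (exp_field r2) field_space T
      = distr (exp_field r1 \<Otimes>\<^sub>M exp_field r2) (field_space \<Otimes>\<^sub>M field_space) (\<lambda>(x, y). (x, T y))"
      by (rule pair_measure_distr) (simp_all add: law R2'.sigma_finite_measure_axioms)
    then show ?thesis by (simp add: id law)
  qed
  also have "distr (exp_field r1 \<Otimes>\<^sub>M exp_field r2') field_space ?S = exp_field (case_sum r1 r2')"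
    by (simp only: exp_field_sum_type)
  finally show "distr (exp_field (case_sum r1 r2)) field_space (\<lambda>w. case_sum (\<lambda>p. w (Inl p)) (T (\<lambda>p. w (Inr p))))
      = exp_field (case_sum r1 r2')" .
qed

text \<open>
The transposed field, shifted by $n$ columns: its vertical axis carries the horizontal increments of
the original field along the row $n$.
\<close>

definition row_increments :: "nat \<Rightarrow> nat \<Rightarrow> (nat \<times> nat \<Rightarrow> real) \<Rightarrow> nat \<times> nat \<Rightarrow> real" where
  "row_increments m n w = col_shift m n (\<lambda>(i, j). w (j, i))"

lemma row_increments_measurable [measurable]: "row_increments m n \<in> measurable field_space field_space"
proof -
  have "(\<lambda>w (i, j). w (j, i) :: real) \<in> measurable field_space field_space"
    by (rule measurable_field_map) (auto simp: case_prod_beta)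
  from measurable_compose[OF this col_shift_measurable] show ?thesis
    by (simp add: row_increments_def[abs_def])
qed

lemma distr_row_increments:
  assumes "0 < \<rho>" "\<rho> < 1"
  shows "distr (exp_field (stat_rate \<rho>)) field_space (row_increments m n) = exp_field (stat_rate (1 - \<rho>))"
proof -
  have sw: "(\<lambda>w (i, j). w (j, i) :: real) \<in> measurable (exp_field (stat_rate \<rho>)) field_space"
    by (rule measurable_field_map) (auto simp: case_prod_beta)
  have "distr (exp_field (stat_rate \<rho>)) field_space (row_increments m n)
    = distr (distr (exp_field (stat_rate \<rho>)) field_space (\<lambda>w (i, j). w (j, i))) field_space (col_shift m n)"
    using sw by (subst distr_distr) (auto simp: comp_def row_increments_def[abs_def])
  then show ?thesis using assms by (simp add: distr_swap_stat_rate distr_col_shift)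
qed

lemma row_increments_value:
  assumes "w (0, 0) = 0" "1 \<le> i" "i \<le> m"
  shows "row_increments m n w (0, i) = lpp w i n - lpp w (i - 1) n"
proof -
  let ?s = "\<lambda>(i, j). w (j, i)" and ?C = "row_increments m n w"
  have P: "lpp ?s n j = lpp ?s n 0 + lpp ?C 0 j" if "j \<le> m" for j
    using col_shift_props[of ?s m n] assms(1) that unfolding row_increments_def by (metis (no_types, lifting) add.right_neutral case_prod_conv)
  obtain k where k: "i = Suc k" using assms by (cases i) auto
  show ?thesis using P[of i] P[of k] assms k by (simp add: lpp_swap)
qed

text \<open>
The field is built from two independent ones. The axis weights come from a field of parameter $\rho$,
and the reflected bulk is the bulk of a stationary field of parameter $\mu$, whose increments along the
row $n$ dominate those of the bulk as long as $D \ge 0$ at $(m-v,n)$. These increments are independent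
of each other and of the axis weights. An early exit then forces either $D \le 0$ at $(m-v,n)$ in the
field of parameter $\mu$, or a rise above $x$ of the walk that runs from $u$ down to the exit, or a walk
from $u$ to $v$ that stays below $x$.
\<close>

lemma early_exit_bound:
  fixes \<rho> \<mu> \<theta> x :: real
  assumes \<rho>: "0 < \<rho>" "\<rho> < \<mu>" "\<mu> < 1" and uv: "1 \<le> u" "u \<le> v" "v \<le> m" and n: "1 \<le> n"
    and \<theta>: "0 < \<theta>" "\<theta> < 1 - \<mu>" and x: "0 \<le> x"
    and \<phi>: "\<phi> = (1 - \<mu>) / (1 - \<mu> - \<theta>) * ((1 - \<rho>) / (1 - \<rho> + \<theta>))" "1 \<le> \<phi>"
    and \<psi>: "\<psi> = (1 - \<rho>) / (1 - \<rho> - (\<mu> - \<rho>) / 2) * ((1 - \<mu>) / (1 - \<mu> + (\<mu> - \<rho>) / 2))"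
  shows "measure (exp_field (stat_rate \<rho>)) {w. late_exit m n u w \<le> early_exit m n u w}
    \<le> measure (exp_field (stat_rate \<mu>)) {w. exit_gap w (m - v) n \<le> 0}
      + exp (- \<theta> * x) * \<phi> ^ (u - 1)
      + ((1 - (1 - \<mu>) / (1 - \<rho>) * exp (- (\<mu> - \<rho>) * x)) + exp (- ((\<mu> - \<rho>) / 2) * x) * \<psi> ^ (v - u))"
proof -
  let ?P = "exp_field (stat_rate \<rho>)"
  have \<mu>: "0 < \<mu>" "\<mu> < 1" using \<rho> by auto
  define big where "big = exp_field (case_sum (stat_rate \<rho>) (stat_rate \<mu>))"
  define big' where "big' = exp_field (case_sum (stat_rate \<rho>) (stat_rate (1 - \<mu>)))"
  interpret big: prob_space big by (simp add: big_def)
  interpret big': prob_space big' by (simp add: big'_def)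
  have sets_big: "sets big = sets field_space" "sets big' = sets field_space" and space_big: "space big = UNIV"
    by (simp_all add: big_def big'_def)
  \<comment> \<open>The left summand carries the axes, the right one the bulk of the rectangle, reflected.\<close>
  define \<sigma> :: "nat \<times> nat \<Rightarrow> nat \<times> nat + nat \<times> nat" where
    "\<sigma> = (\<lambda>(i, j). if 1 \<le> i \<and> i \<le> m \<and> 1 \<le> j \<and> j \<le> n then Inr (m + 1 - i, n + 1 - j) else Inl (i, j))"
  have inj: "inj \<sigma>"
    by (auto simp: inj_def \<sigma>_def split: if_splits)
  have relabel: "distr big field_space (\<lambda>q p. q (\<sigma> p)) = ?P"
  proof -
    have "(\<lambda>p. case_sum (stat_rate \<rho>) (stat_rate \<mu>) (\<sigma> p)) = stat_rate \<rho>"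
      by (auto simp: \<sigma>_def stat_rate_def fun_eq_iff)
    then show ?thesis using distr_exp_field_relabel[OF inj, of "case_sum (stat_rate \<rho>) (stat_rate \<mu>)"]
      by (simp add: big_def)
  qed
  have relabel_meas: "(\<lambda>q p. q (\<sigma> p)) \<in> measurable big field_space"
    by (rule measurable_field_map) (simp add: sets_big cong: measurable_cong_sets)
  have right_meas: "(\<lambda>q p. q (Inr p)) \<in> measurable big field_space"
    by (rule measurable_field_map) (simp add: sets_big cong: measurable_cong_sets)
  have right_law: "distr big field_space (\<lambda>q p. q (Inr p)) = exp_field (stat_rate \<mu>)"
    using distr_exp_field_relabel[OF inj_Inr, of "case_sum (stat_rate \<rho>) (stat_rate \<mu>)"] by (simp add: big_def)
  define T :: "(nat \<times> nat + nat \<times> nat \<Rightarrow> real) \<Rightarrow> nat \<times> nat + nat \<times> nat \<Rightarrow> real" where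
    "T = (\<lambda>q. case_sum (\<lambda>p. q (Inl p)) (row_increments m n (\<lambda>p. q (Inr p))))"
  have T_meas: "T \<in> measurable big field_space"
    using distr_exp_field_sum_map(1)[OF row_increments_measurable[of m n] distr_row_increments[of \<mu> m n, OF \<mu>]]
    by (simp add: T_def sets_big cong: measurable_cong_sets)
  have T_law: "distr big field_space T = big'"
    using distr_exp_field_sum_map(2)[OF row_increments_measurable[of m n] distr_row_increments[of \<mu> m n, OF \<mu>]]
    by (simp add: T_def big_def big'_def)

  define S1 :: "(nat \<times> nat + nat \<times> nat \<Rightarrow> real) set" where "S1 = {q. exit_gap (\<lambda>p. q (Inr p)) (m - v) n \<le> 0}"
  \<comment> \<open>The walk from $u$ down to the exit uses the positions $u-1, u-2, \dots, 1$ in this order.\<close>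
  define pa qa :: "nat \<Rightarrow> nat \<times> nat + nat \<times> nat" where
    "pa i = Inr (0, m + 1 - (u - 1 - i))" and "qa i = Inl (Suc (u - 1 - i), 0)" for i
  define pb qb :: "nat \<Rightarrow> nat \<times> nat + nat \<times> nat" where
    "pb i = Inl (Suc (u + i), 0)" and "qb i = Inr (0, m + 1 - (u + i))" for i
  define A where "A = {q. walk_above pa qa (u - 1) 0 x q}"
  define B where "B = {q. walk_below pb qb (v - u) 0 x q}"
  have A: "A \<in> sets field_space" and B: "B \<in> sets field_space" unfolding A_def B_def by (rule walk_sets)+
  have T_A: "measure big (T -` A \<inter> space big) = measure big' A"
    using measure_distr[OF T_meas A] by (simp add: T_law)
  have T_B: "measure big (T -` B \<inter> space big) = measure big' B"
    using measure_distr[OF T_meas B] by (simp add: T_law)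
  have S1: "measure big S1 = measure (exp_field (stat_rate \<mu>)) {w. exit_gap w (m - v) n \<le> 0}" "S1 \<in> sets big"
  proof -
    have eq: "S1 = (\<lambda>q p. q (Inr p)) -` {w. exit_gap w (m - v) n \<le> 0} \<inter> space big"
      by (auto simp: S1_def space_big)
    show "S1 \<in> sets big" unfolding eq by (rule measurable_sets[OF right_meas]) measurable
    have "measure (distr big field_space (\<lambda>q p. q (Inr p))) {w. exit_gap w (m - v) n \<le> 0} = measure big S1"
      unfolding eq by (rule measure_distr[OF right_meas]) measurable
    then show "measure big S1 = measure (exp_field (stat_rate \<mu>)) {w. exit_gap w (m - v) n \<le> 0}"
      by (simp only: right_law)
  qed
  let ?L = "{w. late_exit m n u w \<le> early_exit m n u w}"
  have "measure ?P ?L = measure big ((\<lambda>q p. q (\<sigma> p)) -` ?L \<inter> space big)"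
    unfolding relabel[symmetric] by (rule measure_distr[OF relabel_meas]) measurable
  also have "\<dots> \<le> measure big (S1 \<union> (T -` A \<inter> space big) \<union> (T -` B \<inter> space big))"
  proof (rule big.finite_measure_mono_AE)
    have ae: "AE q in big. (\<forall>p. 0 \<le> q p) \<and> q (Inl (0, 0)) = 0 \<and> q (Inr (0, 0)) = 0"
      unfolding big_def
      by (intro AE_conjI AE_exp_field_nonneg AE_exp_field_zero) (simp_all add: stat_rate_def)
    show "AE q in big. q \<in> (\<lambda>q p. q (\<sigma> p)) -` ?L \<inter> space big \<longrightarrow> q \<in> S1 \<union> (T -` A \<inter> space big) \<union> (T -` B \<inter> space big)"
    proof (rule eventually_mono[OF ae], intro impI)
      fix q assume q: "(\<forall>p. 0 \<le> q p) \<and> q (Inl (0, 0)) = 0 \<and> q (Inr (0, 0)) = 0"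
        and "q \<in> (\<lambda>q p. q (\<sigma> p)) -` ?L \<inter> space big"
      define w where "w p = q (\<sigma> p)" for p
      define y where "y p = q (Inr p)" for p
      have L: "late_exit m n u w \<le> early_exit m n u w"
        using \<open>q \<in> _\<close> by (simp add: w_def[abs_def])
      have w: "\<And>p. 0 \<le> w p" "w (0, 0) = 0" and y: "\<And>p. 0 \<le> y p" "y (0, 0) = 0"
        using q by (auto simp: w_def y_def \<sigma>_def)
      have wX: "w (Suc i, 0) = T q (Inl (Suc i, 0))" for i by (simp add: w_def T_def \<sigma>_def)
      have TI: "T q (Inr (0, i)) = lpp y i n - lpp y (i - 1) n" if "1 \<le> i" "i \<le> m" for i
        using row_increments_value[of y i m n] y(2) that by (simp add: T_def y_def[abs_def])
      have refl: "lpp (bulk_reflect m n w) i n = lpp (bulk_only y) i n" if "i \<le> m" for i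
        using that by (intro lpp_cong) (auto simp: bulk_reflect_def bulk_only_def w_def y_def \<sigma>_def)
      show "q \<in> S1 \<union> (T -` A \<inter> space big) \<union> (T -` B \<inter> space big)"
      proof (cases "q \<in> S1")
        case False
        then have gap: "0 \<le> exit_gap y (m - v) n" by (simp add: S1_def y_def[abs_def])
        define Y where "Y z = T q (Inr (0, m + 1 - z))" for z
        have "\<exists>yy. 1 \<le> yy \<and> yy \<le> u \<and> (\<forall>z. u < z \<and> z \<le> v \<longrightarrow>
          (\<Sum>i\<in>{u..<z}. w (Suc i, 0) - Y i) \<le> (\<Sum>i\<in>{yy..<u}. Y i - w (Suc i, 0)))"
        proof (rule early_exit_imp_walk[of w, OF w n uv L])
          fix z assume z: "1 \<le> z" "z < v"
          have z': "Suc (m - z) = m + 1 - z" "m + 1 - z \<le> m" using z uv by auto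
          have "lpp (bulk_only y) (Suc (m - z)) n - lpp (bulk_only y) (m - z) n \<le> lpp y (Suc (m - z)) n - lpp y (m - z) n"
            using z uv by (intro bulk_increment_le[of y, OF y gap]) auto
          also have "lpp y (Suc (m - z)) n - lpp y (m - z) n = Y z"
            using z uv TI[of "m + 1 - z"] by (simp add: Y_def z'(1))
          finally show "lpp (bulk_reflect m n w) (m + 1 - z) n - lpp (bulk_reflect m n w) (m - z) n \<le> Y z"
            by (simp only: z'(1) refl[OF z'(2)] refl[OF diff_le_self])
        qed
        then obtain yy where yy: "1 \<le> yy" "yy \<le> u" and walk: "\<And>z. u < z \<Longrightarrow> z \<le> v \<Longrightarrow>
          (\<Sum>i\<in>{u..<z}. w (Suc i, 0) - Y i) \<le> (\<Sum>i\<in>{yy..<u}. Y i - w (Suc i, 0))" by blast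
        show ?thesis
        proof (cases "x \<le> (\<Sum>i\<in>{yy..<u}. Y i - w (Suc i, 0))")
          case True
          have "(\<Sum>i\<in>{yy..<u}. Y i - w (Suc i, 0)) = walk pa qa 0 (T q) (u - yy)"
            unfolding walk_def by (rule sum.reindex_bij_witness[of _ "\<lambda>i. u - 1 - i" "\<lambda>i. u - 1 - i"])
               (use yy in \<open>auto simp: Y_def pa_def qa_def wX\<close>)
          moreover have "u - yy < Suc (u - 1)" using yy by simp
          ultimately have "T q \<in> A" unfolding A_def using True by (auto simp: walk_above_def)
          then show ?thesis by (simp add: space_big)
        next
          case False
          have "T q \<in> B" unfolding B_def walk_below_def mem_Collect_eq
          proof (intro allI impI)
            fix z assume z: "z < v - u"
            have "walk pb qb 0 (T q) (Suc z) = (\<Sum>i\<in>{u..<u + Suc z}. w (Suc i, 0) - Y i)"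
              unfolding walk_def by (rule sum.reindex_bij_witness[of _ "\<lambda>i. i - u" "\<lambda>i. u + i"])
                 (auto simp: Y_def pb_def qb_def wX)
            also have "\<dots> \<le> (\<Sum>i\<in>{yy..<u}. Y i - w (Suc i, 0))"
              using z uv by (intro walk) auto
            also have "\<dots> \<le> x" using False by simp
            finally show "walk pb qb 0 (T q) (Suc z) \<le> x" .
          qed
          then show ?thesis by (simp add: space_big)
        qed
      qed simp
    qed
    show "S1 \<union> (T -` A \<inter> space big) \<union> (T -` B \<inter> space big) \<in> sets big"
      using S1(2) measurable_sets[OF T_meas A] measurable_sets[OF T_meas B] by auto
  qed
  also have "\<dots> \<le> measure big S1 + measure big' A + measure big' B"
  proof -
    have TA: "T -` A \<inter> space big \<in> sets big" "T -` B \<inter> space big \<in> sets big"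
      using measurable_sets[OF T_meas A] measurable_sets[OF T_meas B] by auto
    have "measure big (S1 \<union> (T -` A \<inter> space big) \<union> (T -` B \<inter> space big))
      \<le> measure big (S1 \<union> (T -` A \<inter> space big)) + measure big (T -` B \<inter> space big)"
      using S1(2) TA by (intro measure_Un_le) auto
    also have "measure big (S1 \<union> (T -` A \<inter> space big)) \<le> measure big S1 + measure big (T -` A \<inter> space big)"
      using S1(2) TA by (intro measure_Un_le) auto
    finally show ?thesis by (simp add: T_A T_B)
  qed
  finally have main: "measure ?P ?L \<le> measure big S1 + measure big' A + measure big' B" .

  interpret above: walk_field pa qa "u - 1" "case_sum (stat_rate \<rho>) (stat_rate (1 - \<mu>))" "1 - \<mu>" "1 - \<rho>"
    using \<rho> uv by unfold_locales (auto simp: pa_def qa_def inj_on_def stat_rate_def)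
  interpret below: walk_field pb qb "v - u" "case_sum (stat_rate \<rho>) (stat_rate (1 - \<mu>))" "1 - \<rho>" "1 - \<mu>"
    using \<rho> uv by unfold_locales (auto simp: pb_def qb_def inj_on_def stat_rate_def)
  have "emeasure big' A \<le> ennreal (exp (- \<theta> * x) * \<phi> ^ (u - 1))"
    unfolding A_def big'_def
    by (rule above.walk_above_bound[OF \<theta> \<phi>]) simp
  then have bA: "measure big' A \<le> exp (- \<theta> * x) * \<phi> ^ (u - 1)"
    using \<phi>(2) by (simp add: big'.emeasure_eq_measure)
  let ?c = "1 - (1 - \<mu>) / (1 - \<rho>) * exp (- (\<mu> - \<rho>) * x)" and ?d = "exp (- ((\<mu> - \<rho>) / 2) * x) * \<psi> ^ (v - u)"
  have c: "0 \<le> ?c"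
  proof -
    have "(1 - \<mu>) / (1 - \<rho>) * exp (- (\<mu> - \<rho>) * x) \<le> 1 * 1"
    proof (rule mult_mono)
      have "0 \<le> (\<mu> - \<rho>) * x" using \<rho> x by (intro mult_nonneg_nonneg) auto
      then show "exp (- (\<mu> - \<rho>) * x) \<le> 1" by (simp only: exp_le_one_iff mult_minus_left neg_le_0_iff_le)
    qed (use \<rho> in auto)
    then show ?thesis by simp
  qed
  have \<psi>0: "0 \<le> \<psi>" unfolding \<psi> using \<rho> by (intro mult_nonneg_nonneg divide_nonneg_nonneg) auto
  have "emeasure big' B \<le> ennreal ?c + ennreal ?d"
    unfolding B_def big'_def
    by (rule below.walk_below_bound) (use \<rho> x \<psi> in auto)
  also have "\<dots> = ennreal (?c + ?d)" using c \<psi>0 by (intro ennreal_plus[symmetric]) auto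
  finally have bB: "measure big' B \<le> ?c + ?d"
    using c \<psi>0 by (subst (asm) big'.emeasure_eq_measure, subst (asm) ennreal_le_iff) auto
  from main bA bB S1(1) show ?thesis by linarith
qed

section \<open>Choice of the scales\<close>

text \<open>
Transposition turns the claim into one about $D \ge 0$. The parameter $\rho+e$ moves the characteristic
direction by order $te$ to the left of $(m,n)$, and $M$ is smaller than $m$ by a small fraction of this
only.
\<close>

lemma exit_gap_off_characteristic:
  fixes \<rho> e t :: real
  assumes \<rho>: "0 < \<rho>" "\<rho> < 1" and e: "0 < e" "e \<le> (1 - \<rho>) / 2" "e \<le> \<rho>\<^sup>2 / 2" and t: "0 < t"
    and n: "real n \<le> \<rho>\<^sup>2 * t" and M: "(1 - \<rho>)\<^sup>2 * t * (1 - e / 16) - 1 \<le> real M"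
  shows "measure (exp_field (stat_rate (\<rho> + e))) {w. exit_gap w M n \<le> 0} \<le> exp (1 - t * e ^ 3 / 16)"
proof -
  define \<alpha> \<tau> \<sigma> where "\<alpha> = 1 - \<rho>" and "\<tau> = 1 - \<rho> - e / 2" and "\<sigma> = \<rho> + e / 2"
  have \<alpha>: "0 < \<alpha>" "\<alpha> < 1" using \<rho> by (auto simp: \<alpha>_def)
  have e\<alpha>: "e \<le> \<alpha> / 2" using e by (simp add: \<alpha>_def)
  have \<rho>2: "\<rho>\<^sup>2 \<le> \<rho>" using \<rho> by (simp add: power2_eq_square mult_left_le)
  have \<tau>: "\<alpha> / 2 \<le> \<tau>" "0 < \<tau>" using e e\<alpha> \<alpha> by (auto simp: \<tau>_def \<alpha>_def)
  have \<sigma>: "\<rho> \<le> \<sigma>" "0 < \<sigma>" using \<rho> e by (auto simp: \<sigma>_def)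
  have "measure (exp_field (stat_rate (\<rho> + e))) {w. exit_gap w M n \<le> 0}
      = measure (exp_field (stat_rate (1 - (\<rho> + e)))) {w. 0 \<le> exit_gap w n M}"
    by (rule measure_exit_gap_swap)
  also have "\<dots> \<le> exp ((e / 2)\<^sup>2 / 2 * (real n / \<sigma>\<^sup>2 + 2 * (e / 2)\<^sup>2 * real n / \<sigma> ^ 4 - real M / \<tau>\<^sup>2))"
  proof -
    have "1 - (1 - (\<rho> + e) + e / 2) = \<sigma>" "1 - (\<rho> + e) + e / 2 = \<tau>" by (auto simp: \<sigma>_def \<tau>_def)
    moreover have "0 < 1 - (\<rho> + e)" "0 < e / 2" "1 - (\<rho> + e) + 2 * (e / 2) < 1" "2 * (e / 2) \<le> \<sigma>"
      using e e\<alpha> \<alpha> \<rho> \<rho>2 by (auto simp: \<alpha>_def \<sigma>_def)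
    ultimately show ?thesis using exit_gap_bound_exp[of "1 - (\<rho> + e)" "e / 2" n M] by simp
  qed
  also have "\<dots> \<le> exp (1 - t * e ^ 3 / 16)"
  proof (subst exp_le_cancel_iff)
    have 1: "real n / \<sigma>\<^sup>2 \<le> t"
    proof -
      have "real n \<le> \<sigma>\<^sup>2 * t"
        using n \<sigma> \<rho> t by (meson mult_right_mono order_trans power_mono less_imp_le)
      then show ?thesis using \<sigma> by (simp add: divide_le_eq mult.commute)
    qed
    have 2: "2 * (e / 2)\<^sup>2 * real n / \<sigma> ^ 4 \<le> t * e / 4"
    proof -
      have "2 * (e / 2)\<^sup>2 * real n / \<sigma> ^ 4 = (e\<^sup>2 / 2) * (real n / \<sigma>\<^sup>2) / \<sigma>\<^sup>2"
        by (simp add: power2_eq_square power4_eq_xxxx)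
      also have "\<dots> \<le> (e\<^sup>2 / 2) * t / \<rho>\<^sup>2"
        using 1 \<sigma> \<rho> t by (intro frac_le mult_left_mono power_mono) auto
      also have "\<dots> = (t * e / 2) * (e / \<rho>\<^sup>2)" by (simp add: power2_eq_square)
      also have "\<dots> \<le> (t * e / 2) * (1 / 2)"
        using e t \<rho> by (intro mult_left_mono) (auto simp: divide_le_eq)
      finally show ?thesis by simp
    qed
    have 3: "t + t * e * 3 / 4 - 4 / \<alpha>\<^sup>2 \<le> real M / \<tau>\<^sup>2"
    proof -
      have "(1 + e / \<alpha>) * \<tau>\<^sup>2 = \<alpha>\<^sup>2 - e\<^sup>2 * (3 / 4 - e / (4 * \<alpha>))"
        using \<alpha> by (simp add: \<tau>_def \<alpha>_def[symmetric] field_simps power2_eq_square)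
      also have "\<dots> \<le> \<alpha>\<^sup>2"
      proof -
        have "e / (4 * \<alpha>) \<le> 3 / 4" using e\<alpha> \<alpha> by (simp add: divide_le_eq)
        then show ?thesis by simp
      qed
      finally have "(1 + e / \<alpha>) \<le> \<alpha>\<^sup>2 / \<tau>\<^sup>2" using \<tau> by (simp add: le_divide_eq)
      moreover have "e \<le> e / \<alpha>" using e \<alpha> by (simp add: le_divide_eq mult_left_le)
      ultimately have "(1 + e) * t \<le> \<alpha>\<^sup>2 / \<tau>\<^sup>2 * t" using t by (intro mult_right_mono) auto
      then have "t + t * e \<le> \<alpha>\<^sup>2 / \<tau>\<^sup>2 * t" by (simp add: algebra_simps)
      moreover have "(\<alpha>\<^sup>2 * t * e / 16 + 1) / \<tau>\<^sup>2 \<le> (\<alpha>\<^sup>2 * t * e / 16 + 1) / (\<alpha> / 2)\<^sup>2"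
        using \<tau> \<alpha> t e by (intro divide_left_mono power_mono add_nonneg_nonneg) auto
      moreover have "(\<alpha>\<^sup>2 * t * e / 16 + 1) / (\<alpha> / 2)\<^sup>2 = t * e / 4 + 4 / \<alpha>\<^sup>2"
        using \<alpha> by (simp add: field_simps power2_eq_square)
      moreover have "(\<alpha>\<^sup>2 * t * (1 - e / 16) - 1) / \<tau>\<^sup>2 = \<alpha>\<^sup>2 / \<tau>\<^sup>2 * t - (\<alpha>\<^sup>2 * t * e / 16 + 1) / \<tau>\<^sup>2"
        by (simp add: diff_divide_distrib add_divide_distrib algebra_simps)
      moreover have "(\<alpha>\<^sup>2 * t * (1 - e / 16) - 1) / \<tau>\<^sup>2 \<le> real M / \<tau>\<^sup>2"
        using M by (intro divide_right_mono) (auto simp: \<alpha>_def)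
      moreover have "a - r \<le> Y" if "a \<le> p" "q \<le> q'" "q' = r" "X = p - q" "X \<le> Y" for a p q q' r X Y :: real
        using that by linarith
      ultimately have "t + t * e - (t * e / 4 + 4 / \<alpha>\<^sup>2) \<le> real M / \<tau>\<^sup>2" by blast
      moreover have "t + t * e - (t * e / 4 + 4 / \<alpha>\<^sup>2) = t + t * e * 3 / 4 - 4 / \<alpha>\<^sup>2" by simp
      ultimately show ?thesis by (simp only:)
    qed
    have "(e / 2)\<^sup>2 / 2 * (real n / \<sigma>\<^sup>2 + 2 * (e / 2)\<^sup>2 * real n / \<sigma> ^ 4 - real M / \<tau>\<^sup>2)
      \<le> (e / 2)\<^sup>2 / 2 * (4 / \<alpha>\<^sup>2 - t * e / 2)"
      using 1 2 3 by (intro mult_left_mono) auto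
    also have "\<dots> = e\<^sup>2 / (2 * \<alpha>\<^sup>2) - t * e ^ 3 / 16"
      using \<alpha> by (simp add: field_simps power2_eq_square power3_eq_cube)
    also have "e\<^sup>2 / (2 * \<alpha>\<^sup>2) \<le> 1"
    proof -
      have "e\<^sup>2 \<le> \<alpha>\<^sup>2" using e e\<alpha> \<alpha> by (intro power_mono) auto
      then have "e\<^sup>2 \<le> 2 * \<alpha>\<^sup>2" using zero_le_power2[of \<alpha>] by linarith
      then show ?thesis using \<alpha> by (simp add: divide_le_eq)
    qed
    finally show "(e / 2)\<^sup>2 / 2 * (real n / \<sigma>\<^sup>2 + 2 * (e / 2)\<^sup>2 * real n / \<sigma> ^ 4 - real M / \<tau>\<^sup>2) \<le> 1 - t * e ^ 3 / 16"
      by simp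
  qed
  finally show ?thesis .
qed

text \<open>
The scales are tied to $e$, the increase of the parameter: the walks are followed for $v$ of order
$te$, the level is $\eta/e$, and the rise before $u$ is estimated with the exponent $Ae$. All four terms
are small when $te^3$ and $A\eta$ are large and $e$ and $\eta$ are small.
\<close>

lemma gap_window_bound:
  fixes \<rho> e t \<eta> A :: real
  assumes \<rho>: "0 < \<rho>" "\<rho> < 1" and e: "0 < e" "e \<le> (1 - \<rho>) / 2" "e \<le> \<rho>\<^sup>2 / 2"
    and t: "0 < t" "1 \<le> \<rho>\<^sup>2 * t" "2 \<le> (1 - \<rho>)\<^sup>2 * t"
    and \<eta>: "0 < \<eta>" and A: "0 < A" "8 * (A + A\<^sup>2) * e\<^sup>2 \<le> (1 - \<rho>)\<^sup>2" "A * e < (1 - \<rho>) / 2"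
    and u: "1 \<le> u" "4 * (A + A\<^sup>2) * e\<^sup>2 * real u \<le> (1 - \<rho>)\<^sup>2" "32 * real u \<le> (1 - \<rho>)\<^sup>2 * t * e"
  defines "m \<equiv> nat \<lfloor>(1 - \<rho>)\<^sup>2 * t\<rfloor>" and "n \<equiv> nat \<lfloor>\<rho>\<^sup>2 * t\<rfloor>"
  shows "measure (exp_field (stat_rate \<rho>)) {w. exit_gap w (m - u) n \<le> 0 \<and> 0 \<le> exit_gap w m n}
    \<le> exp (1 - t * e ^ 3 / 16) + exp (1 - A * \<eta>) + (e / (1 - \<rho>) + \<eta>)
      + exp (1 - (1 - \<rho>)\<^sup>2 * t * e ^ 3 / 128)"
proof -
  define \<alpha> \<beta> where "\<alpha> = 1 - \<rho>" and "\<beta> = 1 - (\<rho> + e)"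
  have \<alpha>: "0 < \<alpha>" "\<alpha> < 1" using \<rho> by (auto simp: \<alpha>_def)
  have \<beta>: "\<alpha> / 2 \<le> \<beta>" "0 < \<beta>" "\<beta> = \<alpha> - e" using e \<alpha> by (auto simp: \<beta>_def \<alpha>_def)
  define v where "v = nat \<lfloor>\<alpha>\<^sup>2 * t * e / 16\<rfloor>"
  have v: "real v \<le> \<alpha>\<^sup>2 * t * e / 16" "\<alpha>\<^sup>2 * t * e / 16 - 1 \<le> real v"
  proof -
    have "0 \<le> \<alpha>\<^sup>2 * t * e / 16" using t e by simp
    then show "real v \<le> \<alpha>\<^sup>2 * t * e / 16" "\<alpha>\<^sup>2 * t * e / 16 - 1 \<le> real v"
      unfolding v_def by linarith+
  qed
  have m: "real m \<le> \<alpha>\<^sup>2 * t" "\<alpha>\<^sup>2 * t - 1 \<le> real m"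
    using t(3) unfolding m_def \<alpha>_def by linarith+
  have n: "real n \<le> \<rho>\<^sup>2 * t" using t unfolding n_def by simp
  have n1: "1 \<le> n" using t(2) unfolding n_def by linarith
  have e1: "e \<le> 1" using e \<alpha> by (simp add: \<alpha>_def)
  have uv: "u \<le> v"
  proof -
    have "real u \<le> \<alpha>\<^sup>2 * t * e / 16 - real u" using u(3) by (simp add: \<alpha>_def)
    also have "\<dots> \<le> \<alpha>\<^sup>2 * t * e / 16 - 1" using u(1) by simp
    finally show ?thesis using v(2) by linarith
  qed
  have vm: "v \<le> m"
  proof -
    have "\<alpha>\<^sup>2 * t * e \<le> \<alpha>\<^sup>2 * t * 1" using e1 t by (intro mult_left_mono) auto
    then have "real v \<le> \<alpha>\<^sup>2 * t / 16" using v(1) by simp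
    also have "\<dots> \<le> \<alpha>\<^sup>2 * t - 1" using t(3) unfolding \<alpha>_def[symmetric] by linarith
    finally show ?thesis using m(2) by linarith
  qed
  have um: "u \<le> m" "1 \<le> m" using u(1) uv vm by auto
  define \<theta> \<phi> \<psi> y where "\<theta> = A * e" and "\<phi> = \<beta> / (\<beta> - \<theta>) * (\<alpha> / (\<alpha> + \<theta>))"
    and "\<psi> = \<alpha> / (\<alpha> - e / 2) * (\<beta> / (\<beta> + e / 2))" and "y = (\<theta> * e + \<theta>\<^sup>2) / (\<alpha> * \<beta>)"
  have \<theta>: "0 < \<theta>" "\<theta> < \<beta>" using A e \<beta> by (auto simp: \<theta>_def \<alpha>_def)
  have y: "0 \<le> y" "y \<le> 2 * (A + A\<^sup>2) * e\<^sup>2 / \<alpha>\<^sup>2"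
  proof -
    show "0 \<le> y" using \<theta> e \<alpha> \<beta> by (simp add: y_def)
    have "y \<le> (\<theta> * e + \<theta>\<^sup>2) / (\<alpha> * (\<alpha> / 2))"
      unfolding y_def using \<theta> e \<alpha> \<beta> by (intro divide_left_mono mult_left_mono mult_pos_pos) auto
    also have "\<dots> = 2 * (A + A\<^sup>2) * e\<^sup>2 / \<alpha>\<^sup>2" by (simp add: \<theta>_def power2_eq_square algebra_simps)
    finally show "y \<le> 2 * (A + A\<^sup>2) * e\<^sup>2 / \<alpha>\<^sup>2" .
  qed
  have y4: "y \<le> 1 / 4"
  proof -
    have "2 * (A + A\<^sup>2) * e\<^sup>2 / \<alpha>\<^sup>2 \<le> 1 / 4" using A(2) \<alpha> by (simp add: divide_le_eq \<alpha>_def algebra_simps)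
    then show ?thesis using y by simp
  qed
  have \<phi>y: "\<phi> = 1 / (1 - y)"
  proof -
    have "(\<beta> - \<theta>) * (\<alpha> + \<theta>) = \<alpha> * \<beta> - (\<theta> * e + \<theta>\<^sup>2)"
      by (simp add: \<beta>(3) algebra_simps power2_eq_square)
    moreover have "1 - y = (\<alpha> * \<beta> - (\<theta> * e + \<theta>\<^sup>2)) / (\<alpha> * \<beta>)"
      using \<alpha> \<beta> by (simp add: y_def diff_divide_distrib)
    ultimately have "1 - y = ((\<beta> - \<theta>) * (\<alpha> + \<theta>)) / (\<alpha> * \<beta>)" by simp
    then show ?thesis by (simp add: \<phi>_def)
  qed
  have \<phi>1: "1 \<le> \<phi>" using y y4 by (simp add: \<phi>y)
  have early: "measure (exp_field (stat_rate \<rho>)) {w. late_exit m n u w \<le> early_exit m n u w}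
    \<le> measure (exp_field (stat_rate (\<rho> + e))) {w. exit_gap w (m - v) n \<le> 0}
      + exp (- \<theta> * (\<eta> / e)) * \<phi> ^ (u - 1)
      + ((1 - \<beta> / \<alpha> * exp (- e * (\<eta> / e))) + exp (- (e / 2) * (\<eta> / e)) * \<psi> ^ (v - u))"
    using early_exit_bound[of \<rho> "\<rho> + e" u v m n \<theta> "\<eta> / e" \<phi> \<psi>]
      \<rho> e u(1) uv vm n1 \<theta> \<eta> \<phi>1 \<beta>
    by (simp add: \<alpha>_def[symmetric] \<beta>_def[symmetric] \<phi>_def \<psi>_def)
  have T1: "measure (exp_field (stat_rate (\<rho> + e))) {w. exit_gap w (m - v) n \<le> 0} \<le> exp (1 - t * e ^ 3 / 16)"
  proof (rule exit_gap_off_characteristic[OF \<rho> e t(1) n])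
    have "(1 - \<rho>)\<^sup>2 * t * (1 - e / 16) - 1 = \<alpha>\<^sup>2 * t - 1 - \<alpha>\<^sup>2 * t * e / 16"
      by (simp add: \<alpha>_def algebra_simps)
    also have "\<dots> \<le> real m - real v" using m v by linarith
    finally show "(1 - \<rho>)\<^sup>2 * t * (1 - e / 16) - 1 \<le> real (m - v)" using vm by (simp add: of_nat_diff)
  qed
  have T2: "exp (- \<theta> * (\<eta> / e)) * \<phi> ^ (u - 1) \<le> exp (1 - A * \<eta>)"
  proof -
    have "\<phi> ^ (u - 1) \<le> \<phi> ^ u" using \<phi>1 by (intro power_increasing) auto
    also have "\<phi> ^ u = 1 / (1 - y) ^ u" by (simp add: \<phi>y power_one_over)
    also have "\<dots> \<le> exp ((y + 2 * y\<^sup>2) * real u)"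
      using y y4 by (intro inverse_power_one_minus_le_exp) auto
    also have "\<dots> \<le> exp 1"
    proof (subst exp_le_cancel_iff)
      have "y * y \<le> y * (1 / 4)" using y y4 by (intro mult_left_mono) auto
      then have "2 * y\<^sup>2 \<le> y" using y by (simp add: power2_eq_square)
      then have "(y + 2 * y\<^sup>2) * real u \<le> (2 * y) * real u" by (intro mult_right_mono) auto
      also have "\<dots> \<le> (2 * (2 * (A + A\<^sup>2) * e\<^sup>2 / \<alpha>\<^sup>2)) * real u"
        by (intro mult_right_mono mult_left_mono y(2)) auto
      also have "\<dots> \<le> 1" using u(2) \<alpha> by (simp add: divide_le_eq \<alpha>_def algebra_simps)
      finally show "(y + 2 * y\<^sup>2) * real u \<le> 1" .
    qed
    finally have "exp (- \<theta> * (\<eta> / e)) * \<phi> ^ (u - 1) \<le> exp (- \<theta> * (\<eta> / e)) * exp 1"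
      by (intro mult_left_mono) auto
    also have "\<dots> = exp (1 - A * \<eta>)" using e by (simp add: exp_add[symmetric] \<theta>_def)
    finally show ?thesis .
  qed
  have T3: "1 - \<beta> / \<alpha> * exp (- e * (\<eta> / e)) \<le> e / (1 - \<rho>) + \<eta>"
  proof -
    have "\<beta> / \<alpha> * (1 - \<eta>) \<le> \<beta> / \<alpha> * exp (- \<eta>)"
      using exp_ge_add_one_self[of "- \<eta>"] \<alpha> \<beta> by (intro mult_left_mono) auto
    moreover have "\<beta> / \<alpha> = 1 - e / \<alpha>" using \<alpha> by (simp add: \<beta>(3) diff_divide_distrib)
    moreover have "\<beta> / \<alpha> * \<eta> \<le> 1 * \<eta>" using \<alpha> \<beta> e \<eta> by (intro mult_right_mono) auto
    moreover have "1 - b * E \<le> d + \<eta>" if "b * (1 - \<eta>) \<le> b * E" "b = 1 - d" "b * \<eta> \<le> 1 * \<eta>" for b d E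
    proof -
      have "b - b * \<eta> \<le> b * E" using that(1) by (simp only: right_diff_distrib mult_1_right)
      then show ?thesis using that(2,3) by linarith
    qed
    ultimately have "1 - \<beta> / \<alpha> * exp (- \<eta>) \<le> e / \<alpha> + \<eta>" by blast
    then show ?thesis using e by (simp add: \<alpha>_def)
  qed
  have T4: "exp (- (e / 2) * (\<eta> / e)) * \<psi> ^ (v - u) \<le> exp (1 - (1 - \<rho>)\<^sup>2 * t * e ^ 3 / 128)"
  proof -
    have s: "\<alpha> - e / 2 = \<beta> + e / 2" "0 < \<beta> + e / 2" using \<beta> e by auto
    have "\<alpha> * \<beta> = (\<beta> + e / 2)\<^sup>2 - (e / 2)\<^sup>2"
      by (simp add: \<beta>(3) power2_eq_square algebra_simps)
    then have "\<psi> = 1 - (e / 2)\<^sup>2 / (\<beta> + e / 2)\<^sup>2"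
      using s by (simp add: \<psi>_def s(1) power2_eq_square diff_divide_distrib)
    moreover have "(e / 2)\<^sup>2 / 1 \<le> (e / 2)\<^sup>2 / (\<beta> + e / 2)\<^sup>2"
      using s \<beta> \<alpha> e by (intro divide_left_mono power_le_one) auto
    ultimately have "\<psi> \<le> 1 - e\<^sup>2 / 4" by (simp add: power_divide)
    moreover have "0 \<le> \<psi>" using \<alpha> \<beta> s unfolding \<psi>_def by (intro mult_nonneg_nonneg divide_nonneg_nonneg) auto
    ultimately have "\<psi> ^ (v - u) \<le> (1 - e\<^sup>2 / 4) ^ (v - u)" by (intro power_mono)
    also have "\<dots> \<le> exp (- (e\<^sup>2 / 4 * real (v - u)))"
    proof (rule power_one_minus_le_exp)
      have "e\<^sup>2 \<le> 1" using e e1 by (intro power_le_one) auto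
      then show "e\<^sup>2 / 4 \<le> 1" by simp
    qed simp
    also have "\<dots> \<le> exp (1 - (1 - \<rho>)\<^sup>2 * t * e ^ 3 / 128)"
    proof (subst exp_le_cancel_iff)
      have "\<alpha>\<^sup>2 * t * e / 32 - 1 \<le> real (v - u)"
        using v(2) u(3) uv by (simp add: of_nat_diff \<alpha>_def)
      then have "e\<^sup>2 / 4 * (\<alpha>\<^sup>2 * t * e / 32 - 1) \<le> e\<^sup>2 / 4 * real (v - u)" by (intro mult_left_mono) auto
      moreover have "e\<^sup>2 / 4 * (\<alpha>\<^sup>2 * t * e / 32 - 1) = \<alpha>\<^sup>2 * t * e ^ 3 / 128 - e\<^sup>2 / 4"
        by (simp add: power2_eq_square power3_eq_cube algebra_simps)
      moreover have "e\<^sup>2 \<le> 1" using e e1 by (intro power_le_one) auto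
      ultimately show "- (e\<^sup>2 / 4 * real (v - u)) \<le> 1 - (1 - \<rho>)\<^sup>2 * t * e ^ 3 / 128"
        unfolding \<alpha>_def by linarith
    qed
    finally have "\<psi> ^ (v - u) \<le> exp (1 - (1 - \<rho>)\<^sup>2 * t * e ^ 3 / 128)" .
    moreover have "exp (- (e / 2) * (\<eta> / e)) \<le> 1" using e \<eta> by simp
    moreover have "0 \<le> \<psi> ^ (v - u)" using \<open>0 \<le> \<psi>\<close> by simp
    ultimately show ?thesis
      using mult_mono[of "exp (- (e / 2) * (\<eta> / e))" 1 "\<psi> ^ (v - u)" "exp (1 - (1 - \<rho>)\<^sup>2 * t * e ^ 3 / 128)"] by simp
  qed
  have "measure (exp_field (stat_rate \<rho>)) {w. exit_gap w (m - u) n \<le> 0 \<and> 0 \<le> exit_gap w m n}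
    \<le> measure (exp_field (stat_rate \<rho>)) {w. late_exit m n u w \<le> early_exit m n u w}"
    using \<rho> um by (intro gap_window_le_early_exit)
  with early T1 T2 T3 T4 show ?thesis by linarith
qed

text \<open>
Now $e = K t^{-1/3}$, hence $te^3 = K^3$ and $u$ of order $\delta t^{2/3} = \delta K^2/e^2$. The
constants are chosen in the order $K$, $\eta$, $A$, $\delta$, each depending on the preceding ones.
\<close>

lemma Zstar_at_window:
  fixes \<rho> \<epsilon> :: real
  assumes \<rho>: "0 < \<rho>" "\<rho> < 1" and \<epsilon>: "0 < \<epsilon>"
  shows "\<exists>\<delta>>0. \<forall>\<^sub>F t in at_top. \<forall>(M :: 'a measure) \<omega>. stationary_lpp M \<omega> \<rho> \<longrightarrow>
    \<P>(x in M. 1 \<le> Zstar_at \<rho> (\<lambda>p. \<omega> p x) t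
           \<and> Zstar_at \<rho> (\<lambda>p. \<omega> p x) t \<le> \<delta> * t powr (2/3)) \<le> \<epsilon>"
proof -
  \<comment> \<open>Each of the five terms in the end must be at most $\epsilon/5$. For this, $R$ is so large that $e^{1-z} \le \epsilon/5$ for $z \ge R$, and both $K^3/16$ and $\alpha^2 K^3/128$ are at least $R$.\<close>
  define \<alpha> R K \<eta> A where "\<alpha> = 1 - \<rho>" and "R = max 1 (1 + ln (5 / \<epsilon>))"
    and "K = 16 * R + 128 * R / \<alpha>\<^sup>2" and "\<eta> = \<epsilon> / 5" and "A = R / \<eta>"
  define \<delta> where "\<delta> = min (\<alpha>\<^sup>2 / (4 * (A + A\<^sup>2) * K\<^sup>2)) (\<alpha>\<^sup>2 * K / 32)"
  have \<alpha>: "0 < \<alpha>" "\<alpha> < 1" using \<rho> by (auto simp: \<alpha>_def)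
  have R: "1 \<le> R" by (simp add: R_def)
  have small: "exp (1 - z) \<le> \<epsilon> / 5" if "R \<le> z" for z
  proof -
    have "1 - z \<le> - ln (5 / \<epsilon>)" using that by (simp add: R_def)
    then have "exp (1 - z) \<le> exp (- ln (5 / \<epsilon>))" by simp
    also have "\<dots> = \<epsilon> / 5" using \<epsilon> by (simp add: exp_minus)
    finally show ?thesis .
  qed
  have K: "16 * R \<le> K" "128 * R / \<alpha>\<^sup>2 \<le> K" "1 \<le> K" using R \<alpha> by (auto simp: K_def add_increasing2)
  have K3: "K \<le> K ^ 3" using K(3) power_increasing[of 1 3 K] by simp
  have \<eta>: "0 < \<eta>" using \<epsilon> by (simp add: \<eta>_def)
  have A: "0 < A" "A * \<eta> = R" using R \<eta> by (auto simp: A_def)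
  have AA: "0 < A + A\<^sup>2" using A by (simp add: add_pos_pos)
  have \<delta>: "0 < \<delta>" using \<alpha> AA K by (auto simp: \<delta>_def)
  have \<delta>_le: "\<delta> \<le> \<alpha>\<^sup>2 / (4 * (A + A\<^sup>2) * K\<^sup>2)" "\<delta> \<le> \<alpha>\<^sup>2 * K / 32"
    unfolding \<delta>_def by (rule min.cobounded1, rule min.cobounded2)
  \<comment> \<open>The smallness of $e$ that the bound on the window and the last term require.\<close>
  define e1 where "e1 = Min {\<alpha> / 2, \<rho>\<^sup>2 / 2, \<alpha> / (4 * A), \<alpha>\<^sup>2 / (8 * (A + A\<^sup>2)), \<alpha> * \<epsilon> / 5}"
  have e1: "0 < e1" using \<alpha> \<rho> A AA \<epsilon> by (simp add: e1_def)
  have e1_le: "e1 \<le> \<alpha> / 2" "e1 \<le> \<rho>\<^sup>2 / 2" "e1 \<le> \<alpha> / (4 * A)" "e1 \<le> \<alpha>\<^sup>2 / (8 * (A + A\<^sup>2))" "e1 \<le> \<alpha> * \<epsilon> / 5"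
    unfolding e1_def by (rule Min_le; simp)+
  have "((\<lambda>t::real. K * t powr (- (1/3))) \<longlongrightarrow> 0) at_top"
    by (intro tendsto_mult_right_zero tendsto_neg_powr filterlim_ident) auto
  then have "\<forall>\<^sub>F t::real in at_top. K * t powr (- (1/3)) < e1"
    using e1 by (rule order_tendstoD(2))
  moreover have "\<forall>\<^sub>F t::real in at_top. 1 / \<rho>\<^sup>2 + 2 / \<alpha>\<^sup>2 < t" by (rule eventually_gt_at_top)
  ultimately have "\<forall>\<^sub>F t in at_top. \<forall>(M :: 'a measure) \<omega>. stationary_lpp M \<omega> \<rho> \<longrightarrow>
    \<P>(x in M. 1 \<le> Zstar_at \<rho> (\<lambda>p. \<omega> p x) t
           \<and> Zstar_at \<rho> (\<lambda>p. \<omega> p x) t \<le> \<delta> * t powr (2/3)) \<le> \<epsilon>"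
  proof eventually_elim
    case (elim t)
    have "0 < 1 / \<rho>\<^sup>2" "0 < 2 / \<alpha>\<^sup>2" using \<rho> \<alpha> by auto
    then have t: "0 < t" "1 / \<rho>\<^sup>2 \<le> t" "2 / \<alpha>\<^sup>2 \<le> t" using elim(2) by linarith+
    have t': "1 \<le> \<rho>\<^sup>2 * t" "2 \<le> \<alpha>\<^sup>2 * t" using t \<rho> \<alpha> by (auto simp: divide_le_eq mult.commute)
    define e where "e = K * t powr (- (1/3))"
    have e: "0 < e" "e \<le> e1" using K t elim(1) by (auto simp: e_def)
    have e_le1: "e \<le> 1" using e e1_le \<alpha> by simp
    define T where "T = t powr (2/3)"
    have T: "0 < T" using t by (simp add: T_def)
    have te: "t * e = K * T"
    proof -
      have "t * t powr (- (1/3)) = t powr (1 + - (1/3))" using t by (subst powr_add) auto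
      then show ?thesis by (simp add: e_def T_def mult.left_commute)
    qed
    have eT: "e\<^sup>2 * T = K\<^sup>2"
    proof -
      have "(t powr (- (1/3)))\<^sup>2 * T = t powr (- (1/3) + - (1/3) + 2/3)"
        using t by (simp only: powr_add power2_eq_square T_def)
      also have "\<dots> = 1" using t by simp
      finally show ?thesis by (simp add: e_def power_mult_distrib)
    qed
    have te3: "t * e ^ 3 = K ^ 3"
    proof -
      have "t * e ^ 3 = (t * e) * e\<^sup>2" by (simp add: power2_eq_square power3_eq_cube)
      also have "\<dots> = K * (e\<^sup>2 * T)" by (simp add: te)
      also have "\<dots> = K ^ 3" by (simp only: eT) (simp add: power2_eq_square power3_eq_cube)
      finally show ?thesis .
    qed
    define u m n where "u = nat \<lfloor>\<delta> * T\<rfloor>" and "m = nat \<lfloor>(1 - \<rho>)\<^sup>2 * t\<rfloor>" and "n = nat \<lfloor>\<rho>\<^sup>2 * t\<rfloor>"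
    have n1: "1 \<le> n" using t'(1) unfolding n_def by linarith
    have u\<delta>: "real u \<le> \<delta> * T" using \<delta> T unfolding u_def by simp
    show ?case
    proof (intro allI impI)
      fix M :: "'a measure" and \<omega> assume st: "stationary_lpp M \<omega> \<rho>"
      have incl: "1 \<le> u \<and> exit_gap w (m - u) n \<le> 0 \<and> 0 \<le> exit_gap w m n"
        if w: "\<And>p. 0 \<le> w p" "w (0, 0) = 0" and Z: "1 \<le> Zstar_at \<rho> w t \<and> Zstar_at \<rho> w t \<le> \<delta> * t powr (2/3)" for w
      proof -
        have Z': "1 \<le> Zstar w m n" "Zstar w m n \<le> \<delta> * T" using Z by (auto simp: Zstar_at_def m_def n_def T_def)
        then have "0 < Zstar w m n" by simp
        then obtain v k where v: "v < m" "Zstar w m n = real m - real v" by (rule Zstar_pos_cases)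
        then have "Zstar w m n = real (m - v)" by simp
        with Z'(2) have "m - v \<le> u" unfolding u_def by (simp add: le_nat_floor)
        then have "Zstar w m n \<le> real u" "1 \<le> u" using v by auto
        then show ?thesis using Zstar_window_imp_exit_gap[of w n m u, OF w n1 Z'(1)] by simp
      qed
      show "\<P>(x in M. 1 \<le> Zstar_at \<rho> (\<lambda>p. \<omega> p x) t \<and> Zstar_at \<rho> (\<lambda>p. \<omega> p x) t \<le> \<delta> * t powr (2/3)) \<le> \<epsilon>"
      proof (cases "1 \<le> u")
        case False
        have "measure M {x \<in> space M. 1 \<le> Zstar_at \<rho> (\<lambda>p. \<omega> p x) t \<and> Zstar_at \<rho> (\<lambda>p. \<omega> p x) t \<le> \<delta> * t powr (2/3)}
          \<le> measure (exp_field (stat_rate \<rho>)) {}"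
          by (rule measure_stationary_lpp[OF st \<rho>, where P = "\<lambda>w. 1 \<le> Zstar_at \<rho> w t \<and> Zstar_at \<rho> w t \<le> \<delta> * t powr (2/3)"])
             (use incl False in auto)
        then show ?thesis using \<epsilon> by simp
      next
        case True
        have window: "{w. exit_gap w (m - u) n \<le> 0 \<and> 0 \<le> exit_gap w m n} \<in> sets field_space"
          by (rule sets_field_Collect) measurable
        have "measure M {x \<in> space M. 1 \<le> Zstar_at \<rho> (\<lambda>p. \<omega> p x) t \<and> Zstar_at \<rho> (\<lambda>p. \<omega> p x) t \<le> \<delta> * t powr (2/3)}
          \<le> measure (exp_field (stat_rate \<rho>)) {w. exit_gap w (m - u) n \<le> 0 \<and> 0 \<le> exit_gap w m n}"
          by (rule measure_stationary_lpp[OF st \<rho> window, where P = "\<lambda>w. 1 \<le> Zstar_at \<rho> w t \<and> Zstar_at \<rho> w t \<le> \<delta> * t powr (2/3)"])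
             (use incl in auto)
        also have "\<dots> \<le> exp (1 - t * e ^ 3 / 16) + exp (1 - A * \<eta>) + (e / (1 - \<rho>) + \<eta>)
            + exp (1 - (1 - \<rho>)\<^sup>2 * t * e ^ 3 / 128)"
          unfolding m_def n_def
        proof (rule gap_window_bound[OF \<rho> e(1) _ _ t(1) t'(1) _ \<eta> A(1) _ _ True])
          show "e \<le> (1 - \<rho>) / 2" "e \<le> \<rho>\<^sup>2 / 2" using e e1_le by (auto simp: \<alpha>_def)
          show "2 \<le> (1 - \<rho>)\<^sup>2 * t" using t' by (simp add: \<alpha>_def)
          have "e \<le> \<alpha>\<^sup>2 / (8 * (A + A\<^sup>2))" using e e1_le by simp
          then have "8 * (A + A\<^sup>2) * e \<le> \<alpha>\<^sup>2" using AA by (simp add: le_divide_eq mult.commute)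
          moreover have "e\<^sup>2 \<le> e" using e e_le1 by (simp add: power2_eq_square mult_left_le)
          then have "8 * (A + A\<^sup>2) * e\<^sup>2 \<le> 8 * (A + A\<^sup>2) * e" using AA by (intro mult_left_mono) auto
          ultimately show "8 * (A + A\<^sup>2) * e\<^sup>2 \<le> (1 - \<rho>)\<^sup>2" by (simp add: \<alpha>_def)
          have "e \<le> \<alpha> / (4 * A)" using e e1_le by simp
          then have "A * e \<le> \<alpha> / 4" using A by (simp add: le_divide_eq mult_ac)
          then show "A * e < (1 - \<rho>) / 2" using \<alpha> by (simp add: \<alpha>_def)
          have "4 * (A + A\<^sup>2) * e\<^sup>2 * real u \<le> 4 * (A + A\<^sup>2) * e\<^sup>2 * (\<delta> * T)"
            using u\<delta> AA by (intro mult_left_mono) auto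
          also have "\<dots> = \<delta> * (4 * (A + A\<^sup>2) * K\<^sup>2)" by (simp add: eT[symmetric])
          also have "\<dots> \<le> \<alpha>\<^sup>2 / (4 * (A + A\<^sup>2) * K\<^sup>2) * (4 * (A + A\<^sup>2) * K\<^sup>2)"
            using AA by (intro mult_right_mono \<delta>_le(1)) auto
          also have "\<dots> = \<alpha>\<^sup>2" using AA K by simp
          finally show "4 * (A + A\<^sup>2) * e\<^sup>2 * real u \<le> (1 - \<rho>)\<^sup>2" by (simp add: \<alpha>_def)
          have "32 * real u \<le> 32 * (\<delta> * T)" using u\<delta> by simp
          also have "\<dots> \<le> 32 * (\<alpha>\<^sup>2 * K / 32 * T)" using T by (intro mult_left_mono mult_right_mono \<delta>_le(2)) auto
          also have "\<dots> = \<alpha>\<^sup>2 * (t * e)" by (simp add: te)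
          finally show "32 * real u \<le> (1 - \<rho>)\<^sup>2 * t * e" by (simp add: \<alpha>_def mult.assoc)
        qed
        also have "\<dots> \<le> \<epsilon> / 5 + \<epsilon> / 5 + (\<epsilon> / 5 + \<epsilon> / 5) + \<epsilon> / 5"
        proof (intro add_mono)
          show "exp (1 - t * e ^ 3 / 16) \<le> \<epsilon> / 5" using K K3 by (intro small) (simp add: te3)
          show "exp (1 - A * \<eta>) \<le> \<epsilon> / 5" by (intro small) (simp add: A)
          have "e \<le> \<alpha> * \<epsilon> / 5" using e e1_le by simp
          then show "e / (1 - \<rho>) \<le> \<epsilon> / 5" using \<alpha> by (simp add: \<alpha>_def[symmetric] divide_le_eq mult.commute)
          show "\<eta> \<le> \<epsilon> / 5" by (simp add: \<eta>_def)
          have "128 * R / \<alpha>\<^sup>2 \<le> K ^ 3" using K(2) K3 by linarith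
          then have "128 * R \<le> \<alpha>\<^sup>2 * K ^ 3" using \<alpha> by (simp add: divide_le_eq mult.commute)
          then show "exp (1 - (1 - \<rho>)\<^sup>2 * t * e ^ 3 / 128) \<le> \<epsilon> / 5"
            by (intro small) (simp add: mult.assoc te3 \<alpha>_def)
        qed
        finally show ?thesis by simp
      qed
    qed
  qed
  with \<delta> show ?thesis by blast
qed

theorem corollary2p3:
  fixes \<rho> :: real
  assumes "0 < \<rho>" and "\<rho> < 1"
  shows
    "(\<forall>t0>0. \<exists>C::real. \<forall>(M :: 'a measure) \<omega>. stationary_lpp M \<omega> \<rho> \<longrightarrow>
        (\<forall>a>0. \<forall>t\<ge>t0.
          \<P>(x in M. Zstar_at \<rho> (\<lambda>p. \<omega> p x) t \<ge> a * t powr (2/3)) \<le> C * a powr (-3)))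
     \<and>
     (\<forall>\<epsilon>>0. \<exists>\<delta>>0. \<forall>\<^sub>F t in at_top. \<forall>(M :: 'a measure) \<omega>. stationary_lpp M \<omega> \<rho> \<longrightarrow>
          \<P>(x in M. 1 \<le> Zstar_at \<rho> (\<lambda>p. \<omega> p x) t
                 \<and> Zstar_at \<rho> (\<lambda>p. \<omega> p x) t \<le> \<delta> * t powr (2/3)) \<le> \<epsilon>)"
proof (intro conjI allI impI)
  fix t0 :: real assume "0 < t0"
  obtain C where C: "\<forall>(M :: 'a measure) \<omega>. stationary_lpp M \<omega> \<rho> \<longrightarrow> (\<forall>a>0. \<forall>t>0.
      \<P>(x in M. Zstar_at \<rho> (\<lambda>p. \<omega> p x) t \<ge> a * t powr (2/3)) \<le> C * a powr (-3))"
    using Zstar_at_tail[OF assms] by blast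
  show "\<exists>C::real. \<forall>(M :: 'a measure) \<omega>. stationary_lpp M \<omega> \<rho> \<longrightarrow>
        (\<forall>a>0. \<forall>t\<ge>t0.
          \<P>(x in M. Zstar_at \<rho> (\<lambda>p. \<omega> p x) t \<ge> a * t powr (2/3)) \<le> C * a powr (-3))"
    using C \<open>0 < t0\<close> by (intro exI[of _ C]) (meson less_le_trans)
next
  fix \<epsilon> :: real assume "0 < \<epsilon>"
  then show "\<exists>\<delta>>0. \<forall>\<^sub>F t in at_top. \<forall>(M :: 'a measure) \<omega>. stationary_lpp M \<omega> \<rho> \<longrightarrow>
          \<P>(x in M. 1 \<le> Zstar_at \<rho> (\<lambda>p. \<omega> p x) t
                 \<and> Zstar_at \<rho> (\<lambda>p. \<omega> p x) t \<le> \<delta> * t powr (2/3)) \<le> \<epsilon>"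
    by (rule Zstar_at_window[OF assms])
qed

end
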